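(* Under Assumption (A), with the chain started at an initial state as in (I), for every $0<c<1$ define $K_c(n):=\min\{k:\|\mathcal L(X^{(k)})-\pi\|_{\mathrm{TV}}\le c\}$. Then there exist $N_c$ and $\bar K_c$, both not depending on $n$, such that $K_c(n)\le\bar K_c$ for all $n\ge N_c$.
   Context: Fix $V>0$, $a>0$, $b_0>0$. For each $n\ge2$ observed data $Y_1,\dots,Y_n\in\mathbb R$ are given; $\bar Y=\frac1n\sum_iY_i$, $\Delta=\Delta_n=\sum_{i=1}^n(Y_i-\bar Y)^2$. Model: $Y_i\mid\theta_i\sim\mathcal N(\theta_i,V)$, $\theta_i\mid\mu,A\sim\mathcal N(\mu,A)$ independently ($1\le i\le n$), flat prior on $\mu\in\mathbb R$, $A\sim\mathrm{IG}(a,b_0)$ (density $\propto A^{-a-1}e^{-b_0/A}$ on $(0,\infty)$). The posterior $\pi$ on $\mathcal X=(0,\infty)\times\mathbb R\times\mathbb R^n$, $x=(A,\mu,\theta_1,\dots,\theta_n)$, has density $\propto A^{-a-1}e^{-b_0/A}\prod_{i=1}^n A^{-1/2}e^{-(\theta_i-\mu)^2/(2A)}e^{-(Y_i-\theta_i)^2/(2V)}$. Write $\bar\theta=\frac1n\sum_i\theta_i$. The Gibbs sampler $X^{(k)}=(A^{(k)},\mu^{(k)},\theta^{(k)}_1,\dots,\theta^{(k)}_n)$ updates: $\mu^{(k+1)}\sim\mathcal N(\bar\theta^{(k)},A^{(k)}/n)$; then independently $\theta_i^{(k+1)}\sim\mathcal N\big(\frac{\mu^{(k+1)}V+Y_iA^{(k)}}{V+A^{(k)}},\frac{A^{(k)}V}{V+A^{(k)}}\big)$,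 $i=1,\dots,n$; then $A^{(k+1)}\sim\mathrm{IG}\big(a+\frac{n-1}2,\ b_0+\frac12\sum_i(\theta_i^{(k+1)}-\bar\theta^{(k+1)})^2\big)$. Assumption (A): there are $\delta>0$, $M<\infty$ and an integer $N_0$ with $\frac{\Delta_n}{n-1}\le M$ for all $n$ and $\frac{\Delta_n}{n-1}\ge V+\delta$ for all $n\ge N_0$. Initial state (I): $x^{(0)}=(A^{(0)},\mu^{(0)},\theta^{(0)}_1,\dots,\theta^{(0)}_n)$ with $\bar\theta^{(0)}=\bar Y$, $\mu^{(0)}$ arbitrary, and $A^{(0)}=\frac{\Delta}{n-1}-V$ if $\frac{\Delta}{n-1}>V$, $A^{(0)}=\frac{\Delta}{n-1}$ otherwise. $\|\cdot\|_{\mathrm{TV}}$ is total variation distance. *)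

theory Defs
  imports "HOL-Probability.Probability"
begin

type_synonym state = "real \<times> real \<times> (nat \<Rightarrow> real)"
  (* x = (A, mu, theta); theta i is meaningful for i < n *)

definition state_space :: "nat \<Rightarrow> state measure" where
  "state_space n = lborel \<Otimes>\<^sub>M lborel \<Otimes>\<^sub>M PiM {..<n} (\<lambda>_. lborel)"

definition avg :: "nat \<Rightarrow> (nat \<Rightarrow> real) \<Rightarrow> real" where
  "avg n y = (\<Sum>i<n. y i) / real n"

definition ssq :: "nat \<Rightarrow> (nat \<Rightarrow> real) \<Rightarrow> real" where
  "ssq n y = (\<Sum>i<n. (y i - avg n y)\<^sup>2)"

definition normal_measure :: "real \<Rightarrow> real \<Rightarrow> real measure" where
  "normal_measure m v = density lborel (normal_density m (sqrt v))"

definition IG_measure :: "real \<Rightarrow> real \<Rightarrow> real measure" where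
  "IG_measure al be = density lborel
     (\<lambda>x. if x > 0 then be powr al / Gamma al * x powr (- al - 1) * exp (- be / x) else 0)"

definition gibbs_step :: "nat \<Rightarrow> (nat \<Rightarrow> real) \<Rightarrow> real \<Rightarrow> real \<Rightarrow> real \<Rightarrow> state \<Rightarrow> state measure" where
  "gibbs_step n Y V a b0 x = (case x of (A, mu, th) \<Rightarrow>
     Giry_Monad.bind (normal_measure (avg n th) (A / real n)) (\<lambda>mu'.
     Giry_Monad.bind (PiM {..<n} (\<lambda>i. normal_measure ((mu' * V + Y i * A) / (V + A)) (A * V / (V + A)))) (\<lambda>th'.
     Giry_Monad.bind (IG_measure (a + (real n - 1) / 2) (b0 + ssq n th' / 2)) (\<lambda>A'.
     return (state_space n) (A', mu', th')))))"

definition gibbs_law :: "nat \<Rightarrow> (nat \<Rightarrow> real) \<Rightarrow> real \<Rightarrow> real \<Rightarrow> real \<Rightarrow> state \<Rightarrow> nat \<Rightarrow> state measure" where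
  "gibbs_law n Y V a b0 x0 k =
     ((\<lambda>M. Giry_Monad.bind M (gibbs_step n Y V a b0)) ^^ k) (return (state_space n) x0)"

definition post_dens :: "nat \<Rightarrow> (nat \<Rightarrow> real) \<Rightarrow> real \<Rightarrow> real \<Rightarrow> real \<Rightarrow> state \<Rightarrow> real" where
  "post_dens n Y V a b0 x = (case x of (A, mu, th) \<Rightarrow>
     if A > 0 then A powr (- a - 1) * exp (- b0 / A) *
       (\<Prod>i<n. A powr (- 1 / 2) * exp (- (th i - mu)\<^sup>2 / (2 * A)) * exp (- (Y i - th i)\<^sup>2 / (2 * V)))
     else 0)"

definition posterior :: "nat \<Rightarrow> (nat \<Rightarrow> real) \<Rightarrow> real \<Rightarrow> real \<Rightarrow> real \<Rightarrow> state measure" where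
  "posterior n Y V a b0 = density (state_space n)
     (\<lambda>x. ennreal (post_dens n Y V a b0 x) /
          (\<integral>\<^sup>+ z. ennreal (post_dens n Y V a b0 z) \<partial>state_space n))"

definition tv_dist :: "'a measure \<Rightarrow> 'a measure \<Rightarrow> real" where
  "tv_dist P Q = (SUP E \<in> sets P. \<bar>measure P E - measure Q E\<bar>)"

definition Kc :: "real \<Rightarrow> nat \<Rightarrow> (nat \<Rightarrow> real) \<Rightarrow> real \<Rightarrow> real \<Rightarrow> real \<Rightarrow> state \<Rightarrow> nat" where
  "Kc c n Y V a b0 x0 = (LEAST k. tv_dist (gibbs_law n Y V a b0 x0 k) (posterior n Y V a b0) \<le> c)"

definition A_init :: "nat \<Rightarrow> (nat \<Rightarrow> real) \<Rightarrow> real \<Rightarrow> real" where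
  "A_init n Y V = (if ssq n Y / (real n - 1) > V then ssq n Y / (real n - 1) - V else ssq n Y / (real n - 1))"

end

(* The sampler depends on the state only through A and the mean of theta, and near
   As = Delta/(n-1) - V it contracts both at scale n^(-1/2). So the argument runs on the Lyapunov function
   n (avg theta - avg Y)^2 + n min(|A - As|, h)^2 with h = delta/2.

   Near A = 0 the sampler drifts with no uniform rate, so P is compared with the kernel Q that first clamps
   A to [As - h, As + h]. For Q the drift condition holds globally with n-free constants. On sublevel
   sets of the Lyapunov function, two starting points give laws of (mu, theta) whose Hellinger affinity is
   bounded below (an n-fold product of normal affinities 1 - O(1/n)). The Hairer-Mattingly argument turns
   this into a weighted contraction with an n-free rate. Markov's inequality bounds the error of replacing
   P by Q during k steps by O(k^2/n).

   The posterior is not exactly invariant for this scan: given theta, the new A is drawn independently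
   of mu. Only the (A, theta)-marginal is preserved. Because A is concentrated at scale n^(-1/2),
   one step moves the posterior by O(n^(-1/2)) in total variation, which is why N_c depends on c.
   Concentration of the posterior follows from one integration by parts in A. *)

theory Submission
  imports Defs "HOL-Real_Asymp.Real_Asymp"
begin

section \<open>Densities of the normal and inverse gamma laws\<close>

text \<open>Write r = A / (V + A). Given A, the sum of squares of the new theta about the average of
  their means has expectation r^2 ssq Y + n V r. To leading order the next A is therefore centred at
  V r + (V + As) r^2, and V r = A (1 - r) makes its distance to As equal to (1 - r^2) (A - As). The
  rate degenerates only as r tends to 0; since As is at least \<delta>, clamping at h = \<delta> / 2
  keeps r above a positive q. Capping \<bar>A - As\<bar> at h gives A and its clamped value the same
  Lyapunov value, and lets a one-sided noise term enter linearly, so that its first moment is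
  enough. All comparisons of laws are made dually, by iterating kernel operators on functions with
  values in [0, 1]. This also limits the defect of invariance: the step does not read mu, so after
  one application of the operator the function depends on (A, theta) only, and all further steps
  preserve its posterior mean exactly.\<close>

abbreviation nd :: "real \<Rightarrow> real \<Rightarrow> real \<Rightarrow> real" where
  "nd m v \<equiv> normal_density m (sqrt v)"

abbreviation thetas :: "nat \<Rightarrow> (nat \<Rightarrow> real) measure" where
  "thetas n \<equiv> PiM {..<n} (\<lambda>_. lborel)"

definition igd :: "real \<Rightarrow> real \<Rightarrow> real \<Rightarrow> real" where
  "igd al be x = (if x > 0 then be powr al / Gamma al * x powr (- al - 1) * exp (- be / x) else 0)"

definition pd :: "nat \<Rightarrow> (nat \<Rightarrow> real) \<Rightarrow> real \<Rightarrow> (nat \<Rightarrow> real) \<Rightarrow> real" where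
  "pd n m v th = (\<Prod>i<n. nd (m i) v (th i))"

text \<open>Common source of measurability for the three updates. Mass at most 1 is demanded, and
  not exactly 1, because the normal updates have to be covered for every real A, where the formal
  variance may be zero or negative.\<close>

lemma measurable_density_kernel:
  assumes "sigma_finite_measure N"
    and f [measurable]: "case_prod f \<in> borel_measurable (M \<Otimes>\<^sub>M N)"
    and le: "\<And>x. x \<in> space M \<Longrightarrow> (\<integral>\<^sup>+y. f x y \<partial>N) \<le> 1"
    and ne: "space N \<noteq> {}"
  shows "(\<lambda>x. density N (f x)) \<in> measurable M (subprob_algebra N)"
proof (rule measurable_subprob_algebra)
  interpret sigma_finite_measure N by fact
  fix x assume x: "x \<in> space M"
  have [measurable]: "f x \<in> borel_measurable N"
    using measurable_Pair2[OF f x] by simp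
  show "subprob_space (density N (f x))"
    using le[OF x] ne by (intro subprob_spaceI) (auto simp: emeasure_density cong: nn_integral_cong_simp)
  show "sets (density N (f x)) = sets N" by simp
next
  interpret sigma_finite_measure N by fact
  fix A assume [measurable]: "A \<in> sets N"
  have "(\<lambda>x. \<integral>\<^sup>+y. f x y * indicator A y \<partial>N) \<in> borel_measurable M"
    by measurable
  also have "?this \<longleftrightarrow> (\<lambda>x. emeasure (density N (f x)) A) \<in> borel_measurable M"
    by (intro measurable_cong) (auto simp: emeasure_density measurable_Pair2[OF f])
  finally show "(\<lambda>x. emeasure (density N (f x)) A) \<in> borel_measurable M" .
qed

lemma PiM_density:
  assumes "finite I"
    and [measurable]: "\<And>i. i \<in> I \<Longrightarrow> f i \<in> borel_measurable lborel"
    and fin: "\<And>i. i \<in> I \<Longrightarrow> (\<integral>\<^sup>+x. f i x \<partial>lborel) < \<infinity>"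
  shows "PiM I (\<lambda>i. density (lborel :: real measure) (f i)) = density (PiM I (\<lambda>_. lborel)) (\<lambda>x. \<Prod>i\<in>I. f i (x i))"
proof -
  \<comment> \<open>\<open>product_sigma_finite\<close> speaks of every index, so the densities
    outside I are set to 0, which makes each factor a finite measure.\<close>
  define g where "g i = (if i \<in> I then f i else (\<lambda>_. 0))" for i
  have [measurable]: "g i \<in> borel_measurable lborel" for i by (auto simp: g_def)
  have "finite_measure (density (lborel :: real measure) (g i))" for i
    using fin[of i] by (intro finite_measureI) (auto simp: emeasure_density g_def)
  then interpret P: product_sigma_finite "\<lambda>i. density (lborel :: real measure) (g i)"
    by (intro product_sigma_finite.intro finite_measure.axioms(1))
  interpret L: product_sigma_finite "\<lambda>_. lborel :: real measure"
    by (intro product_sigma_finite.intro) (rule sigma_finite_lborel)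
  have "density (PiM I (\<lambda>_. lborel)) (\<lambda>x. \<Prod>i\<in>I. g i (x i)) = PiM I (\<lambda>i. density lborel (g i))"
  proof (rule P.PiM_eqI[OF assms(1)])
    show "sets (density (PiM I (\<lambda>_. lborel)) (\<lambda>x. \<Prod>i\<in>I. g i (x i))) = sets (PiM I (\<lambda>i. density lborel (g i)))"
      by (simp cong: sets_PiM_cong)
    fix A assume A: "\<And>i. i \<in> I \<Longrightarrow> A i \<in> sets (density lborel (g i))"
    then have [measurable]: "\<And>i. i \<in> I \<Longrightarrow> A i \<in> sets borel" by simp
    have "emeasure (density (PiM I (\<lambda>_. lborel)) (\<lambda>x. \<Prod>i\<in>I. g i (x i))) (Pi\<^sub>E I A)
        = (\<integral>\<^sup>+x. (\<Prod>i\<in>I. g i (x i)) * indicator (Pi\<^sub>E I A) x \<partial>PiM I (\<lambda>_. lborel))"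
      using assms(1) by (subst emeasure_density) (auto intro!: sets_PiM_I_finite borel_measurable_prod_ennreal)
    also have "\<dots> = (\<integral>\<^sup>+x. (\<Prod>i\<in>I. g i (x i) * indicator (A i) (x i)) \<partial>PiM I (\<lambda>_. lborel))"
      using assms(1) by (intro nn_integral_cong)
        (auto simp: space_PiM PiE_iff prod.distrib indicator_def extensional_def split: if_splits)
    also have "\<dots> = (\<Prod>i\<in>I. \<integral>\<^sup>+x. g i x * indicator (A i) x \<partial>lborel)"
      using assms(1) by (intro L.product_nn_integral_prod) auto
    also have "\<dots> = (\<Prod>i\<in>I. emeasure (density lborel (g i)) (A i))"
      by (intro prod.cong) (auto simp: emeasure_density)
    finally show "emeasure (density (PiM I (\<lambda>_. lborel)) (\<lambda>x. \<Prod>i\<in>I. g i (x i))) (Pi\<^sub>E I A)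
        = (\<Prod>i\<in>I. emeasure (density lborel (g i)) (A i))" .
  qed
  moreover have "PiM I (\<lambda>i. density lborel (g i)) = PiM I (\<lambda>i. density (lborel :: real measure) (f i))"
    by (intro PiM_cong) (auto simp: g_def)
  moreover have "(\<lambda>x. \<Prod>i\<in>I. g i (x i)) = (\<lambda>x. \<Prod>i\<in>I. f i (x i))"
    by (intro ext prod.cong) (auto simp: g_def)
  ultimately show ?thesis by simp
qed

lemma nn_integral_nd: "v > 0 \<Longrightarrow> (\<integral>\<^sup>+x. ennreal (nd m v x) \<partial>lborel) = 1"
  by (subst nn_integral_eq_integral) auto

lemma normal_density_abs: "normal_density m s = normal_density m \<bar>s\<bar>"
  by (rule ext) (simp add: normal_density_def)

text \<open>\<open>sqrt\<close> is odd on the reals and the density sees only its square, so a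
  negative v acts like \<bar>v\<bar>. For v = 0 the division by zero makes the density
  vanish.\<close>

lemma nn_integral_nd_le: "(\<integral>\<^sup>+x. ennreal (nd m v x) \<partial>lborel) \<le> 1"
proof (cases "v = 0")
  case True
  then show ?thesis by (simp add: normal_density_def)
next
  case False
  then have "sqrt \<bar>v\<bar> = \<bar>sqrt v\<bar>" by (simp add: real_sqrt_abs2 real_sqrt_abs real_sqrt_minus abs_if)
  then have "nd m v = nd m \<bar>v\<bar>" using normal_density_abs[of m "sqrt v"] by simp
  then show ?thesis using nn_integral_nd[of "\<bar>v\<bar>" m] False by simp
qed

lemma measurable_normal_density2 [measurable (raw)]:
  assumes [measurable]: "f \<in> borel_measurable M" "g \<in> borel_measurable M" "h \<in> borel_measurable M"
  shows "(\<lambda>x. normal_density (f x) (g x) (h x)) \<in> borel_measurable M"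
  unfolding normal_density_def by measurable

lemma igd_nonneg [simp]: "al > 0 \<Longrightarrow> be > 0 \<Longrightarrow> 0 \<le> igd al be x"
  by (auto simp: igd_def Gamma_real_pos intro!: mult_nonneg_nonneg divide_nonneg_pos)

lemma measurable_igd [measurable (raw)]:
  assumes [measurable]: "g \<in> borel_measurable M" "h \<in> borel_measurable M"
  shows "(\<lambda>x. igd al (g x) (h x)) \<in> borel_measurable M"
  unfolding igd_def by measurable

text \<open>Substituting \<open>x = 1/y\<close> turns this into the Gamma integral.\<close>

lemma nn_integral_ig_kernel:
  assumes "al > 0" "be > 0"
  shows "(\<integral>\<^sup>+x. ennreal (if x > 0 then x powr (- al - 1) * exp (- be / x) else 0) \<partial>lborel)
     = ennreal (Gamma al / be powr al)"
proof -
  let ?f = "\<lambda>x::real. x powr (- al - 1) * exp (- be / x)"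
  \<comment> \<open>The substitution carries the factor be so that the exponent be / x becomes y,
    and the parameter be comes out as a constant power.\<close>
  let ?g = "\<lambda>y::real. be / y"
  let ?h = "\<lambda>y::real. y powr (al - 1) / exp y"
  have gi: "?h absolutely_integrable_on {0<..} \<and> integral {0<..} ?h = Gamma al"
  proof -
    have "((\<lambda>t. if t \<in> {0<..} then ?h t else 0) has_integral Gamma al) {0..}"
      by (rule has_integral_spike [of "{0}", OF _ _ Gamma_integral_real[OF assms(1)]]) auto
    then have "(?h has_integral Gamma al) {0<..}"
      by (subst (asm) has_integral_restrict) auto
    then show ?thesis
      by (auto simp: has_integral_iff intro!: nonnegative_absolutely_integrable_1)
  qed
  have im: "?g ` {0<..} = {0<..}"
  proof
    show "{0<..} \<subseteq> ?g ` {0<..}"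
    proof
      fix x :: real assume "x \<in> {0<..}"
      then show "x \<in> ?g ` {0<..}" using assms by (intro image_eqI[of _ _ "be / x"]) auto
    qed
  qed (use assms in auto)
  have eq: "\<bar>- be / y^2\<bar> * ?f (?g y) = be powr (- al) * ?h y" if "y \<in> {0<..}" for y
  proof -
    have y: "y > 0" using that by simp
    have "(be / y) powr (- al - 1) = be powr (- al - 1) / y powr (- al - 1)"
      using y assms by (simp add: powr_divide)
    moreover have "be * be powr (- al - 1) = be powr (- al)"
      using assms by (simp add: powr_diff)
    moreover have "1 / y^2 / y powr (- al - 1) = y powr (al - 1)"
      using y by (simp add: powr_minus powr_diff divide_simps power2_eq_square)
    moreover have "be / y^2 * (be powr (- al - 1) / y powr (- al - 1))
        = (be * be powr (- al - 1)) * (1 / y^2 / y powr (- al - 1))" by simp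
    ultimately have "be / y^2 * (be / y) powr (- al - 1) = be powr (- al) * y powr (al - 1)"
      by (simp only:)
    then show ?thesis using y assms by (simp add: exp_minus divide_simps)
  qed
  have "(\<lambda>y. \<bar>- be / y^2\<bar> * ?f (?g y)) absolutely_integrable_on {0<..} \<and>
      integral {0<..} (\<lambda>y. \<bar>- be / y^2\<bar> * ?f (?g y)) = be powr (- al) * Gamma al
    \<longleftrightarrow> ?f absolutely_integrable_on ?g ` {0<..} \<and> integral (?g ` {0<..}) ?f = be powr (- al) * Gamma al"
  proof (rule has_absolute_integral_change_of_variables_1')
    show "inj_on ?g {0<..}" using assms by (auto simp: inj_on_def)
    fix y :: real assume "y \<in> {0<..}"
    then show "(?g has_field_derivative - be / y\<^sup>2) (at y within {0<..})"
      by (auto intro!: derivative_eq_intros simp: power2_eq_square)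
  qed simp
  moreover have "(\<lambda>y. \<bar>- be / y^2\<bar> * ?f (?g y)) absolutely_integrable_on {0<..} \<longleftrightarrow>
      (\<lambda>y. be powr (- al) * ?h y) absolutely_integrable_on {0<..}"
    using eq by (intro set_integrable_cong) auto
  moreover have "integral {0<..} (\<lambda>y. \<bar>- be / y^2\<bar> * ?f (?g y)) = integral {0<..} (\<lambda>y. be powr (- al) * ?h y)"
    using eq by (intro Henstock_Kurzweil_Integration.integral_cong) auto
  moreover have "(\<lambda>y. be powr (- al) * ?h y) absolutely_integrable_on {0<..}"
    using gi by (intro set_integrable_mult_right) auto
  moreover have "integral {0<..} (\<lambda>y. be powr (- al) * ?h y) = be powr (- al) * Gamma al"
    using gi by (subst integral_mult_right) auto
  ultimately have *: "?f absolutely_integrable_on {0<..} \<and> integral {0<..} ?f = be powr (- al) * Gamma al"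
    unfolding im by simp
  have "(?f has_integral be powr (- al) * Gamma al) {0<..}"
    using * by (simp add: has_integral_iff set_lebesgue_integral_eq_integral)
  have "(\<integral>\<^sup>+x. ennreal (if x > 0 then ?f x else 0) \<partial>lborel) = (\<integral>\<^sup>+x. ennreal (indicator {0<..} x * ?f x) \<partial>lborel)"
    by (intro nn_integral_cong) auto
  also have "\<dots> = ennreal (Gamma al / be powr al)"
    using \<open>(?f has_integral _) _\<close> assms
    by (subst nn_integral_has_integral_lebesgue[where I="be powr (- al) * Gamma al"])
      (auto simp: powr_minus field_simps)
  finally show ?thesis .
qed

section \<open>The Gibbs kernel\<close>

lemma nn_integral_igd:
  assumes "al > 0" "be > 0"
  shows "(\<integral>\<^sup>+x. ennreal (igd al be x) \<partial>lborel) = 1"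
proof -
  have "(\<integral>\<^sup>+x. ennreal (igd al be x) \<partial>lborel) = (\<integral>\<^sup>+x. ennreal (be powr al / Gamma al) *
      ennreal (if x > 0 then x powr (- al - 1) * exp (- be / x) else 0) \<partial>lborel)"
    using assms by (intro nn_integral_cong) (auto simp: igd_def ennreal_mult[symmetric] Gamma_real_pos less_imp_le mult.assoc)
  also have "\<dots> = ennreal (be powr al / Gamma al) * ennreal (Gamma al / be powr al)"
    using assms by (subst nn_integral_cmult) (auto simp: nn_integral_ig_kernel)
  also have "\<dots> = ennreal (be powr al / Gamma al * (Gamma al / be powr al))"
    using assms by (intro ennreal_mult[symmetric]) (auto simp: Gamma_real_pos less_imp_le)
  also have "be powr al / Gamma al * (Gamma al / be powr al) = 1"
    using assms Gamma_real_pos[OF assms(1)] by (metis less_irrefl nonzero_divide_mult_cancel_left powr_eq_0_iff times_divide_times_eq divide_self mult_eq_0_iff mult.commute)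
  finally show ?thesis by simp
qed

lemma measurable_avg [measurable (raw)]:
  assumes [measurable]: "f \<in> measurable M (thetas n)"
  shows "(\<lambda>x. avg n (f x)) \<in> borel_measurable M"
proof -
  have "(\<lambda>x. f x i) \<in> borel_measurable M" if "i < n" for i
    using measurable_compose[OF assms measurable_component_singleton[of i "{..<n}" "\<lambda>_. lborel"]] that by simp
  then show ?thesis unfolding avg_def by (auto intro!: borel_measurable_divide borel_measurable_sum)
qed

lemma measurable_ssq [measurable (raw)]:
  assumes [measurable]: "f \<in> measurable M (thetas n)"
  shows "(\<lambda>x. ssq n (f x)) \<in> borel_measurable M"
proof -
  have "(\<lambda>x. f x i) \<in> borel_measurable M" if "i < n" for i
    using measurable_compose[OF assms measurable_component_singleton[of i "{..<n}" "\<lambda>_. lborel"]] that by simp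
  then show ?thesis unfolding ssq_def
    by (intro borel_measurable_sum borel_measurable_power borel_measurable_diff) auto
qed

lemma pd_nonneg [simp]: "0 \<le> pd n m v th"
  by (auto simp: pd_def intro: prod_nonneg)

lemma measurable_pd [measurable (raw)]:
  assumes "\<And>i. i < n \<Longrightarrow> (\<lambda>x. m x i) \<in> borel_measurable M"
    and [measurable]: "v \<in> borel_measurable M" "f \<in> measurable M (thetas n)"
  shows "(\<lambda>x. pd n (m x) (v x) (f x)) \<in> borel_measurable M"
proof -
  have "(\<lambda>x. f x i) \<in> borel_measurable M" if "i < n" for i
    using measurable_compose[OF assms(3) measurable_component_singleton[of i "{..<n}" "\<lambda>_. lborel"]] that by simp
  then show ?thesis unfolding pd_def using assms(1)
    by (intro borel_measurable_prod measurable_normal_density2) auto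
qed

lemma PiM_normal: "PiM {..<n} (\<lambda>i. normal_measure (m i) v) = density (thetas n) (pd n m v)"
  unfolding normal_measure_def
  by (subst PiM_density) (auto simp: pd_def prod_ennreal intro!: le_less_trans[OF nn_integral_nd_le])

interpretation L: product_sigma_finite "\<lambda>_. lborel :: real measure"
  by (intro product_sigma_finite.intro) (rule sigma_finite_lborel)

lemma nn_integral_pd_prod:
  assumes [measurable]: "\<And>i. i < n \<Longrightarrow> g i \<in> borel_measurable borel"
  shows "(\<integral>\<^sup>+th. ennreal (pd n m v th) * (\<Prod>i<n. g i (th i)) \<partial>thetas n) =
    (\<Prod>i<n. \<integral>\<^sup>+x. ennreal (nd (m i) v x) * g i x \<partial>lborel)"
proof -
  have "(\<integral>\<^sup>+th. ennreal (pd n m v th) * (\<Prod>i<n. g i (th i)) \<partial>thetas n) =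
     (\<integral>\<^sup>+th. (\<Prod>i<n. ennreal (nd (m i) v (th i)) * g i (th i)) \<partial>thetas n)"
    by (intro nn_integral_cong) (simp add: pd_def prod.distrib prod_ennreal)
  also have "\<dots> = (\<Prod>i<n. \<integral>\<^sup>+x. ennreal (nd (m i) v x) * g i x \<partial>lborel)"
    by (intro L.product_nn_integral_prod) auto
  finally show ?thesis .
qed

lemma nn_integral_pd: "v > 0 \<Longrightarrow> (\<integral>\<^sup>+th. ennreal (pd n m v th) \<partial>thetas n) = 1"
  using nn_integral_pd_prod[of n "\<lambda>_ _. 1" m v] by (simp add: nn_integral_nd)

lemma nn_integral_pd_le: "(\<integral>\<^sup>+th. ennreal (pd n m v th) \<partial>thetas n) \<le> 1"
  using nn_integral_pd_prod[of n "\<lambda>_ _. 1" m v] by (auto simp: nn_integral_nd_le intro!: prod_le_1)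

lemma sigma_finite_thetas: "sigma_finite_measure (thetas n)"
proof -
  interpret finite_product_sigma_finite "\<lambda>_. lborel :: real measure" "{..<n}"
    by standard auto
  show ?thesis by (rule sigma_finite_measure_axioms)
qed

interpretation thetas: sigma_finite_measure "thetas n" for n
  by (rule sigma_finite_thetas)

lemma space_thetas_nonempty: "space (thetas n) \<noteq> {}"
  by (auto simp: space_PiM PiE_eq_empty_iff)

lemma ssq_nonneg [simp]: "0 \<le> ssq n y" by (auto simp: ssq_def intro: sum_nonneg)

section \<open>The three conditional updates as kernels with densities\<close>

locale gibbs =
  fixes n :: nat and Y :: "nat \<Rightarrow> real" and V a b0 :: real
  assumes V: "V > 0" and a: "a > 0" and b0: "b0 > 0" and n2: "n \<ge> 2"
begin

text \<open>\<open>al\<close> and \<open>be th\<close> are shape and scale of the inverse gamma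
  update of A; \<open>mm A mu i\<close> and \<open>vv A\<close> are the mean and the common variance
  in the update of theta.\<close>

definition "al = a + (real n - 1) / 2"

definition be :: "(nat \<Rightarrow> real) \<Rightarrow> real" where "be th = b0 + ssq n th / 2"

definition mm :: "real \<Rightarrow> real \<Rightarrow> nat \<Rightarrow> real" where "mm A mu i = (mu * V + Y i * A) / (V + A)"

definition vv :: "real \<Rightarrow> real" where "vv A = A * V / (V + A)"

abbreviation "SS \<equiv> state_space n"

abbreviation "P \<equiv> gibbs_step n Y V a b0"

lemma al_pos: "al > 0" using a n2 by (auto simp: al_def intro!: add_pos_nonneg)

lemma be_pos: "be th > 0" using b0 ssq_nonneg[of n th] unfolding be_def by linarith

lemma measurable_be [measurable (raw)]:
  assumes [measurable]: "f \<in> measurable M (thetas n)"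
  shows "(\<lambda>x. be (f x)) \<in> borel_measurable M"
  unfolding be_def by measurable

lemma measurable_mm [measurable (raw)]:
  assumes [measurable]: "f \<in> borel_measurable M" "g \<in> borel_measurable M"
  shows "(\<lambda>x. mm (f x) (g x) i) \<in> borel_measurable M"
  unfolding mm_def by measurable

lemma measurable_vv [measurable (raw)]:
  assumes [measurable]: "f \<in> borel_measurable M"
  shows "(\<lambda>x. vv (f x)) \<in> borel_measurable M"
  unfolding vv_def by measurable

text \<open>Expectations under the three updates, written against Lebesgue measure: mu around the
  centre t, theta given A and mu, A given theta.\<close>

abbreviation "Emu t A f \<equiv> \<integral>\<^sup>+mu. ennreal (nd t (A / real n) mu) * f mu \<partial>lborel"
abbreviation "Eth A mu f \<equiv> \<integral>\<^sup>+th. ennreal (pd n (mm A mu) (vv A) th) * f th \<partial>thetas n"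
abbreviation "EA th f \<equiv> \<integral>\<^sup>+A. ennreal (igd al (be th) A) * f A \<partial>lborel"

definition K1 :: "real \<Rightarrow> (nat \<Rightarrow> real) \<Rightarrow> real measure" where
  "K1 A th = density lborel (nd (avg n th) (A / real n))"

definition K2 :: "real \<Rightarrow> real \<Rightarrow> (nat \<Rightarrow> real) measure" where
  "K2 A mu = density (thetas n) (pd n (mm A mu) (vv A))"

definition K3 :: "(nat \<Rightarrow> real) \<Rightarrow> real measure" where
  "K3 th = density lborel (igd al (be th))"

lemma step_eq: "P (A, mu, th) =
     Giry_Monad.bind (K1 A th) (\<lambda>mu'. Giry_Monad.bind (K2 A mu') (\<lambda>th'.
     Giry_Monad.bind (K3 th') (\<lambda>A'. return SS (A', mu', th'))))"
  unfolding gibbs_step_def K1_def K2_def K3_def split PiM_normal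
  by (simp add: normal_measure_def IG_measure_def igd_def[abs_def] al_def be_def mm_def[abs_def] vv_def)

lemma K1_measurable [measurable (raw)]:
  assumes [measurable]: "f \<in> borel_measurable M" "g \<in> measurable M (thetas n)"
  shows "(\<lambda>x. K1 (f x) (g x)) \<in> measurable M (subprob_algebra lborel)"
  unfolding K1_def
  by (intro measurable_density_kernel sigma_finite_lborel nn_integral_nd_le) (auto simp: split_beta')

lemma K2_measurable [measurable (raw)]:
  assumes [measurable]: "f \<in> borel_measurable M" "g \<in> borel_measurable M"
  shows "(\<lambda>x. K2 (f x) (g x)) \<in> measurable M (subprob_algebra (thetas n))"
  unfolding K2_def
  by (intro measurable_density_kernel sigma_finite_thetas nn_integral_pd_le space_thetas_nonempty)
    (simp add: split_beta')

lemma K3_measurable [measurable (raw)]: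
  assumes [measurable]: "g \<in> measurable M (thetas n)"
  shows "(\<lambda>x. K3 (g x)) \<in> measurable M (subprob_algebra lborel)"
  unfolding K3_def
  by (intro measurable_density_kernel sigma_finite_lborel)
    (auto simp: split_beta' nn_integral_igd al_pos be_pos)

lemma measurable_state [measurable]:
  "fst \<in> borel_measurable SS" "(\<lambda>x. fst (snd x)) \<in> borel_measurable SS"
  "(\<lambda>x. snd (snd x)) \<in> measurable SS (thetas n)"
  unfolding state_space_def by measurable

lemma measurable_state_Pair [measurable (raw)]:
  assumes [measurable]: "f \<in> borel_measurable M" "g \<in> borel_measurable M" "h \<in> measurable M (thetas n)"
  shows "(\<lambda>x. (f x, g x, h x)) \<in> measurable M SS"
  unfolding state_space_def by measurable

lemma step_measurable [measurable]: "P \<in> measurable SS (subprob_algebra SS)"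
proof -
  have "(\<lambda>x. Giry_Monad.bind (K1 (fst x) (snd (snd x))) (\<lambda>mu'. Giry_Monad.bind (K2 (fst x) mu') (\<lambda>th'.
     Giry_Monad.bind (K3 th') (\<lambda>A'. return SS (A', mu', th'))))) \<in> measurable SS (subprob_algebra SS)"
    by measurable
  also have "?this \<longleftrightarrow> ?thesis"
    by (intro arg_cong2[where f="(\<in>)"] refl ext) (auto simp: step_eq[symmetric])
  finally show ?thesis .
qed

text \<open>Replaces the monadic step by iterated integrals against densities, the form in which all
  estimates are made. The vector \<open>th\<close> must be extensional outside \<open>{..<n}\<close>
  for the state to lie in the space.\<close>

lemma nn_integral_step:
  assumes [measurable]: "\<phi> \<in> borel_measurable SS" and th: "th \<in> space (thetas n)"
  shows "(\<integral>\<^sup>+x. \<phi> x \<partial>P (A, mu, th)) =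
    Emu (avg n th) A (\<lambda>mu'. Eth A mu' (\<lambda>th'. EA th' (\<lambda>A'. \<phi> (A', mu', th'))))"
proof -
  have inner1: "(\<lambda>p. \<integral>\<^sup>+A'. \<phi> (A', fst p, snd p) \<partial>K3 (snd p)) \<in> borel_measurable (borel \<Otimes>\<^sub>M thetas n)"
    by (rule nn_integral_measurable_subprob_algebra2[where N=lborel]) measurable
  from measurable_Pair2[OF this]
  have inner2: "(\<lambda>th'. \<integral>\<^sup>+A'. \<phi> (A', mu', th') \<partial>K3 th') \<in> borel_measurable (thetas n)" for mu'
    by simp
  have pdm: "(\<lambda>th'. ennreal (pd n (mm A mu') (vv A) th')) \<in> borel_measurable (thetas n)" for mu'
    by measurable
  have inner: "(\<lambda>mu'. \<integral>\<^sup>+th'. \<integral>\<^sup>+A'. \<phi> (A', mu', th') \<partial>K3 th' \<partial>K2 A mu') \<in> borel_measurable borel"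
    by (intro nn_integral_measurable_subprob_algebra2[where N="thetas n"]) (use inner1 in \<open>auto simp: split_beta'\<close>)
  have "(\<integral>\<^sup>+x. \<phi> x \<partial>P (A, mu, th)) = (\<integral>\<^sup>+mu'. \<integral>\<^sup>+th'. \<integral>\<^sup>+A'. \<phi> (A', mu', th') \<partial>K3 th' \<partial>K2 A mu' \<partial>K1 A th)"
  proof -
    have space: "th' \<in> space (thetas n) \<Longrightarrow> (A', mu', th') \<in> space SS" for A' mu' th'
      by (simp add: state_space_def space_pair_measure)
    have 3: "(\<lambda>A'. return SS (A', mu', th')) \<in> measurable lborel (subprob_algebra SS)"
      if [simp]: "th' \<in> space (thetas n)" for mu' th'
      by (intro measurable_compose[OF _ return_measurable] measurable_state_Pair) auto
    have "(\<integral>\<^sup>+x. \<phi> x \<partial>P (A, mu, th)) = (\<integral>\<^sup>+mu'. \<integral>\<^sup>+x. \<phi> x \<partial>Giry_Monad.bind (K2 A mu') (\<lambda>th'.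
        Giry_Monad.bind (K3 th') (\<lambda>A'. return SS (A', mu', th'))) \<partial>K1 A th)"
      unfolding step_eq by (rule nn_integral_bind[where B=SS]) (auto simp: K1_def)
    also have "\<dots> = (\<integral>\<^sup>+mu'. \<integral>\<^sup>+th'. \<integral>\<^sup>+x. \<phi> x \<partial>Giry_Monad.bind (K3 th') (\<lambda>A'. return SS (A', mu', th')) \<partial>K2 A mu' \<partial>K1 A th)"
      by (intro nn_integral_cong nn_integral_bind[where B=SS]) (auto simp: K2_def)
    also have "\<dots> = (\<integral>\<^sup>+mu'. \<integral>\<^sup>+th'. \<integral>\<^sup>+A'. \<phi> (A', mu', th') \<partial>K3 th' \<partial>K2 A mu' \<partial>K1 A th)"
    proof (intro nn_integral_cong)
      fix mu' th' assume "th' \<in> space (K2 A mu')"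
      then have th': "th' \<in> space (thetas n)" by (simp add: K2_def)
      have "(\<integral>\<^sup>+x. \<phi> x \<partial>Giry_Monad.bind (K3 th') (\<lambda>A'. return SS (A', mu', th')))
          = (\<integral>\<^sup>+A'. \<integral>\<^sup>+x. \<phi> x \<partial>return SS (A', mu', th') \<partial>K3 th')"
        using 3[OF th'] by (intro nn_integral_bind[where B=SS]) (auto simp: K3_def)
      also have "\<dots> = (\<integral>\<^sup>+A'. \<phi> (A', mu', th') \<partial>K3 th')"
        using space[OF th'] by (intro nn_integral_cong nn_integral_return) auto
      finally show "(\<integral>\<^sup>+x. \<phi> x \<partial>Giry_Monad.bind (K3 th') (\<lambda>A'. return SS (A', mu', th')))
          = (\<integral>\<^sup>+A'. \<phi> (A', mu', th') \<partial>K3 th')" .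
    qed
    finally show ?thesis .
  qed
  also have "\<dots> = Emu (avg n th) A (\<lambda>mu'. \<integral>\<^sup>+th'. \<integral>\<^sup>+A'. \<phi> (A', mu', th') \<partial>K3 th' \<partial>K2 A mu')"
    unfolding K1_def by (rule nn_integral_density) (use inner in auto)
  also have "\<dots> = Emu (avg n th) A (\<lambda>mu'. Eth A mu' (\<lambda>th'. \<integral>\<^sup>+A'. \<phi> (A', mu', th') \<partial>K3 th'))"
    unfolding K2_def by (intro nn_integral_cong arg_cong2[where f="(*)"] refl nn_integral_density) (rule pdm inner2)+
  also have "\<dots> = Emu (avg n th) A (\<lambda>mu'. Eth A mu' (\<lambda>th'. EA th' (\<lambda>A'. \<phi> (A', mu', th'))))"
    unfolding K3_def
    by (intro nn_integral_cong arg_cong2[where f="(*)"] refl nn_integral_density) (auto simp: space_PiM)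
  finally show ?thesis .
qed

end

section \<open>Overlap of densities and weighted contraction\<close>

lemma nd_eq: "v > 0 \<Longrightarrow> nd m v x = exp (- (x - m)\<^sup>2 / (2 * v)) / sqrt (2 * pi * v)"
  by (simp add: normal_density_def)

text \<open>Completing the square: the geometric mean of two normal densities is a normal density,
  whose precision is the average of the two precisions, times a constant. That constant is the
  Hellinger affinity.\<close>

lemma sqrt_normal_product:
  assumes v: "v1 > 0" "v2 > 0"
  shows "sqrt (nd m1 v1 x * nd m2 v2 x) =
    sqrt (2 * sqrt (v1 * v2) / (v1 + v2)) * exp (- (m1 - m2)\<^sup>2 / (4 * (v1 + v2))) *
      nd ((m1 * v2 + m2 * v1) / (v1 + v2)) (2 * v1 * v2 / (v1 + v2)) x"
proof -
  let ?w = "2 * v1 * v2 / (v1 + v2)" and ?m = "(m1 * v2 + m2 * v1) / (v1 + v2)"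
  have w: "?w > 0" using v by simp
  have aux: "exp (- A) * exp (- B) = (exp (- C) * exp (- D))\<^sup>2" if "A + B = 2 * (C + D)" for A B C D :: real
    using that by (simp add: exp_add[symmetric] exp_double[symmetric])
  have "(x - m1)\<^sup>2 / (2 * v1) + (x - m2)\<^sup>2 / (2 * v2) = 2 * ((m1 - m2)\<^sup>2 / (4 * (v1 + v2)) + (x - ?m)\<^sup>2 / (2 * ?w))"
  proof -
    have "(x - ?m) = (x * (v1 + v2) - (m1 * v2 + m2 * v1)) / (v1 + v2)" using v by (simp add: field_simps)
    then have "(x - ?m)\<^sup>2 / (2 * ?w) = (x * (v1 + v2) - (m1 * v2 + m2 * v1))\<^sup>2 / (4 * v1 * v2 * (v1 + v2))"
      using v by (simp add: power_divide power2_eq_square)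
    moreover have "(x - m1)\<^sup>2 / (2 * v1) + (x - m2)\<^sup>2 / (2 * v2) =
       ((m1 - m2)\<^sup>2 * v1 * v2 + (x * (v1 + v2) - (m1 * v2 + m2 * v1))\<^sup>2) / (2 * v1 * v2 * (v1 + v2))"
      using v by (simp add: divide_simps) (simp add: power2_eq_square algebra_simps)
    moreover have "2 * ((m1 - m2)\<^sup>2 / (4 * (v1 + v2)) + (x * (v1 + v2) - (m1 * v2 + m2 * v1))\<^sup>2 / (4 * v1 * v2 * (v1 + v2)))
      = ((m1 - m2)\<^sup>2 * v1 * v2 + (x * (v1 + v2) - (m1 * v2 + m2 * v1))\<^sup>2) / (2 * v1 * v2 * (v1 + v2))"
      using v by (simp add: divide_simps) (simp add: algebra_simps)
    ultimately show ?thesis by simp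
  qed
  then have "exp (- (x - m1)\<^sup>2 / (2 * v1)) * exp (- (x - m2)\<^sup>2 / (2 * v2)) =
      (exp (- (m1 - m2)\<^sup>2 / (4 * (v1 + v2))) * exp (- (x - ?m)\<^sup>2 / (2 * ?w)))\<^sup>2"
    by (auto simp only: minus_divide_left[symmetric] intro!: aux)
  then have "sqrt (exp (- (x - m1)\<^sup>2 / (2 * v1)) * exp (- (x - m2)\<^sup>2 / (2 * v2))) =
      exp (- (m1 - m2)\<^sup>2 / (4 * (v1 + v2))) * exp (- (x - ?m)\<^sup>2 / (2 * ?w))"
    by simp
  moreover have "sqrt (1 / (sqrt (2 * pi * v1) * sqrt (2 * pi * v2))) =
      sqrt (2 * sqrt (v1 * v2) / (v1 + v2)) / sqrt (2 * pi * ?w)"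
  proof -
    have "sqrt (v1 * v2) * sqrt (v1 * v2) = v1 * v2" using v by simp
    then have "1 / (2 * pi * sqrt (v1 * v2)) = 2 * sqrt (v1 * v2) / (v1 + v2) / (2 * pi * ?w)"
      using v by (simp add: divide_simps)
    moreover have "sqrt (2 * pi * v1) * sqrt (2 * pi * v2) = 2 * pi * sqrt (v1 * v2)"
    proof -
      have "sqrt (2 * pi * v1) * sqrt (2 * pi * v2) = sqrt ((2 * pi)\<^sup>2 * (v1 * v2))"
        by (simp add: real_sqrt_mult[symmetric] power2_eq_square mult_ac)
      also have "\<dots> = 2 * pi * sqrt (v1 * v2)"
        by (simp only: real_sqrt_mult real_sqrt_abs) simp
      finally show ?thesis .
    qed
    ultimately show ?thesis by (simp add: real_sqrt_divide)
  qed
  moreover have "nd m1 v1 x * nd m2 v2 x = 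
     (exp (- (x - m1)\<^sup>2 / (2 * v1)) * exp (- (x - m2)\<^sup>2 / (2 * v2))) * (1 / (sqrt (2 * pi * v1) * sqrt (2 * pi * v2)))"
    using v by (simp add: nd_eq)
  ultimately have "sqrt (nd m1 v1 x * nd m2 v2 x) = exp (- (m1 - m2)\<^sup>2 / (4 * (v1 + v2))) * exp (- (x - ?m)\<^sup>2 / (2 * ?w))
     * (sqrt (2 * sqrt (v1 * v2) / (v1 + v2)) / sqrt (2 * pi * ?w))"
    by (metis real_sqrt_mult)
  then show ?thesis using w by (simp add: nd_eq)
qed

text \<open>The loss sits in a single exponential so that the affinity of a product law follows by
  adding exponents. For the variances, v1 + v2 = 2 p + d with p the geometric mean and d the squared
  difference of the square roots, and 1 + t \<le> exp t. The loss is quadratic in both differences,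
  which is why n coordinates with differences of order n^(-1/2) lose only a constant factor.\<close>

lemma normal_affinity_ge:
  assumes v: "w0 > 0" "v1 \<ge> w0" "v2 \<ge> w0"
  shows "ennreal (exp (- (v1 - v2)\<^sup>2 / (16 * w0\<^sup>2) - (m1 - m2)\<^sup>2 / (8 * w0)))
     \<le> (\<integral>\<^sup>+x. ennreal (sqrt (nd m1 v1 x * nd m2 v2 x)) \<partial>lborel)"
proof -
  have v': "v1 > 0" "v2 > 0" using v by auto
  let ?C = "sqrt (2 * sqrt (v1 * v2) / (v1 + v2)) * exp (- (m1 - m2)\<^sup>2 / (4 * (v1 + v2)))"
  define p where "p = sqrt (v1 * v2)"
  define d where "d = (sqrt v1 - sqrt v2)\<^sup>2"
  have p: "p \<ge> w0" unfolding p_def using v by (intro real_le_rsqrt) (auto simp: power2_eq_square intro!: mult_mono)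
  have s: "v1 + v2 = d + 2 * p" using v' by (simp add: d_def p_def power2_diff real_sqrt_mult)
  have d0: "d \<ge> 0" by (simp add: d_def)
  have d: "d \<le> (v1 - v2)\<^sup>2 / (4 * w0)"
  proof -
    have "(v1 - v2) = (sqrt v1 - sqrt v2) * (sqrt v1 + sqrt v2)" using v' by (simp add: algebra_simps)
    then have "(v1 - v2)\<^sup>2 = d * (v1 + v2 + 2 * p)" 
      using v' by (simp add: d_def p_def power_mult_distrib power2_sum real_sqrt_mult)
    moreover have "d * (v1 + v2 + 2 * p) \<ge> d * (4 * w0)" using v p d0 by (intro mult_left_mono) auto
    ultimately show ?thesis using v by (simp add: field_simps)
  qed
  have "2 * p / (v1 + v2) \<ge> exp (- (d / (2 * p)))"
  proof -
    have "1 + d / (2 * p) \<le> exp (d / (2 * p))" by (rule exp_ge_add_one_self)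
    then have "(v1 + v2) / (2 * p) \<le> exp (d / (2 * p))" using p v unfolding s by (simp add: field_simps)
    then have "inverse (exp (d / (2 * p))) \<le> inverse ((v1 + v2) / (2 * p))" 
      using p v v' by (intro le_imp_inverse_le) auto
    then show ?thesis by (simp add: exp_minus)
  qed
  moreover have "exp (- (v1 - v2)\<^sup>2 / (16 * w0\<^sup>2)) ^ 2 \<le> exp (- (d / (2 * p)))"
  proof -
    have "d / (2 * p) \<le> ((v1 - v2)\<^sup>2 / (4 * w0)) / (2 * w0)"
      using d d0 p v by (intro frac_le) auto
    also have "\<dots> = 2 * ((v1 - v2)\<^sup>2 / (16 * w0\<^sup>2))" by (simp add: power2_eq_square)
    finally show ?thesis by (simp add: exp_double[symmetric])
  qed
  ultimately have 1: "exp (- (v1 - v2)\<^sup>2 / (16 * w0\<^sup>2)) \<le> sqrt (2 * p / (v1 + v2))"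
    by (intro real_le_rsqrt) linarith
  have 2: "exp (- (m1 - m2)\<^sup>2 / (8 * w0)) \<le> exp (- (m1 - m2)\<^sup>2 / (4 * (v1 + v2)))"
    using v by (auto intro!: divide_left_mono)
  have "exp (- (v1 - v2)\<^sup>2 / (16 * w0\<^sup>2) - (m1 - m2)\<^sup>2 / (8 * w0)) \<le> ?C"
    using mult_mono[OF 1 2] v' p v unfolding p_def[symmetric] by (simp add: exp_add[symmetric])
  also have "ennreal ?C = (\<integral>\<^sup>+x. ennreal ?C * ennreal (nd ((m1 * v2 + m2 * v1) / (v1 + v2)) (2 * v1 * v2 / (v1 + v2)) x) \<partial>lborel)"
    using v' by (subst nn_integral_cmult) (auto simp: nn_integral_nd)
  also have "\<dots> = (\<integral>\<^sup>+x. ennreal (sqrt (nd m1 v1 x * nd m2 v2 x)) \<partial>lborel)"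
    using v' by (intro nn_integral_cong) (simp add: sqrt_normal_product ennreal_mult)
  finally show ?thesis using ennreal_leI by blast
qed

text \<open>One-sided coupling bound: only the part of p that exceeds min p q can raise the integral
  of \<psi>. The additive form avoids subtraction of extended reals.\<close>

lemma density_overlap:
  fixes p q :: "'a \<Rightarrow> real" and \<psi> :: "'a \<Rightarrow> ennreal"
  assumes [measurable]: "p \<in> borel_measurable N" "q \<in> borel_measurable N" "\<psi> \<in> borel_measurable N"
    and nn: "\<And>x. 0 \<le> p x" "\<And>x. 0 \<le> q x" and le1: "\<And>x. x \<in> space N \<Longrightarrow> \<psi> x \<le> 1"
    and 1: "(\<integral>\<^sup>+x. ennreal (p x) \<partial>N) = 1" and t: "0 \<le> t" "ennreal t \<le> (\<integral>\<^sup>+x. ennreal (min (p x) (q x)) \<partial>N)"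
  shows "(\<integral>\<^sup>+x. ennreal (p x) * \<psi> x \<partial>N) \<le> (\<integral>\<^sup>+x. ennreal (q x) * \<psi> x \<partial>N) + ennreal (1 - t)"
proof -
  let ?m = "\<lambda>x. min (p x) (q x)"
  have "(\<integral>\<^sup>+x. ennreal (?m x) \<partial>N) + (\<integral>\<^sup>+x. ennreal (p x - ?m x) \<partial>N) = (\<integral>\<^sup>+x. ennreal (p x) \<partial>N)"
    using nn by (subst nn_integral_add[symmetric]) (auto simp: ennreal_plus[symmetric] simp del: ennreal_plus)
  then have "ennreal t + (\<integral>\<^sup>+x. ennreal (p x - ?m x) \<partial>N) \<le> 1"
    using t(2) 1 by (metis add_right_mono)
  then have pm: "(\<integral>\<^sup>+x. ennreal (p x - ?m x) \<partial>N) \<le> ennreal (1 - t)"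
    using t(1) by (cases "(\<integral>\<^sup>+x. ennreal (p x - ?m x) \<partial>N)") 
      (auto simp: ennreal_plus[symmetric] top_unique simp del: ennreal_plus simp flip: ennreal_1 intro!: ennreal_leI)
  have "(\<integral>\<^sup>+x. ennreal (p x) * \<psi> x \<partial>N) \<le> (\<integral>\<^sup>+x. ennreal (q x) * \<psi> x + ennreal (p x - ?m x) \<partial>N)"
  proof (intro nn_integral_mono)
    fix x assume x: "x \<in> space N"
    have "ennreal (p x) = ennreal (?m x) + ennreal (p x - ?m x)"
      using nn by (simp add: ennreal_plus[symmetric] del: ennreal_plus)
    then have "ennreal (p x) * \<psi> x = ennreal (?m x) * \<psi> x + ennreal (p x - ?m x) * \<psi> x" by (simp add: distrib_right)
    also have "\<dots> \<le> ennreal (q x) * \<psi> x + ennreal (p x - ?m x) * 1" 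
      using le1[OF x] by (intro add_mono mult_mono ennreal_leI) auto
    finally show "ennreal (p x) * \<psi> x \<le> ennreal (q x) * \<psi> x + ennreal (p x - ?m x)" by simp
  qed
  also have "\<dots> = (\<integral>\<^sup>+x. ennreal (q x) * \<psi> x \<partial>N) + (\<integral>\<^sup>+x. ennreal (p x - ?m x) \<partial>N)"
    by (intro nn_integral_add) auto
  finally show ?thesis using pm by (meson add_left_mono order_trans)
qed

text \<open>Takes the place of Cauchy-Schwarz. With m the minimum and M the maximum of the
  densities, sqrt (m M) \<le> m / b + b M / 4, and M integrates to at most 2. Hence b \<le> I / b +
  b / 2 for the overlap I.\<close>

lemma overlap_ge_affinity:
  fixes p q :: "'a \<Rightarrow> real"
  assumes [measurable]: "p \<in> borel_measurable N" "q \<in> borel_measurable N"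
    and nn: "\<And>x. 0 \<le> p x" "\<And>x. 0 \<le> q x"
    and 1: "(\<integral>\<^sup>+x. ennreal (p x) \<partial>N) = 1" "(\<integral>\<^sup>+x. ennreal (q x) \<partial>N) = 1"
    and b: "0 < b" "ennreal b \<le> (\<integral>\<^sup>+x. ennreal (sqrt (p x * q x)) \<partial>N)"
  shows "ennreal (b\<^sup>2 / 2) \<le> (\<integral>\<^sup>+x. ennreal (min (p x) (q x)) \<partial>N)"
proof -
  let ?I = "\<integral>\<^sup>+x. ennreal (min (p x) (q x)) \<partial>N"
  have "(\<integral>\<^sup>+x. ennreal (sqrt (p x * q x)) \<partial>N) \<le>
      (\<integral>\<^sup>+x. ennreal (1 / b) * ennreal (min (p x) (q x)) + ennreal (b / 4) * (ennreal (p x) + ennreal (q x)) \<partial>N)"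
  proof (intro nn_integral_mono)
    fix x
    define m M where "m = min (p x) (q x)" and "M = max (p x) (q x)"
    have mM: "0 \<le> m" "0 \<le> M" "M \<le> p x + q x" "p x * q x = m * M" using nn[of x] by (auto simp: m_def M_def min_def max_def)
    have "sqrt (m * M) \<le> m / b + (b / 4) * M"
    proof (rule real_le_lsqrt)
      have "0 \<le> (m / b - (b / 4) * M)\<^sup>2" by simp
      then show "m * M \<le> (m / b + b / 4 * M)\<^sup>2" using b by (simp add: power2_eq_square field_simps)
    qed (use mM b in auto)
    also have "\<dots> \<le> m / b + (b / 4) * (p x + q x)" using mM b by (intro add_left_mono mult_left_mono) auto
    finally show "ennreal (sqrt (p x * q x)) \<le> ennreal (1 / b) * ennreal (min (p x) (q x)) + ennreal (b / 4) * (ennreal (p x) + ennreal (q x))"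
      using nn[of x] b mM unfolding mM(4) m_def[symmetric]
      by (simp add: ennreal_mult[symmetric] ennreal_plus[symmetric] ennreal_leI del: ennreal_plus)
  qed
  also have "\<dots> = ennreal (1 / b) * ?I + ennreal (b / 4) * (1 + 1)"
    by (simp add: nn_integral_add nn_integral_cmult 1)
  finally have *: "ennreal b \<le> ennreal (1 / b) * ?I + ennreal (b / 2)"
    using b by (simp add: ennreal_mult[symmetric] flip: ennreal_numeral)
  show ?thesis
  proof (cases ?I)
    case (real r)
    with * b have "b \<le> 1 / b * r + b / 2" 
      by (simp add: ennreal_mult[symmetric] ennreal_plus[symmetric] del: ennreal_plus)
    then have "b\<^sup>2 / 2 \<le> r" using b by (simp add: field_simps power2_eq_square)
    then show ?thesis using real by (simp add: ennreal_leI)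
  qed simp
qed

text \<open>Common mean, different variances. The error is a sum of one term in u and one term in v,
  both relative to a reference variance m, so that later each can be integrated on its own.\<close>

lemma normal_overlap_variance:
  assumes u: "u > 0" and v: "v > 0" and [measurable]: "\<psi> \<in> borel_measurable borel"
    and psi: "\<And>x. \<psi> x \<le> 1" and m: "m > 0"
  shows "(\<integral>\<^sup>+x. ennreal (nd c u x) * \<psi> x \<partial>lborel) \<le> (\<integral>\<^sup>+x. ennreal (nd c v x) * \<psi> x \<partial>lborel)
     + ennreal ((\<bar>u - m\<bar> + \<bar>v - m\<bar>) / m)"
proof -
  have key: "min u v / max u v \<le> sqrt (min u v / max u v)"
    using u v by (intro real_le_rsqrt) (auto simp: power2_eq_square min_def max_def divide_simps intro!: mult_mono)
  have "ennreal (min u v / max u v) \<le> (\<integral>\<^sup>+x. ennreal (min u v / max u v) * ennreal (nd c (min u v) x) \<partial>lborel)"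
    using u v by (subst nn_integral_cmult) (auto simp: nn_integral_nd)
  also have "\<dots> \<le> (\<integral>\<^sup>+x. ennreal (min (nd c u x) (nd c v x)) \<partial>lborel)"
  proof (intro nn_integral_mono)
    fix x
    \<comment> \<open>At every point the wider density dominates sqrt (s / t) times the narrower
      one; s / t is a smaller factor without a root.\<close>
    have le: "s / t * nd c s x \<le> nd c t x" if "0 < s" "s \<le> t" for s t
    proof -
      have "s / t * nd c s x \<le> sqrt (s / t) * nd c s x"
        using that by (intro mult_right_mono real_le_rsqrt) (auto simp: power2_eq_square divide_simps intro!: mult_mono)
      also have "\<dots> = exp (- (x - c)\<^sup>2 / (2 * s)) / sqrt (2 * pi * t)"
        using that by (simp add: nd_eq real_sqrt_divide real_sqrt_mult)
      also have "\<dots> \<le> exp (- (x - c)\<^sup>2 / (2 * t)) / sqrt (2 * pi * t)"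
        using that by (auto intro!: divide_right_mono divide_left_mono)
      finally show ?thesis using that by (simp add: nd_eq)
    qed
    have le1: "s / t * nd c s x \<le> nd c s x" if "0 < s" "s \<le> t" for s t
      using that by (intro mult_left_le_one_le) auto
    have "min u v / max u v * nd c (min u v) x \<le> min (nd c u x) (nd c v x)"
      using le[of u v] le[of v u] le1[of u v] le1[of v u] u v by (auto simp: min_def max_def)
    then show "ennreal (min u v / max u v) * ennreal (nd c (min u v) x) \<le> ennreal (min (nd c u x) (nd c v x))"
      using u v by (simp add: ennreal_mult[symmetric] ennreal_leI)
  qed
  finally have "ennreal (min u v / max u v) \<le> \<dots>" .
  then have "(\<integral>\<^sup>+x. ennreal (nd c u x) * \<psi> x \<partial>lborel) \<le> (\<integral>\<^sup>+x. ennreal (nd c v x) * \<psi> x \<partial>lborel)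
     + ennreal (1 - min u v / max u v)"
    using u v psi by (intro density_overlap) (auto simp: nn_integral_nd)
  moreover have "1 - min u v / max u v \<le> (\<bar>u - m\<bar> + \<bar>v - m\<bar>) / m"
  proof -
    have *: "1 - s / t \<le> (\<bar>s - m\<bar> + \<bar>t - m\<bar>) / m" if "0 < s" "s \<le> t" for s t
    proof (cases "t \<le> m")
      case True
      have "s / m \<le> s / t" using that True m by (intro divide_left_mono) auto
      moreover have "(\<bar>s - m\<bar> + \<bar>t - m\<bar>) / m = (1 - s / m) + (1 - t / m)" using that True m by (simp add: field_simps)
      moreover have "t / m \<le> 1" using True m by simp
      ultimately show ?thesis by linarith
    next
      case False
      have "1 - s / t = (t - s) / t" using that by (simp add: field_simps)
      also have "\<dots> \<le> (t - s) / m" using that False m by (intro divide_left_mono) auto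
      also have "\<dots> \<le> (\<bar>s - m\<bar> + \<bar>t - m\<bar>) / m" using m by (intro divide_right_mono) auto
      finally show ?thesis .
    qed
    show ?thesis using *[of u v] *[of v u] u v by (auto simp: min_def max_def add.commute)
  qed
  ultimately show ?thesis by (meson add_left_mono ennreal_leI order_trans)
qed

text \<open>Dual form of the Hairer-Mattingly theorem: the kernel shrinks the Lipschitz constant of
  \<phi> with respect to the weight 2 + \<beta> f x + \<beta> f y. The overlap hypothesis
  \<open>small\<close> treats pairs with f x + f y small, the drift treats the others, and \<beta>
  balances the two.\<close>

lemma hairer_mattingly:
  fixes Q :: "'a \<Rightarrow> 'a measure" and f :: "'a \<Rightarrow> real"
  assumes Q: "\<And>x. x \<in> space M \<Longrightarrow> prob_space (Q x)" "\<And>x. x \<in> space M \<Longrightarrow> sets (Q x) = sets M"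
    and f [measurable]: "f \<in> borel_measurable M" and f0: "\<And>x. 0 \<le> f x"
    and drift: "\<And>x. x \<in> space M \<Longrightarrow> (\<integral>\<^sup>+y. ennreal (f y) \<partial>Q x) \<le> ennreal (\<gamma> * f x + K)"
    and small: "\<And>x y \<psi>. \<lbrakk>x \<in> space M; y \<in> space M; f x + f y \<le> 4 * K / (1 - \<gamma>); \<psi> \<in> borel_measurable M;
        \<And>z. 0 \<le> \<psi> z; \<And>z. \<psi> z \<le> 1\<rbrakk> \<Longrightarrow> (\<integral>z. \<psi> z \<partial>Q x) - (\<integral>z. \<psi> z \<partial>Q y) \<le> 1 - \<epsilon>"
    and c: "0 \<le> \<gamma>" "\<gamma> < 1" "0 < K" "0 < \<epsilon>" "\<epsilon> \<le> 1"
    and beta: "\<beta> = \<epsilon> / (2 * K)" 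
    and alpha: "\<alpha> \<ge> 1 - \<epsilon> / 2" "\<alpha> \<ge> (2 + \<beta> * (4 * K / (1 - \<gamma>)) * ((1 + \<gamma>) / 2)) / (2 + \<beta> * (4 * K / (1 - \<gamma>)))"
    and phi [measurable]: "\<phi> \<in> borel_measurable M" and B: "\<And>x. x \<in> space M \<Longrightarrow> \<bar>\<phi> x\<bar> \<le> B" and L: "0 \<le> L"
    and lip: "\<And>x y. x \<in> space M \<Longrightarrow> y \<in> space M \<Longrightarrow> \<bar>\<phi> x - \<phi> y\<bar> \<le> L * (2 + \<beta> * f x + \<beta> * f y)"
    and xy: "x \<in> space M" "y \<in> space M"
  shows "\<bar>(\<integral>z. \<phi> z \<partial>Q x) - (\<integral>z. \<phi> z \<partial>Q y)\<bar> \<le> \<alpha> * L * (2 + \<beta> * f x + \<beta> * f y)"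
proof -
  let ?W = "\<lambda>x. L * (1 + \<beta> * f x)"
  have b: "\<beta> > 0" using c beta by simp
  have W0: "0 \<le> ?W x" for x using L b f0 by simp
  \<comment> \<open>By the Lipschitz bound, \<phi> - L (1 + \<beta> f) at one point never exceeds
    \<phi> + L (1 + \<beta> f) at another. A number C separating the two families gives \<bar>\<phi>
    - C\<bar> \<le> L (1 + \<beta> f).\<close>
  define C where "C = (SUP x\<in>space M. \<phi> x - ?W x)"
  have bdd: "bdd_above ((\<lambda>x. \<phi> x - ?W x) ` space M)"
    using B W0 by (intro bdd_aboveI2[of _ _ B]) (smt (verit))
  have C1: "\<phi> x - ?W x \<le> C" if "x \<in> space M" for x
    unfolding C_def by (rule cSUP_upper[OF that bdd])
  have C2: "C \<le> \<phi> x + ?W x" if "x \<in> space M" for x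
    unfolding C_def
  proof (rule cSUP_least)
    show "space M \<noteq> {}" using xy by auto
    fix y assume "y \<in> space M"
    from lip[OF that this] show "\<phi> y - ?W y \<le> \<phi> x + ?W x" by (simp add: algebra_simps)
  qed
  \<comment> \<open>The centred function is cut into a part bounded by L, to which the overlap
    applies, and a remainder bounded by L \<beta> f, which the drift controls.\<close>
  define p1 where "p1 z = max (- L) (min L (\<phi> z - C))" for z
  define p2 where "p2 z = \<phi> z - C - p1 z" for z
  have [measurable]: "p1 \<in> borel_measurable M" "p2 \<in> borel_measurable M" by (simp_all add: p1_def[abs_def] p2_def[abs_def])
  have p1: "- L \<le> p1 z" "p1 z \<le> L" for z using L by (auto simp: p1_def)
  have p2: "\<bar>p2 z\<bar> \<le> L * \<beta> * f z" if "z \<in> space M" for z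
    using C1[OF that] C2[OF that] L b f0[of z] mult_nonneg_nonneg[of "L * \<beta>" "f z"] unfolding p2_def p1_def by (auto simp: algebra_simps max_def min_def abs_if)
  define I where "I x = L * \<beta> * (\<gamma> * f x + K)" for x
  have split: "(\<integral>z. \<phi> z \<partial>Q x) = C + (\<integral>z. p1 z \<partial>Q x) + (\<integral>z. p2 z \<partial>Q x)" "\<bar>\<integral>z. p2 z \<partial>Q x\<bar> \<le> I x"
     "integrable (Q x) p1" if x: "x \<in> space M" for x
  proof -
    interpret prob_space "Q x" by (rule Q(1)[OF x])
    note Q(2)[OF x, measurable_cong]
    have sp: "space (Q x) = space M" using Q(2)[OF x] by (rule sets_eq_imp_space_eq)
    have fi: "integrable (Q x) f" "(\<integral>z. f z \<partial>Q x) \<le> \<gamma> * f x + K"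
    proof -
      show "integrable (Q x) f" using drift[OF x] f0 
        by (intro integrableI_nonneg) (auto intro: le_less_trans)
      show "(\<integral>z. f z \<partial>Q x) \<le> \<gamma> * f x + K"
        using drift[OF x] f0 c by (intro integral_real_bounded) auto
    qed
    show i1: "integrable (Q x) p1" using p1 by (intro integrable_const_bound[where B=L]) (auto simp: abs_le_iff minus_le_iff)
    have i2: "integrable (Q x) p2"
      using fi(1) p2 sp by (intro Bochner_Integration.integrable_bound[OF integrable_mult_right[OF fi(1), of "L * \<beta>"]])
        (auto intro: order_trans[OF _ abs_ge_self])
    have "(\<integral>z. \<phi> z \<partial>Q x) = (\<integral>z. C + p1 z + p2 z \<partial>Q x)" by (simp add: p2_def)
    also have "\<dots> = C + (\<integral>z. p1 z \<partial>Q x) + (\<integral>z. p2 z \<partial>Q x)" using i1 i2 by (simp add: prob_space)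
    finally show "(\<integral>z. \<phi> z \<partial>Q x) = C + (\<integral>z. p1 z \<partial>Q x) + (\<integral>z. p2 z \<partial>Q x)" .
    have "\<bar>\<integral>z. p2 z \<partial>Q x\<bar> \<le> (\<integral>z. \<bar>p2 z\<bar> \<partial>Q x)" by (rule integral_abs_bound)
    also have "\<dots> \<le> (\<integral>z. L * \<beta> * f z \<partial>Q x)"
      using p2 sp i2 fi by (intro integral_mono) auto
    also have "\<dots> \<le> I x" unfolding I_def using fi(2) L b by (simp add: mult_left_mono)
    finally show "\<bar>\<integral>z. p2 z \<partial>Q x\<bar> \<le> I x" .
  qed
  have main: "(\<integral>z. \<phi> z \<partial>Q x) - (\<integral>z. \<phi> z \<partial>Q y) \<le> \<alpha> * L * (2 + \<beta> * f x + \<beta> * f y)"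
    if x: "x \<in> space M" and y: "y \<in> space M" for x y
  proof -
    define s where "s = f x + f y"
    have s0: "s \<ge> 0" using f0 by (simp add: s_def)
    \<comment> \<open>The reason for \<beta> = \<epsilon> / (2 K): the additive drift constants of x
      and y together cost \<epsilon>, half of the gain 2 \<epsilon> that the overlap
      provides.\<close>
    have K2: "\<beta> * (2 * K) = \<epsilon>" using c by (simp add: beta)
    have Is: "I x + I y = L * (\<beta> * \<gamma> * s + \<epsilon>)" unfolding K2[symmetric] by (simp add: I_def s_def algebra_simps)
    have d: "(\<integral>z. \<phi> z \<partial>Q x) - (\<integral>z. \<phi> z \<partial>Q y) \<le> ((\<integral>z. p1 z \<partial>Q x) - (\<integral>z. p1 z \<partial>Q y)) + L * (\<beta> * \<gamma> * s + \<epsilon>)"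
      using split(1,2)[OF x] split(1,2)[OF y] Is by linarith
    interpret X: prob_space "Q x" by (rule Q(1)[OF x])
    interpret Y: prob_space "Q y" by (rule Q(1)[OF y])
    define R where "R = 4 * K / (1 - \<gamma>)"
    have R0: "R > 0" using c by (simp add: R_def)
    have al: "(2 + \<beta> * R * ((1 + \<gamma>) / 2)) \<le> \<alpha> * (2 + \<beta> * R)"
    proof -
      have "(2 + \<beta> * R * ((1 + \<gamma>) / 2)) / (2 + \<beta> * R) \<le> \<alpha>" using alpha(2) unfolding R_def .
      moreover have "2 + \<beta> * R > 0" using b R0 by (simp add: add_pos_nonneg)
      ultimately show ?thesis by (simp add: pos_divide_le_eq)
    qed
    have "\<alpha> \<ge> (1 + \<gamma>) / 2"
    proof -
      have "(1 + \<gamma>) / 2 * (2 + \<beta> * R) \<le> 2 + \<beta> * R * ((1 + \<gamma>) / 2)" using c by (simp add: field_simps)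
      also note al
      finally show ?thesis using b R0 by (simp add: add_pos_nonneg)
    qed
    show ?thesis
    proof (cases "s \<le> R")
      case True
      have "(\<integral>z. p1 z \<partial>Q x) - (\<integral>z. p1 z \<partial>Q y) \<le> 2 * L * (1 - \<epsilon>)"
      proof (cases "L = 0")
        case True
        then have "p1 z = 0" for z using p1[of z] by simp
        then show ?thesis using True by simp
      next
        case False
        then have L0: "L > 0" using L by simp
        \<comment> \<open>An affine rescaling from [-L, L] to [0, 1] fits the hypothesis
          \<open>small\<close>.\<close>
        have "(\<integral>z. (p1 z + L) / (2 * L) \<partial>Q x) - (\<integral>z. (p1 z + L) / (2 * L) \<partial>Q y) \<le> 1 - \<epsilon>"
        proof (intro small x y)
          fix z
          show "0 \<le> (p1 z + L) / (2 * L)" using p1(1)[of z] L0 by simp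
          show "(p1 z + L) / (2 * L) \<le> 1" using p1(2)[of z] L0 by simp
        qed (use True in \<open>auto simp: s_def R_def\<close>)
        then have "((\<integral>z. p1 z \<partial>Q x) + L) / (2 * L) - ((\<integral>z. p1 z \<partial>Q y) + L) / (2 * L) \<le> 1 - \<epsilon>"
          using split(3)[OF x] split(3)[OF y] by (simp add: X.prob_space Y.prob_space)
        then have "((\<integral>z. p1 z \<partial>Q x) - (\<integral>z. p1 z \<partial>Q y)) / (2 * L) \<le> 1 - \<epsilon>"
          by (simp add: diff_divide_distrib[symmetric])
        then show ?thesis using L0 by (simp add: pos_divide_le_eq mult_ac)
      qed
      then have "(\<integral>z. \<phi> z \<partial>Q x) - (\<integral>z. \<phi> z \<partial>Q y) \<le> L * (2 - \<epsilon> + \<beta> * \<gamma> * s)"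
        using d by (simp add: algebra_simps)
      moreover have "2 - \<epsilon> + \<beta> * \<gamma> * s \<le> \<alpha> * 2 + \<beta> * s * \<alpha>"
      proof (rule add_mono)
        have "\<gamma> \<le> \<alpha>" using \<open>\<alpha> \<ge> (1 + \<gamma>) / 2\<close> c by (simp add: field_simps)
        then show "\<beta> * \<gamma> * s \<le> \<beta> * s * \<alpha>" using b s0 by (simp add: mult.commute mult.left_commute mult_left_mono mult_right_mono)
      qed (use alpha in auto)
      ultimately have "(\<integral>z. \<phi> z \<partial>Q x) - (\<integral>z. \<phi> z \<partial>Q y) \<le> L * (\<alpha> * 2 + \<beta> * s * \<alpha>)"
        using L by (meson mult_left_mono order_trans)
      then show ?thesis by (simp add: s_def algebra_simps)
    next
      case False
      have "(\<integral>z. p1 z \<partial>Q x) \<le> L" "(\<integral>z. p1 z \<partial>Q y) \<ge> - L"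
        using p1 split(3)[OF x] split(3)[OF y] by (auto intro!: X.integral_le_const Y.integral_ge_const)
      then have "(\<integral>z. \<phi> z \<partial>Q x) - (\<integral>z. \<phi> z \<partial>Q y) \<le> L * (2 + \<epsilon> + \<beta> * \<gamma> * s)"
        using d by (simp add: algebra_simps)
      moreover have "2 + \<epsilon> + \<beta> * \<gamma> * s \<le> \<alpha> * (2 + \<beta> * s)"
      proof -
        \<comment> \<open>Since R (1 - \<gamma>) = 4 K, one has 2 \<epsilon> = \<beta> R (1 -
          \<gamma>), so at s = R the claim is the lower bound \<open>al\<close> on \<alpha>; the
          bound \<alpha> \<ge> (1 + \<gamma>) / 2 carries it to larger s. The products are named so
          that what remains is linear arithmetic.\<close>
        define p u w z a1 a2 where "p = \<beta> * R" and "u = \<beta> * R * \<gamma>" and "w = \<beta> * s" and "z = \<beta> * \<gamma> * s"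
          and "a1 = \<alpha> * (\<beta> * R)" and "a2 = \<alpha> * (\<beta> * s)"
        note defs = p_def u_def w_def z_def a1_def a2_def
        have "R * (1 - \<gamma>) = 4 * K" using c by (simp add: R_def)
        moreover have "p - u = \<beta> * (R * (1 - \<gamma>))" unfolding defs by (simp add: algebra_simps)
        ultimately have "2 * \<epsilon> = p - u" unfolding K2[symmetric] by simp
        moreover have "\<beta> * (s - R) * (1 + \<gamma>) \<le> \<beta> * (s - R) * (2 * \<alpha>)"
          using \<open>\<alpha> \<ge> (1 + \<gamma>) / 2\<close> b False by (intro mult_left_mono) auto
        then have "w + z - p - u \<le> 2 * a2 - 2 * a1" unfolding defs by (simp add: algebra_simps)
        moreover have "\<beta> * (1 - \<gamma>) * R \<le> \<beta> * (1 - \<gamma>) * s"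
          using b c False by (intro mult_left_mono) auto
        then have "p - u \<le> w - z" unfolding defs by (simp add: algebra_simps)
        moreover have "4 + p + u \<le> 2 * a1 + 4 * \<alpha>" using al unfolding defs by (simp add: field_simps)
        ultimately have "\<epsilon> + 2 + z \<le> a2 + 2 * \<alpha>" by linarith
        then show ?thesis unfolding defs by (simp add: algebra_simps)
      qed
      ultimately have "(\<integral>z. \<phi> z \<partial>Q x) - (\<integral>z. \<phi> z \<partial>Q y) \<le> L * (\<alpha> * (2 + \<beta> * s))"
        using L by (meson mult_left_mono order_trans)
      then show ?thesis by (simp add: s_def algebra_simps)
    qed
  qed
  from main[OF xy] main[OF xy(2,1)] show ?thesis by (simp add: algebra_simps abs_le_iff)
qed

section \<open>Moments\<close>

lemma has_bochner_integral_thetas_prod: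
  assumes "\<And>i. i < n \<Longrightarrow> has_bochner_integral lborel (g i) (I i :: real)"
  shows "has_bochner_integral (thetas n) (\<lambda>th. \<Prod>i<n. g i (th i)) (\<Prod>i<n. I i)"
proof -
  have i: "\<And>i. i \<in> {..<n} \<Longrightarrow> integrable lborel (g i)" "\<And>i. i < n \<Longrightarrow> (\<integral>x. g i x \<partial>lborel) = I i"
    using assms by (auto simp: has_bochner_integral_iff)
  show ?thesis
    using L.product_integrable_prod[of "{..<n}" g] L.product_integral_prod[of "{..<n}" g] i
    by (simp add: has_bochner_integral_iff)
qed

text \<open>The X i are independent and centred under \<open>pd\<close>, so the square of their sum
  has only diagonal terms. Arbitrary X i are allowed in order to serve both the average of theta and
  its sum of squares.\<close>

lemma pd_second_moment:
  fixes X :: "nat \<Rightarrow> real \<Rightarrow> real"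
  assumes X0: "\<And>i. i < n \<Longrightarrow> has_bochner_integral lborel (\<lambda>x. nd (m i) v x * X i x) 0"
    and X2: "\<And>i. i < n \<Longrightarrow> has_bochner_integral lborel (\<lambda>x. nd (m i) v x * (X i x)\<^sup>2) (s i)"
    and v: "v > 0"
  shows "(\<integral>\<^sup>+th. ennreal (pd n m v th * (c + (\<Sum>i<n. X i (th i)))\<^sup>2) \<partial>thetas n) = ennreal (c\<^sup>2 + (\<Sum>i<n. s i))"
proof -
  have 1: "has_bochner_integral lborel (nd (m i) v) 1" for i
    using v by (simp add: has_bochner_integral_iff)
  have lin: "has_bochner_integral (thetas n) (\<lambda>th. pd n m v th * X i (th i)) 0" if i: "i < n" for i
  proof -
    have "has_bochner_integral (thetas n) (\<lambda>th. \<Prod>k<n. nd (m k) v (th k) * (if k = i then X k (th k) else 1))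
        (\<Prod>k<n. if k = i then 0 else 1)"
      using X0[OF i] 1 by (intro has_bochner_integral_thetas_prod) auto
    moreover have "(\<Prod>k<n. if k = i then 0 else 1) = (0::real)" using i by auto
    moreover have "(\<Prod>k<n. nd (m k) v (th k) * (if k = i then X k (th k) else 1)) = pd n m v th * X i (th i)" for th
      using i by (simp add: prod.distrib pd_def)
    ultimately show ?thesis by simp
  qed
  have quad: "has_bochner_integral (thetas n) (\<lambda>th. pd n m v th * (X i (th i) * X j (th j))) (if i = j then s i else 0)"
    if i: "i < n" and j: "j < n" for i j
  proof -
    \<comment> \<open>Two separate conditionals let one product formula cover both i = j and i
      \<noteq> j.\<close>
    have "has_bochner_integral (thetas n) (\<lambda>th. \<Prod>k<n. nd (m k) v (th k) * ((if k = i then X k (th k) else 1) * (if k = j then X k (th k) else 1)))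
        (\<Prod>k<n. if i = j then (if k = i then s k else 1) else (if k = i \<or> k = j then 0 else 1))"
      using X0[OF i] X0[OF j] X2[OF i] 1 by (intro has_bochner_integral_thetas_prod) (auto simp: power2_eq_square)
    moreover have "(\<Prod>k<n. if i = j then (if k = i then s k else 1) else (if k = i \<or> k = j then 0 else 1)) = (if i = j then s i else 0)" 
      using i by auto
    moreover have "(\<Prod>k<n. nd (m k) v (th k) * ((if k = i then X k (th k) else 1) * (if k = j then X k (th k) else 1)))
       = pd n m v th * (X i (th i) * X j (th j))" for th
      using i j by (simp add: prod.distrib pd_def)
    ultimately show ?thesis by simp
  qed
  have 0: "has_bochner_integral (thetas n) (pd n m v) 1"
    using has_bochner_integral_thetas_prod[of n "\<lambda>i. nd (m i) v" "\<lambda>_. 1"] 1 by (simp add: pd_def[abs_def])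
  have "has_bochner_integral (thetas n) (\<lambda>th. c\<^sup>2 * pd n m v th + (2 * c) * (\<Sum>i<n. pd n m v th * X i (th i))
      + (\<Sum>i<n. \<Sum>j<n. pd n m v th * (X i (th i) * X j (th j)))) (c\<^sup>2 * 1 + (2 * c) * (\<Sum>i<n. 0) + (\<Sum>i<n. \<Sum>j<n. (if i = j then s i else 0)))"
    using lin quad 0 by (intro has_bochner_integral_add has_bochner_integral_sum has_bochner_integral_mult_right) auto
  moreover have "c\<^sup>2 * pd n m v th + (2 * c) * (\<Sum>i<n. pd n m v th * X i (th i))
      + (\<Sum>i<n. \<Sum>j<n. pd n m v th * (X i (th i) * X j (th j))) = pd n m v th * (c + (\<Sum>i<n. X i (th i)))\<^sup>2" for th
  proof -
    have "(\<Sum>i<n. X i (th i))\<^sup>2 = (\<Sum>i<n. \<Sum>j<n. X i (th i) * X j (th j))"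
      unfolding power2_eq_square by (rule sum_product)
    then have "(\<Sum>i<n. \<Sum>j<n. pd n m v th * (X i (th i) * X j (th j))) = pd n m v th * (\<Sum>i<n. X i (th i))\<^sup>2"
      by (simp only: sum_distrib_left)
    moreover have "(\<Sum>i<n. pd n m v th * X i (th i)) = pd n m v th * (\<Sum>i<n. X i (th i))"
      by (simp only: sum_distrib_left)
    ultimately show ?thesis by (simp add: power2_sum algebra_simps)
  qed
  ultimately have "has_bochner_integral (thetas n) (\<lambda>th. pd n m v th * (c + (\<Sum>i<n. X i (th i)))\<^sup>2) (c\<^sup>2 + (\<Sum>i<n. s i))"
    by simp
  then show ?thesis
    by (subst nn_integral_eq_integral) (auto simp: has_bochner_integral_iff)
qed

lemma normal_moments:
  assumes "v > 0"
  shows "has_bochner_integral lborel (\<lambda>x. nd m v x) 1"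
    "has_bochner_integral lborel (\<lambda>x. nd m v x * (x - m)) 0"
    "has_bochner_integral lborel (\<lambda>x. nd m v x * (x - m)\<^sup>2) v"
    "has_bochner_integral lborel (\<lambda>x. nd m v x * (x - m) ^ 3) 0"
    "has_bochner_integral lborel (\<lambda>x. nd m v x * (x - m) ^ 4) (3 * v\<^sup>2)"
proof -
  have s: "sqrt v > 0" "(sqrt v)\<^sup>2 = v" using assms by auto
  show "has_bochner_integral lborel (\<lambda>x. nd m v x) 1"
    using s by (simp add: has_bochner_integral_iff)
  show "has_bochner_integral lborel (\<lambda>x. nd m v x * (x - m)) 0"
    using normal_moment_odd[OF s(1), of m 0] by simp
  show "has_bochner_integral lborel (\<lambda>x. nd m v x * (x - m)\<^sup>2) v"
    using normal_moment_even[OF s(1), of m 1] s by (simp add: fact_numeral)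
  show "has_bochner_integral lborel (\<lambda>x. nd m v x * (x - m) ^ 3) 0"
    using normal_moment_odd[OF s(1), of m 1] by (simp add: numeral_3_eq_3)
  have "fact (2 * 2) / ((2 / (sqrt v)\<^sup>2)^2 * fact 2) = 3 * v\<^sup>2" unfolding s(2) by (simp add: fact_numeral field_simps)
  then show "has_bochner_integral lborel (\<lambda>x. nd m v x * (x - m) ^ 4) (3 * v\<^sup>2)"
    using normal_moment_even[OF s(1), of m 2] by simp
qed

text \<open>Fluctuation of one summand in the sum of squares of theta, where d will be the deviation
  of its mean from the average of the means. Expanding the square leaves normal moments up to order
  four.\<close>

lemma noncentral_square_moments:
  fixes d :: real
  assumes "v > 0"
  shows "has_bochner_integral lborel (\<lambda>x. nd m v x * ((d + (x - m))\<^sup>2 - d\<^sup>2 - v)) 0"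
    "has_bochner_integral lborel (\<lambda>x. nd m v x * ((d + (x - m))\<^sup>2 - d\<^sup>2 - v)\<^sup>2) (4 * d\<^sup>2 * v + 2 * v\<^sup>2)"
proof -
  note M = normal_moments[OF assms, of m]
  have "has_bochner_integral lborel (\<lambda>x. (2 * d) * (nd m v x * (x - m)) + nd m v x * (x - m)\<^sup>2 - v * nd m v x)
     ((2 * d) * 0 + v - v * 1)"
    using M by (intro has_bochner_integral_add has_bochner_integral_diff has_bochner_integral_mult_right) auto
  then show "has_bochner_integral lborel (\<lambda>x. nd m v x * ((d + (x - m))\<^sup>2 - d\<^sup>2 - v)) 0"
    by (simp add: algebra_simps power2_eq_square)
  have "has_bochner_integral lborel (\<lambda>x. (4 * d\<^sup>2 - 2 * v) * (nd m v x * (x - m)\<^sup>2) + nd m v x * (x - m) ^ 4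
      + v\<^sup>2 * nd m v x + (4 * d) * (nd m v x * (x - m) ^ 3) - (4 * d * v) * (nd m v x * (x - m)))
     ((4 * d\<^sup>2 - 2 * v) * v + 3 * v\<^sup>2 + v\<^sup>2 * 1 + (4 * d) * 0 - (4 * d * v) * 0)"
    using M by (intro has_bochner_integral_add has_bochner_integral_diff has_bochner_integral_mult_right) auto
  moreover have e1: "(4 * d\<^sup>2 - 2 * v) * (nd m v x * (x - m)\<^sup>2) + nd m v x * (x - m) ^ 4
      + v\<^sup>2 * nd m v x + (4 * d) * (nd m v x * (x - m) ^ 3) - (4 * d * v) * (nd m v x * (x - m))
     = nd m v x * ((d + (x - m))\<^sup>2 - d\<^sup>2 - v)\<^sup>2" for x
    by (simp add: power2_eq_square power3_eq_cube power4_eq_xxxx algebra_simps)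
  moreover have e2: "(4 * d\<^sup>2 - 2 * v) * v + 3 * v\<^sup>2 + v\<^sup>2 * 1 + (4 * d) * 0 - (4 * d * v) * 0 = 4 * d\<^sup>2 * v + 2 * v\<^sup>2"
    by (simp add: power2_eq_square algebra_simps)
  ultimately show "has_bochner_integral lborel (\<lambda>x. nd m v x * ((d + (x - m))\<^sup>2 - d\<^sup>2 - v)\<^sup>2) (4 * d\<^sup>2 * v + 2 * v\<^sup>2)"
    unfolding e1 e2 by blast
qed

lemma igd_has_integral: "al > 0 \<Longrightarrow> be > 0 \<Longrightarrow> has_bochner_integral lborel (igd al be) 1"
  using nn_integral_igd[of al be] 
  by (intro has_bochner_integral_nn_integral) auto

text \<open>Each factor x lowers the shape by one, so the moments of the inverse gamma law reduce to
  total masses.\<close>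

lemma igd_mult_self:
  assumes "al > 1" "be > 0"
  shows "igd al be x * x = be / (al - 1) * igd (al - 1) be x"
proof (cases "x > 0")
  case True
  have g: "Gamma al = (al - 1) * Gamma (al - 1)"
    using Gamma_plus1[of "al - 1"] assms by (auto simp: nonpos_Ints_def)
  have p: "be powr al = be * be powr (al - 1)" using assms by (simp add: powr_diff)
  have x: "x powr (- (al - 1) - 1) = x powr (- al - 1) * x" using True by (simp add: powr_diff powr_minus field_simps)
  have "igd al be x * x = be * be powr (al - 1) / ((al - 1) * Gamma (al - 1)) * x powr (- al - 1) * exp (- be / x) * x"
    using True unfolding igd_def g p by simp
  also have "\<dots> = be / (al - 1) * (be powr (al - 1) / Gamma (al - 1) * (x powr (- al - 1) * x) * exp (- be / x))"
    by simp
  finally show ?thesis using True unfolding igd_def x by simp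
qed (simp add: igd_def)

lemma nn_integral_igd_variance:
  assumes "al > 2" "be > 0"
  shows "(\<integral>\<^sup>+x. ennreal (igd al be x * (x - be / (al - 1))\<^sup>2) \<partial>lborel) = ennreal ((be / (al - 1))\<^sup>2 / (al - 2))"
proof -
  let ?m = "be / (al - 1)"
  have *: "igd al be x * (x - ?m)\<^sup>2 = (?m * (be / (al - 2))) * igd (al - 2) be x - (2 * ?m * ?m) * igd (al - 1) be x + ?m\<^sup>2 * igd al be x" for x
  proof -
    have 1: "igd al be x * x = ?m * igd (al - 1) be x" using assms by (intro igd_mult_self) auto
    have 2: "igd (al - 1) be x * x = be / (al - 2) * igd (al - 2) be x"
      using igd_mult_self[of "al - 1" be x] assms by simp
    have "igd al be x * (x - ?m)\<^sup>2 = (igd al be x * x) * x - 2 * ?m * (igd al be x * x) + ?m\<^sup>2 * igd al be x"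
      by (simp add: power2_eq_square algebra_simps)
    also have "\<dots> = ?m * (igd (al - 1) be x * x) - (2 * ?m * ?m) * igd (al - 1) be x + ?m\<^sup>2 * igd al be x"
      unfolding 1 by (simp only: mult_ac)
    finally show ?thesis unfolding 2 by (simp only: mult_ac)
  qed
  have "has_bochner_integral lborel (\<lambda>x. (?m * (be / (al - 2))) * igd (al - 2) be x - (2 * ?m * ?m) * igd (al - 1) be x + ?m\<^sup>2 * igd al be x)
     ((?m * (be / (al - 2))) * 1 - (2 * ?m * ?m) * 1 + ?m\<^sup>2 * 1)"
    using assms by (intro has_bochner_integral_add has_bochner_integral_diff has_bochner_integral_mult_right igd_has_integral) auto
  also have "(?m * (be / (al - 2))) * 1 - (2 * ?m * ?m) * 1 + ?m\<^sup>2 * 1 = ?m\<^sup>2 / (al - 2)"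
    using assms by (simp add: divide_simps) (simp add: power2_eq_square algebra_simps)
  finally show ?thesis unfolding *[symmetric] using assms
    by (subst nn_integral_eq_integral) (auto simp: has_bochner_integral_iff)
qed

text \<open>The parallel axis identity.\<close>

lemma ssq_shift:
  assumes "n > 0"
  shows "ssq n y = (\<Sum>i<n. (y i - t)\<^sup>2) - real n * (avg n y - t)\<^sup>2"
proof -
  define s where "s = avg n y"
  have s: "(\<Sum>i<n. y i) = n * s" using assms by (simp add: s_def avg_def)
  have e: "(\<Sum>i<n. (y i - u)\<^sup>2) = (\<Sum>i<n. (y i)\<^sup>2) - 2 * u * (n * s) + n * u\<^sup>2" for u :: real
    unfolding s[symmetric] by (simp add: power2_diff sum.distrib sum_subtractf sum_distrib_left mult_ac)
  show ?thesis unfolding ssq_def s_def[symmetric] e by (simp add: power2_eq_square algebra_simps)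
qed

section \<open>Drift of the clamped sampler\<close>

text \<open>Here x is the contracting part of A' - As and the rest is noise. Because the left side
  is capped at h, the nonnegative z2 may be replaced by min z2 h, whose square is at most h z2: the
  first moment of z2 will do. Keeping the factor of x^2 close to 1 costs the factor 1 + 1 / e on the
  noise, and 4 is the number of noise terms.\<close>

lemma truncated_square_le:
  fixes x y t z1 z2 h e :: real
  assumes "h \<ge> 0" "z2 \<ge> 0" "e > 0"
  shows "(min \<bar>x + y + t + z1 - z2\<bar> h)\<^sup>2 \<le> (1 + e) * x\<^sup>2 + 4 * (1 + 1 / e) * (y\<^sup>2 + t\<^sup>2 + z1\<^sup>2 + h * z2)"
proof -
  define w where "w = min z2 h"
  define s where "s = \<bar>y\<bar> + \<bar>t\<bar> + \<bar>z1\<bar> + w"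
  have w: "w \<ge> 0" "w\<^sup>2 \<le> h * z2" using assms by (auto simp: w_def power2_eq_square min_def intro: mult_mono mult_right_mono)
  have "min \<bar>x + y + t + z1 - z2\<bar> h \<le> \<bar>x\<bar> + s" using assms unfolding s_def w_def by (auto simp: min_def)
  then have 1: "(min \<bar>x + y + t + z1 - z2\<bar> h)\<^sup>2 \<le> (\<bar>x\<bar> + s)\<^sup>2" using assms by (intro power_mono) auto
  have 2: "(\<bar>x\<bar> + s)\<^sup>2 \<le> (1 + e) * x\<^sup>2 + (1 + 1 / e) * s\<^sup>2"
  proof -
    have "0 \<le> (e * \<bar>x\<bar> - s)\<^sup>2 / e" using assms by simp
    also have "\<dots> = e * x\<^sup>2 - 2 * \<bar>x\<bar> * s + s\<^sup>2 / e" using assms by (simp add: power2_eq_square field_simps abs_mult_self_eq)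
    finally show ?thesis by (simp add: power2_sum algebra_simps)
  qed
  have "0 \<le> (\<bar>y\<bar> - \<bar>t\<bar>)\<^sup>2 + (\<bar>y\<bar> - \<bar>z1\<bar>)\<^sup>2 + (\<bar>y\<bar> - w)\<^sup>2 + (\<bar>t\<bar> - \<bar>z1\<bar>)\<^sup>2 + (\<bar>t\<bar> - w)\<^sup>2 + (\<bar>z1\<bar> - w)\<^sup>2"
    by simp
  then have "s\<^sup>2 \<le> 4 * (y\<^sup>2 + t\<^sup>2 + z1\<^sup>2 + w\<^sup>2)"
    unfolding s_def by (simp add: power2_eq_square algebra_simps abs_mult_self_eq)
  also have "4 * (y\<^sup>2 + t\<^sup>2 + z1\<^sup>2 + w\<^sup>2) \<le> 4 * (y\<^sup>2 + t\<^sup>2 + z1\<^sup>2 + h * z2)" using w by simp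
  finally have "(1 + 1 / e) * s\<^sup>2 \<le> (1 + 1 / e) * (4 * (y\<^sup>2 + t\<^sup>2 + z1\<^sup>2 + h * z2))"
    using assms by (intro mult_left_mono) auto
  with 1 2 show ?thesis by (simp only: mult_ac)
qed

text \<open>The term t of \<open>truncated_square_le\<close> becomes the deviation of A from the
  inverse gamma mean, whose square integrates to the variance; x, y, z1 and z2 describe the mean
  itself.\<close>

lemma igd_truncated_moment:
  fixes m As h e x y z1 z2 al be :: real
  assumes "h \<ge> 0" "z2 \<ge> 0" "e > 0" "al > 2" "be > 0"
    and eq: "be / (al - 1) - As = x + y + z1 - z2"
  shows "(\<integral>\<^sup>+A. ennreal (igd al be A * (min \<bar>A - As\<bar> h)\<^sup>2) \<partial>lborel)
    \<le> ennreal ((1 + e) * x\<^sup>2 + 4 * (1 + 1 / e) * (y\<^sup>2 + (be / (al - 1))\<^sup>2 / (al - 2) + z1\<^sup>2 + h * z2))"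
proof -
  let ?m = "be / (al - 1)"
  define D where "D = 4 * (1 + 1 / e)"
  define C where "C = (1 + e) * x\<^sup>2 + D * (y\<^sup>2 + z1\<^sup>2 + h * z2)"
  have D: "D \<ge> 0" and C: "C \<ge> 0" using assms by (auto simp: D_def C_def)
  have "(\<integral>\<^sup>+A. ennreal (igd al be A * (min \<bar>A - As\<bar> h)\<^sup>2) \<partial>lborel)
     \<le> (\<integral>\<^sup>+A. ennreal C * ennreal (igd al be A) + ennreal D * ennreal (igd al be A * (A - ?m)\<^sup>2) \<partial>lborel)"
  proof (intro nn_integral_mono)
    fix A
    have i: "igd al be A \<ge> 0" using assms by simp
    have "A - As = x + y + (A - ?m) + z1 - z2" using eq by simp
    then have "(min \<bar>A - As\<bar> h)\<^sup>2 \<le> C + D * (A - ?m)\<^sup>2"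
      using truncated_square_le[OF assms(1-3), of x y "A - ?m" z1] by (simp add: C_def D_def algebra_simps)
    then have "igd al be A * (min \<bar>A - As\<bar> h)\<^sup>2 \<le> igd al be A * (C + D * (A - ?m)\<^sup>2)"
      using i by (rule mult_left_mono)
    also have "\<dots> = C * igd al be A + D * (igd al be A * (A - ?m)\<^sup>2)" by (simp add: algebra_simps)
    finally have "ennreal (igd al be A * (min \<bar>A - As\<bar> h)\<^sup>2) \<le> ennreal \<dots>" by (rule ennreal_leI)
    then show "ennreal (igd al be A * (min \<bar>A - As\<bar> h)\<^sup>2) \<le> ennreal C * ennreal (igd al be A) + ennreal D * ennreal (igd al be A * (A - ?m)\<^sup>2)"
      using C D i by (simp add: ennreal_mult ennreal_plus)
  qed
  also have "\<dots> = ennreal C + ennreal D * ennreal (?m\<^sup>2 / (al - 2))"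
    using assms by (simp add: nn_integral_add nn_integral_cmult nn_integral_igd nn_integral_igd_variance)
  also have "\<dots> = ennreal (C + D * (?m\<^sup>2 / (al - 2)))"
    using C D assms by (simp add: ennreal_mult[symmetric] ennreal_plus[symmetric] del: ennreal_plus)
  also have "C + D * (?m\<^sup>2 / (al - 2)) = (1 + e) * x\<^sup>2 + D * (y\<^sup>2 + ?m\<^sup>2 / (al - 2) + z1\<^sup>2 + h * z2)"
    by (simp add: C_def algebra_simps)
  finally show ?thesis unfolding D_def by (simp add: mult.assoc)
qed

text \<open>The regime in which both bounds of (A) hold. From n = 10 on, (n - 5) / 2 \<ge> n / 4, so
  \<open>al - 1\<close> and \<open>al - 2\<close> are at least n / 4.\<close>

locale gibbs_reg = gibbs +
  fixes \<delta> M :: real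
  assumes del: "\<delta> > 0" and n10: "n \<ge> 10"
    and lo: "V + \<delta> \<le> ssq n Y / (real n - 1)" and hi: "ssq n Y / (real n - 1) \<le> M"
begin

definition "As = ssq n Y / (real n - 1) - V"
definition "Yb = avg n Y"
text \<open>As is at least \<delta>, so this h keeps the clamped A above \<delta> / 2;
  \<open>q\<close> is the value of A / (V + A) at \<delta> / 2.\<close>

definition "h = \<delta> / 2"
definition "q = \<delta> / (2 * V + \<delta>)"
definition "\<gamma> = 1 - q\<^sup>2"
definition "cl A = max (As - h) (min (As + h) A)"
definition lyap :: "state \<Rightarrow> real" where
  "lyap x = real n * (avg n (snd (snd x)) - Yb)\<^sup>2 + real n * (min \<bar>fst x - As\<bar> h)\<^sup>2"
definition Q :: "state \<Rightarrow> state measure" where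
  "Q x = P (cl (fst x), snd x)"

text \<open>\<open>B1\<close> bounds the deterministic part of the inverse gamma mean,
  \<open>B2\<close> the average variance of the squared deviations of theta, \<open>B3\<close> the
  numerator of a bias of order 1 / n. \<open>D\<close> is the noise factor of
  \<open>truncated_square_le\<close> for e = q^2. None of these constants contains n or Y.\<close>

definition "B1 = 4 * b0 + 2 * M + 2 * V"
definition "B2 = 4 * V * M + 2 * V\<^sup>2"
definition "B3 = b0 + V + \<bar>a - 1\<bar> * (M + V)"
definition "D = 4 * (1 + 1 / q\<^sup>2)"
definition "Kd = 2 * V + D * (16 * B3\<^sup>2 + 8 * B1\<^sup>2 + 36 * B2 + 2 * h * V)"

lemma As: "\<delta> \<le> As" "As + V \<le> M" "ssq n Y = (real n - 1) * (V + As)"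
  using lo hi n10 by (auto simp: As_def)

lemma h_pos: "h > 0" using del by (simp add: h_def)

lemma cl: "As - h \<le> cl A" "cl A \<le> As + h" "\<delta> / 2 \<le> cl A" "cl A > 0" "\<bar>cl A - As\<bar> = min \<bar>A - As\<bar> h"
  using As del by (auto simp: cl_def h_def max_def min_def abs_if)

lemma q: "0 < q" "q < 1" using V del by (auto simp: q_def)

lemma D_nonneg: "D \<ge> 0" by (simp add: D_def)

lemma M_nonneg: "M \<ge> 0" using As V del by linarith

lemma ssq_le: "ssq n Y \<le> real n * M"
proof -
  have "ssq n Y \<le> (real n - 1) * M" using hi n10 by (simp add: pos_divide_le_eq mult.commute)
  also have "\<dots> \<le> real n * M" using M_nonneg by (intro mult_right_mono) auto
  finally show ?thesis .
qed

lemma ratio: "A > 0 \<Longrightarrow> 0 \<le> A / (V + A)" "A > 0 \<Longrightarrow> A / (V + A) \<le> 1" using V by auto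

lemma ratio_ge: "\<delta> / 2 \<le> A \<Longrightarrow> q \<le> A / (V + A)"
  using V del by (simp add: q_def divide_simps) (simp add: algebra_simps)

lemma al_bounds: "al - 1 \<ge> real n / 4" "al - 2 \<ge> real n / 4" "al > 2"
proof -
  have "real n \<ge> 10" using n10 by simp
  then show "al - 1 \<ge> real n / 4" "al - 2 \<ge> real n / 4" "al > 2"
    using a unfolding al_def by (simp_all add: field_simps)
qed

lemma vv: "A > 0 \<Longrightarrow> vv A > 0" "A > 0 \<Longrightarrow> vv A \<le> V" "vv A = V * (A / (V + A))"
  using V by (auto simp: vv_def divide_simps)

lemma avg_mm: "V + A > 0 \<Longrightarrow> avg n (mm A mu) - Yb = V * (mu - Yb) / (V + A)"
proof -
  assume A: "V + A > 0"
  have "(\<Sum>i<n. mm A mu i) = (real n * (mu * V) + A * (\<Sum>i<n. Y i)) / (V + A)"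
    by (simp add: mm_def sum_divide_distrib[symmetric] sum.distrib sum_distrib_left mult_ac)
  moreover have "(\<Sum>i<n. Y i) = real n * Yb" using n2 by (simp add: Yb_def avg_def)
  ultimately have "(\<Sum>i<n. mm A mu i) = real n * ((mu * V + A * Yb) / (V + A))"
    by (simp add: distrib_left mult_ac)
  then have "avg n (mm A mu) = (mu * V + A * Yb) / (V + A)"
    using n2 by (simp add: avg_def)
  then show ?thesis using A by (simp add: field_simps)
qed

text \<open>Given A and mu, the means of theta are the data shrunk around their average by A / (V +
  A), so their spread does not depend on mu.\<close>

lemma mm_centered: "V + A > 0 \<Longrightarrow> mm A mu i - avg n (mm A mu) = A / (V + A) * (Y i - Yb)"
  using avg_mm[of A mu] by (simp add: mm_def field_simps)

lemma sum_mm_centered: "V + A > 0 \<Longrightarrow> (\<Sum>i<n. (mm A mu i - avg n (mm A mu))\<^sup>2) = (A / (V + A))\<^sup>2 * ssq n Y"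
  unfolding ssq_def Yb_def[symmetric] by (simp only: mm_centered power_mult_distrib sum_distrib_left)

lemma avg_diff: "avg n th - avg n m = (\<Sum>i<n. (th i - m i) / real n)"
  by (simp add: avg_def sum_subtractf sum_divide_distrib[symmetric] diff_divide_distrib)

lemma avg_second_moment:
  assumes A: "A > 0"
  shows "(\<integral>\<^sup>+th. ennreal (pd n (mm A mu) (vv A) th * (avg n th - u)\<^sup>2) \<partial>thetas n)
    = ennreal ((avg n (mm A mu) - u)\<^sup>2 + vv A / real n)"
proof -
  let ?m = "mm A mu" and ?v = "vv A"
  note mom = normal_moments[OF vv(1)[OF A]]
  have "(\<integral>\<^sup>+th. ennreal (pd n ?m ?v th * ((avg n ?m - u) + (\<Sum>i<n. (th i - ?m i) / real n))\<^sup>2) \<partial>thetas n)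
     = ennreal ((avg n ?m - u)\<^sup>2 + (\<Sum>i<n. ?v / (real n)\<^sup>2))"
  proof (rule pd_second_moment[OF _ _ vv(1)[OF A]])
    fix i
    show "has_bochner_integral lborel (\<lambda>x. nd (?m i) ?v x * ((x - ?m i) / real n)) 0"
      using has_bochner_integral_divide_zero[OF mom(2)[of "?m i"], of "real n"] by simp
    show "has_bochner_integral lborel (\<lambda>x. nd (?m i) ?v x * ((x - ?m i) / real n)\<^sup>2) (?v / (real n)\<^sup>2)"
      using has_bochner_integral_divide_zero[OF mom(3)[of "?m i"], of "(real n)\<^sup>2"] by (simp add: power_divide)
  qed
  also have "(\<lambda>th. (avg n ?m - u) + (\<Sum>i<n. (th i - ?m i) / real n)) = (\<lambda>th. avg n th - u)"
    by (simp add: avg_diff[symmetric])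
  also have "(\<Sum>i<n. ?v / (real n)\<^sup>2) = ?v / real n" using n2 by (simp add: power2_eq_square)
  finally show ?thesis by (simp add: fun_eq_iff)
qed

text \<open>The next A has conditional mean \<open>be th / (al - 1)\<close>, whose deterministic
  part is As + (1 - r^2) (A - As) up to a bias y of order 1 / n. The amount 2 V of \<open>Kd\<close>
  is held back for the average of theta, treated in \<open>drift\<close>.\<close>

lemma drift_A:
  assumes A: "\<delta> / 2 \<le> A" "A > 0"
  shows "Eth A mu (\<lambda>th. \<integral>\<^sup>+A'. ennreal (igd al (be th) A' * (real n * (min \<bar>A' - As\<bar> h)\<^sup>2)) \<partial>lborel)
    \<le> ennreal (\<gamma> * (real n * (A - As)\<^sup>2) + (Kd - 2 * V))"
proof -
  define r where "r = A / (V + A)"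
  \<comment> \<open>Leading term of the inverse gamma mean as a function of the current A. By
    \<open>gA\<close> it has As as fixed point, with the factor 1 - r^2.\<close>
  define g where "g = V * r + (V + As) * r\<^sup>2"
  define c where "c = al - 1"
  define m where "m = mm A mu"
  define v where "v = vv A"
  define d where "d i = m i - avg n m" for i
  define X where "X i x = (d i + (x - m i))\<^sup>2 - (d i)\<^sup>2 - v" for i x
  \<comment> \<open>Collects what g misses: b0, the a - 1 in the shape, and v / 2 because n
    coordinates carry the variance v while the shape counts n - 1.\<close>
  define y where "y = (b0 + v / 2 - (a - 1) * g) / c"
  define mg where "mg = (b0 + (r\<^sup>2 * ssq n Y + real n * v) / 2) / c"
  \<comment> \<open>z1 is the centred fluctuation of the sum of squares about the average of the
    means; z2 is the nonnegative correction for centring at the average of theta instead.\<close>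
  define z1 where "z1 th = (\<Sum>i<n. X i (th i) / (2 * c))" for th
  define z2 where "z2 th = real n / (2 * c) * (avg n th - avg n m)\<^sup>2" for th
  have n: "real n \<ge> 10" "real n > 0" using n10 by auto
  have VA: "V + A > 0" using V A by simp
  have c: "c \<ge> real n / 4" "c > 0" using al_bounds n by (auto simp: c_def)
  have r: "0 \<le> r" "r \<le> 1" "q \<le> r" using ratio[OF A(2)] ratio_ge[OF A(1)] by (auto simp: r_def)
  have v: "0 < v" "v \<le> V" "v = V * r" using vv(1,2)[OF A(2)] vv(3) by (auto simp: v_def r_def)
  have g: "0 \<le> g" "g \<le> M + V"
  proof -
    show "0 \<le> g" using V As del r by (simp add: g_def)
    have "V * r \<le> V * 1" "(V + As) * r\<^sup>2 \<le> (V + As) * 1"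
      using r V As del by (auto intro!: mult_left_mono simp: power_le_one)
    then show "g \<le> M + V" using As(2) by (simp add: g_def)
  qed
  have gA: "g - As = (1 - r\<^sup>2) * (A - As)"
  proof -
    have "(V + A) * r = A" using VA by (simp add: r_def)
    then have 1: "V * r = A * (1 - r)" by (simp add: algebra_simps)
    have "g = V * r + (V * r) * r + As * r\<^sup>2" by (simp add: g_def power2_eq_square algebra_simps)
    also have "\<dots> = A * (1 - r\<^sup>2) + As * r\<^sup>2" unfolding 1 by (simp add: power2_eq_square algebra_simps)
    finally show ?thesis by (simp add: algebra_simps)
  qed
  have mg: "mg = As + ((1 - r\<^sup>2) * (A - As) + y)"
  proof -
    have "c * (mg - As - (g - As)) = c * y"
      using c unfolding mg_def y_def As(3) by (simp add: field_simps) (simp add: g_def v c_def al_def field_simps power2_eq_square)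
    then show ?thesis using c gA by simp
  qed
  have mg_bounds: "0 \<le> mg" "mg \<le> B1"
  proof -
    have "0 \<le> r\<^sup>2 * ssq n Y" by simp
    then show "0 \<le> mg" using b0 v c n by (auto simp: mg_def intro!: divide_nonneg_pos add_nonneg_nonneg)
    have bn: "b0 \<le> real n * b0" using mult_right_mono[of 1 "real n" b0] b0 n by simp
    have "r\<^sup>2 * ssq n Y \<le> 1 * (real n * M)" using r ssq_le by (intro mult_mono) (auto simp: power_le_one)
    moreover have "real n * v \<le> real n * V" using v n by simp
    ultimately have "b0 + (r\<^sup>2 * ssq n Y + real n * v) / 2 \<le> real n * b0 + real n * (M + V) / 2"
      using bn unfolding distrib_left mult_1 by (intro add_mono divide_right_mono) auto
    also have "\<dots> = B1 * (real n / 4)" by (simp add: B1_def field_simps)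
    also have "\<dots> \<le> B1 * c" using c b0 M_nonneg V by (intro mult_left_mono) (auto simp: B1_def)
    finally show "mg \<le> B1" using c by (simp add: mg_def pos_divide_le_eq)
  qed
  have y: "real n * y\<^sup>2 \<le> 16 * B3\<^sup>2"
  proof -
    have "\<bar>(a - 1) * g\<bar> \<le> \<bar>a - 1\<bar> * (M + V)" using g by (simp add: abs_mult mult_left_mono)
    then have "\<bar>b0 + v / 2 - (a - 1) * g\<bar> \<le> B3" using b0 v unfolding B3_def by linarith
    then have "\<bar>y\<bar> \<le> B3 / (real n / 4)" using c n unfolding y_def abs_divide
      by (intro frac_le) auto
    then have "y\<^sup>2 \<le> (4 * B3 / real n)\<^sup>2" by (metis abs_ge_zero power2_abs power_mono divide_divide_eq_right mult.commute)
    then have "real n * y\<^sup>2 \<le> real n * (4 * B3 / real n)\<^sup>2" using n by (intro mult_left_mono) auto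
    also have "\<dots> = 16 * B3\<^sup>2 / real n" using n by (simp add: power2_eq_square)
    also have "\<dots> \<le> 16 * B3\<^sup>2 / 1" using n by (intro divide_left_mono) auto
    finally show ?thesis by simp
  qed
  have sumd: "(\<Sum>i<n. (d i)\<^sup>2) = r\<^sup>2 * ssq n Y"
    using sum_mm_centered[OF VA, of mu] by (simp add: d_def m_def r_def)
  have ssq_th: "be th / c = mg + z1 th - z2 th" for th
  proof -
    have "ssq n th = (\<Sum>i<n. (d i + (th i - m i))\<^sup>2) - real n * (avg n th - avg n m)\<^sup>2"
      using ssq_shift[of n th "avg n m"] n by (simp add: d_def)
    moreover have "(\<Sum>i<n. (d i + (th i - m i))\<^sup>2) = (\<Sum>i<n. X i (th i)) + r\<^sup>2 * ssq n Y + real n * v"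
      by (simp add: X_def sum_subtractf sumd)
    ultimately have "be th = b0 + ((\<Sum>i<n. X i (th i)) + r\<^sup>2 * ssq n Y + real n * v - real n * (avg n th - avg n m)\<^sup>2) / 2"
      by (simp add: be_def)
    moreover have "z1 th = (\<Sum>i<n. X i (th i)) / (2 * c)" by (simp add: z1_def sum_divide_distrib)
    then have "mg + z1 th - z2 th = (b0 + (r\<^sup>2 * ssq n Y + real n * v) / 2 + (\<Sum>i<n. X i (th i)) / 2 - real n * (avg n th - avg n m)\<^sup>2 / 2) / c"
      by (simp add: mg_def z2_def add_divide_distrib diff_divide_distrib)
    ultimately show ?thesis by (simp add: add_divide_distrib diff_divide_distrib)
  qed
  have z2: "z2 th \<ge> 0" for th using c by (simp add: z2_def)
  define sX where "sX = (\<Sum>i<n. (4 * (d i)\<^sup>2 * v + 2 * v\<^sup>2) / (2 * c)\<^sup>2)"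
  have sX: "sX \<ge> 0" unfolding sX_def using v by (auto intro!: sum_nonneg)
  define C0 where "C0 = real n * ((1 + q\<^sup>2) * ((1 - r\<^sup>2) * (A - As))\<^sup>2) + D * (16 * B3\<^sup>2 + 8 * B1\<^sup>2)"
  have C0: "C0 \<ge> 0" using D_nonneg by (simp add: C0_def)
  \<comment> \<open>The 9 is 1 + 8: once z1^2 itself, and 8 from the inverse gamma variance, where
    \<open>be th / c\<close> is at most mg + z1, its square is split with a factor 2, and
    \<open>al - 2\<close> is at least n / 4. The surplus factor n on these 8 is harmless because n
    times the second moment of z1 is bounded.\<close>
  have point: "(\<integral>\<^sup>+A'. ennreal (igd al (be th) A' * (real n * (min \<bar>A' - As\<bar> h)\<^sup>2)) \<partial>lborel)
     \<le> ennreal (C0 + (9 * D * real n) * (z1 th)\<^sup>2 + (D * h * real n) * z2 th)" for th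
  proof -
    have "(\<integral>\<^sup>+A'. ennreal (igd al (be th) A' * (real n * (min \<bar>A' - As\<bar> h)\<^sup>2)) \<partial>lborel)
       = ennreal (real n) * (\<integral>\<^sup>+A'. ennreal (igd al (be th) A' * (min \<bar>A' - As\<bar> h)\<^sup>2) \<partial>lborel)"
      using al_pos be_pos by (subst nn_integral_cmult[symmetric]) (auto simp: ennreal_mult[symmetric] mult_ac)
    also have "\<dots> \<le> ennreal (real n) * ennreal ((1 + q\<^sup>2) * ((1 - r\<^sup>2) * (A - As))\<^sup>2 + D * (y\<^sup>2 + (be th / c)\<^sup>2 / (al - 2) + (z1 th)\<^sup>2 + h * z2 th))"
      unfolding D_def c_def
      using h_pos z2[of th] q al_bounds be_pos ssq_th[of th] mg
      by (intro mult_left_mono igd_truncated_moment) (auto simp: c_def[symmetric])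
    also have "\<dots> = ennreal (real n * ((1 + q\<^sup>2) * ((1 - r\<^sup>2) * (A - As))\<^sup>2 + D * (y\<^sup>2 + (be th / c)\<^sup>2 / (al - 2) + (z1 th)\<^sup>2 + h * z2 th)))"
      by (simp add: ennreal_mult')
    also have "\<dots> \<le> ennreal (C0 + (9 * D * real n) * (z1 th)\<^sup>2 + (D * h * real n) * z2 th)"
    proof (rule ennreal_leI)
      have "(be th / c)\<^sup>2 \<le> (mg + z1 th)\<^sup>2"
      proof (rule power_mono)
        show "0 \<le> be th / c" using be_pos[of th] c by simp
      qed (use ssq_th[of th] z2[of th] in linarith)
      also have "\<dots> \<le> 2 * mg\<^sup>2 + 2 * (z1 th)\<^sup>2" 
        using zero_le_power2[of "mg - z1 th"] by (simp add: power2_eq_square algebra_simps)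
      also have "\<dots> \<le> 2 * B1\<^sup>2 + 2 * (z1 th)\<^sup>2" using mg_bounds by (simp add: power_mono)
      finally have "(be th / c)\<^sup>2 / (al - 2) \<le> (2 * B1\<^sup>2 + 2 * (z1 th)\<^sup>2) / (real n / 4)"
        using al_bounds n by (intro frac_le) auto
      then have "real n * ((be th / c)\<^sup>2 / (al - 2)) \<le> real n * ((2 * B1\<^sup>2 + 2 * (z1 th)\<^sup>2) / (real n / 4))"
        using n by (intro mult_left_mono) auto
      also have "\<dots> = 8 * B1\<^sup>2 + 8 * (z1 th)\<^sup>2" using n by (simp add: field_simps)
      also have "\<dots> \<le> 8 * B1\<^sup>2 + (8 * real n) * (z1 th)\<^sup>2" using n by (intro add_left_mono mult_right_mono) auto
      finally have "real n * y\<^sup>2 + real n * ((be th / c)\<^sup>2 / (al - 2)) + real n * (z1 th)\<^sup>2 + h * (real n * z2 th)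
         \<le> 16 * B3\<^sup>2 + 8 * B1\<^sup>2 + (9 * real n) * (z1 th)\<^sup>2 + h * (real n * z2 th)" using y by simp
      then have "D * (real n * y\<^sup>2 + real n * ((be th / c)\<^sup>2 / (al - 2)) + real n * (z1 th)\<^sup>2 + h * (real n * z2 th))
         \<le> D * (16 * B3\<^sup>2 + 8 * B1\<^sup>2 + (9 * real n) * (z1 th)\<^sup>2 + h * (real n * z2 th))"
        using D_nonneg by (rule mult_left_mono)
      then show "real n * ((1 + q\<^sup>2) * ((1 - r\<^sup>2) * (A - As))\<^sup>2 + D * (y\<^sup>2 + (be th / c)\<^sup>2 / (al - 2) + (z1 th)\<^sup>2 + h * z2 th))
         \<le> C0 + (9 * D * real n) * (z1 th)\<^sup>2 + (D * h * real n) * z2 th"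
        unfolding C0_def by (simp only: distrib_left distrib_right mult_ac add_ac)
    qed
    finally show ?thesis .
  qed
  note mom = noncentral_square_moments[OF v(1)]
  have m1: "(\<integral>\<^sup>+th. ennreal (pd n m v th * (z1 th)\<^sup>2) \<partial>thetas n) = ennreal sX"
  proof -
    have "(\<integral>\<^sup>+th. ennreal (pd n m v th * (0 + (\<Sum>i<n. X i (th i) / (2 * c)))\<^sup>2) \<partial>thetas n) = ennreal (0\<^sup>2 + sX)"
    proof (unfold sX_def, rule pd_second_moment[OF _ _ v(1)])
      fix i
      show "has_bochner_integral lborel (\<lambda>x. nd (m i) v x * (X i x / (2 * c))) 0"
        using has_bochner_integral_divide_zero[OF mom(1)[of "m i" "d i"], of "2 * c"] by (simp add: X_def)
      show "has_bochner_integral lborel (\<lambda>x. nd (m i) v x * (X i x / (2 * c))\<^sup>2) ((4 * (d i)\<^sup>2 * v + 2 * v\<^sup>2) / (2 * c)\<^sup>2)"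
        using has_bochner_integral_divide_zero[OF mom(2)[of "m i" "d i"], of "(2 * c)\<^sup>2"] by (simp add: X_def power_divide)
    qed
    then show ?thesis by (simp add: z1_def)
  qed
  have m1': "real n * sX \<le> 4 * B2"
  proof -
    have "(\<Sum>i<n. (4 * (d i)\<^sup>2 * v + 2 * v\<^sup>2)) = 4 * v * (r\<^sup>2 * ssq n Y) + real n * (2 * v\<^sup>2)"
      unfolding sumd[symmetric] by (simp add: sum.distrib sum_distrib_left mult_ac)
    also have "\<dots> \<le> 4 * V * (1 * (real n * M)) + real n * (2 * V\<^sup>2)"
    proof -
      have "r\<^sup>2 * ssq n Y \<le> 1 * (real n * M)" using r ssq_le by (intro mult_mono) (auto simp: power_le_one)
      moreover have "v\<^sup>2 \<le> V\<^sup>2" using v by (intro power_mono) auto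
      ultimately show ?thesis using v n r by (intro add_mono mult_mono[of "4 * v"] mult_left_mono) auto
    qed
    also have "\<dots> = real n * B2" by (simp add: B2_def algebra_simps)
    finally have s: "(\<Sum>i<n. (4 * (d i)\<^sup>2 * v + 2 * v\<^sup>2)) \<le> real n * B2" .
    have "(real n / 2)\<^sup>2 \<le> (2 * c)\<^sup>2" using c n by (intro power_mono) auto
    then have "(\<Sum>i<n. (4 * (d i)\<^sup>2 * v + 2 * v\<^sup>2)) / (2 * c)\<^sup>2 \<le> (real n * B2) / (real n / 2)\<^sup>2"
      using s n V M_nonneg by (intro frac_le) (auto simp: B2_def)
    also have "\<dots> = 4 * B2 / real n" using n by (simp add: power2_eq_square)
    finally show ?thesis using n by (simp add: sX_def sum_divide_distrib[symmetric] pos_le_divide_eq mult.commute)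
  qed
  have m2: "(\<integral>\<^sup>+th. ennreal (pd n m v th * z2 th) \<partial>thetas n) = ennreal (real n / (2 * c) * (v / real n))"
  proof -
    have "(\<integral>\<^sup>+th. ennreal (pd n m v th * z2 th) \<partial>thetas n) = (\<integral>\<^sup>+th. ennreal (real n / (2 * c)) * ennreal (pd n m v th * (avg n th - avg n m)\<^sup>2) \<partial>thetas n)"
      using c n by (intro nn_integral_cong) (simp add: z2_def ennreal_mult[symmetric] mult_ac)
    also have "\<dots> = ennreal (real n / (2 * c)) * (\<integral>\<^sup>+th. ennreal (pd n m v th * (avg n th - avg n m)\<^sup>2) \<partial>thetas n)"
      by (rule nn_integral_cmult) (auto simp: m_def)
    also have "\<dots> = ennreal (real n / (2 * c)) * ennreal (v / real n)"
      using avg_second_moment[OF A(2), of mu "avg n m"] by (simp add: m_def v_def)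
    finally show ?thesis using c n v by (simp add: ennreal_mult[symmetric])
  qed
  have m2': "real n * (real n / (2 * c) * (v / real n)) \<le> 2 * V"
  proof -
    have "real n * (real n / (2 * c) * (v / real n)) = v * (real n / (2 * c))" using n by simp
    also have "\<dots> \<le> V * 2" using c n v by (intro mult_mono) (auto simp: pos_divide_le_eq)
    finally show ?thesis by simp
  qed
  have z1m [measurable]: "z1 \<in> borel_measurable (thetas n)"
  proof -
    have "(\<lambda>th. th i) \<in> borel_measurable (thetas n)" if "i < n" for i
      using measurable_component_singleton[of i "{..<n}" "\<lambda>_. lborel"] that by simp
    then show ?thesis unfolding z1_def[abs_def] X_def
      by (intro borel_measurable_sum borel_measurable_divide borel_measurable_diff borel_measurable_power borel_measurable_add) auto
  qed
  have [measurable]: "z2 \<in> borel_measurable (thetas n)" unfolding z2_def[abs_def] by measurable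
  have [measurable]: "pd n m v \<in> borel_measurable (thetas n)" by measurable
  have "(\<integral>\<^sup>+th. ennreal (pd n m v th) * (\<integral>\<^sup>+A'. ennreal (igd al (be th) A' * (real n * (min \<bar>A' - As\<bar> h)\<^sup>2)) \<partial>lborel) \<partial>thetas n)
    \<le> (\<integral>\<^sup>+th. ennreal (pd n m v th) * ennreal (C0 + (9 * D * real n) * (z1 th)\<^sup>2 + (D * h * real n) * z2 th) \<partial>thetas n)"
    by (intro nn_integral_mono mult_left_mono point) auto
  also have "\<dots> = (\<integral>\<^sup>+th. ennreal C0 * ennreal (pd n m v th) + ennreal (9 * D * real n) * ennreal (pd n m v th * (z1 th)\<^sup>2)
      + ennreal (D * h * real n) * ennreal (pd n m v th * z2 th) \<partial>thetas n)"
    using C0 D_nonneg z2 h_pos n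
    by (intro nn_integral_cong) (simp add: ennreal_mult[symmetric] ennreal_plus[symmetric] algebra_simps del: ennreal_plus)
  also have "\<dots> = ennreal C0 + ennreal (9 * D * real n) * ennreal sX
      + ennreal (D * h * real n) * ennreal (real n / (2 * c) * (v / real n))"
    using v(1) n by (simp add: nn_integral_add nn_integral_cmult nn_integral_pd m1 m2)
  also have "\<dots> = ennreal (C0 + (9 * D * real n) * sX
      + (D * h * real n) * (real n / (2 * c) * (v / real n)))"
    using C0 D_nonneg h_pos n v c sX
    by (simp add: ennreal_mult[symmetric] ennreal_plus[symmetric] del: ennreal_plus)
  also have "\<dots> \<le> ennreal (\<gamma> * (real n * (A - As)\<^sup>2) + (Kd - 2 * V))"
  proof (rule ennreal_leI)
    have "(9 * D) * (real n * sX) \<le> (9 * D) * (4 * B2)"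
      using m1' D_nonneg by (intro mult_left_mono) auto
    moreover have "(D * h) * (real n * (real n / (2 * c) * (v / real n))) \<le> (D * h) * (2 * V)"
      using m2' D_nonneg h_pos by (intro mult_left_mono) auto
    \<comment> \<open>The contraction survives the factor 1 + e because e = q^2: (1 + q^2) (1 -
      q^2)^2 = (1 - q^2) (1 - q^4) \<le> \<gamma>.\<close>
    moreover have "(1 + q\<^sup>2) * ((1 - r\<^sup>2) * (A - As))\<^sup>2 \<le> \<gamma> * (A - As)\<^sup>2"
    proof -
      have q2: "0 \<le> q\<^sup>2" "q\<^sup>2 \<le> r\<^sup>2" "r\<^sup>2 \<le> 1" using q r by (auto simp: power_le_one intro: power_mono)
      then have "(1 - r\<^sup>2)\<^sup>2 \<le> (1 - q\<^sup>2)\<^sup>2" by (intro power_mono) auto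
      then have "(1 + q\<^sup>2) * (1 - r\<^sup>2)\<^sup>2 \<le> (1 + q\<^sup>2) * (1 - q\<^sup>2)\<^sup>2" by (intro mult_left_mono) auto
      also have "\<dots> = (1 - q\<^sup>2) * (1 - q\<^sup>2 * q\<^sup>2)" by (simp add: power2_eq_square algebra_simps)
      also have "\<dots> \<le> (1 - q\<^sup>2) * 1" using q2 by (intro mult_left_mono) auto
      finally have "(1 + q\<^sup>2) * (1 - r\<^sup>2)\<^sup>2 * (A - As)\<^sup>2 \<le> (1 - q\<^sup>2) * (A - As)\<^sup>2"
        by (intro mult_right_mono) auto
      then show ?thesis by (simp add: \<gamma>_def power_mult_distrib mult.assoc)
    qed
    then have "real n * ((1 + q\<^sup>2) * ((1 - r\<^sup>2) * (A - As))\<^sup>2) \<le> real n * (\<gamma> * (A - As)\<^sup>2)" using n by (intro mult_left_mono) auto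
    ultimately show "C0 + (9 * D * real n) * sX
      + (D * h * real n) * (real n / (2 * c) * (v / real n)) \<le> \<gamma> * (real n * (A - As)\<^sup>2) + (Kd - 2 * V)"
      unfolding C0_def Kd_def distrib_left by (simp only: mult_ac)
  qed
  finally show ?thesis by (simp add: m_def v_def)
qed

end

lemma normal_second_moment:
  assumes "v > 0" "a \<ge> 0" "b \<ge> 0"
  shows "(\<integral>\<^sup>+x. ennreal (nd m v x) * ennreal (a * (x - u)\<^sup>2 + b) \<partial>lborel) = ennreal (a * ((m - u)\<^sup>2 + v) + b)"
proof -
  note M = normal_moments[OF assms(1), of m]
  have "has_bochner_integral lborel (\<lambda>x. a * (nd m v x * (x - m)\<^sup>2) + (2 * a * (m - u)) * (nd m v x * (x - m)) + (a * (m - u)\<^sup>2 + b) * nd m v x)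
      (a * v + (2 * a * (m - u)) * 0 + (a * (m - u)\<^sup>2 + b) * 1)"
    using M by (intro has_bochner_integral_add has_bochner_integral_mult_right)
  moreover have "a * (nd m v x * (x - m)\<^sup>2) + (2 * a * (m - u)) * (nd m v x * (x - m)) + (a * (m - u)\<^sup>2 + b) * nd m v x
      = nd m v x * (a * (x - u)\<^sup>2 + b)" for x
    by (simp add: power2_eq_square algebra_simps)
  ultimately have "has_bochner_integral lborel (\<lambda>x. nd m v x * (a * (x - u)\<^sup>2 + b)) (a * ((m - u)\<^sup>2 + v) + b)"
    by (simp add: algebra_simps)
  then have "(\<integral>\<^sup>+x. ennreal (nd m v x * (a * (x - u)\<^sup>2 + b)) \<partial>lborel) = ennreal (a * ((m - u)\<^sup>2 + v) + b)"
    using assms by (subst nn_integral_eq_integral) (auto simp: has_bochner_integral_iff)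
  then show ?thesis using assms by (simp add: ennreal_mult)
qed

section \<open>Joint density of mu and theta after one step\<close>

context gibbs
begin

lemma measurable_Pi: 
  assumes [measurable]: "\<phi> \<in> borel_measurable SS"
  shows "(\<lambda>p. EA (snd p) (\<lambda>A'. \<phi> (A', fst p, snd p))) \<in> borel_measurable (lborel \<Otimes>\<^sub>M thetas n)" by measurable

text \<open>The last update reads theta alone, so comparing steps from two states reduces to
  comparing two densities in (mu, theta) on one product space.\<close>

lemma nn_integral_step_pair:
  assumes [measurable]: "\<phi> \<in> borel_measurable SS" and th: "th \<in> space (thetas n)"
  shows "(\<integral>\<^sup>+x. \<phi> x \<partial>P (A, mu, th)) =
    (\<integral>\<^sup>+p. ennreal (nd (avg n th) (A / real n) (fst p) * pd n (mm A (fst p)) (vv A) (snd p)) *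
        EA (snd p) (\<lambda>A'. \<phi> (A', fst p, snd p)) \<partial>(lborel \<Otimes>\<^sub>M thetas n))"
proof -
  have mp: "(\<lambda>p. ennreal (nd (avg n th) (A / real n) (fst p) * pd n (mm A (fst p)) (vv A) (snd p)) *
        EA (snd p) (\<lambda>A'. \<phi> (A', fst p, snd p))) \<in> borel_measurable (lborel \<Otimes>\<^sub>M thetas n)"
    by (rule borel_measurable_times_ennreal[OF _ measurable_Pi]) measurable
  have m: "(\<lambda>th'. ennreal (pd n (mm A mu') (vv A) th') * EA th' (\<lambda>A'. \<phi> (A', mu', th'))) \<in> borel_measurable (thetas n)" for mu'
    using measurable_Pair2[OF measurable_Pi[OF assms(1)], of mu'] by (intro borel_measurable_times_ennreal) auto
  have "(\<integral>\<^sup>+p. ennreal (nd (avg n th) (A / real n) (fst p) * pd n (mm A (fst p)) (vv A) (snd p)) *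
        EA (snd p) (\<lambda>A'. \<phi> (A', fst p, snd p)) \<partial>(lborel \<Otimes>\<^sub>M thetas n))
     = (\<integral>\<^sup>+mu'. \<integral>\<^sup>+th'. ennreal (nd (avg n th) (A / real n) mu' * pd n (mm A mu') (vv A) th') *
        EA th' (\<lambda>A'. \<phi> (A', mu', th')) \<partial>thetas n \<partial>lborel)"
    by (subst thetas.nn_integral_fst[OF mp, symmetric]) simp
  also have "\<dots> = Emu (avg n th) A (\<lambda>mu'. Eth A mu' (\<lambda>th'. EA th' (\<lambda>A'. \<phi> (A', mu', th'))))"
    using m by (intro nn_integral_cong) (simp add: nn_integral_cmult[symmetric] ennreal_mult mult.assoc)
  finally show ?thesis using nn_integral_step[OF assms] by simp
qed

lemma vv_pos: "A > 0 \<Longrightarrow> vv A > 0" using V by (simp add: vv_def)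

lemma nn_integral_pair_density:
  assumes "A > 0"
  shows "(\<integral>\<^sup>+p. ennreal (nd t (A / real n) (fst p) * pd n (mm A (fst p)) (vv A) (snd p)) \<partial>(lborel \<Otimes>\<^sub>M thetas n)) = 1"
proof -
  have "(\<integral>\<^sup>+p. ennreal (nd t (A / real n) (fst p) * pd n (mm A (fst p)) (vv A) (snd p)) \<partial>(lborel \<Otimes>\<^sub>M thetas n))
    = (\<integral>\<^sup>+mu'. \<integral>\<^sup>+th'. ennreal (nd t (A / real n) mu' * pd n (mm A mu') (vv A) th') \<partial>thetas n \<partial>lborel)"
    by (subst thetas.nn_integral_fst[symmetric]) auto
  also have "\<dots> = Emu t A (\<lambda>mu'. \<integral>\<^sup>+th'. ennreal (pd n (mm A mu') (vv A) th') \<partial>thetas n)"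
    by (intro nn_integral_cong) (subst nn_integral_cmult[symmetric], auto simp: ennreal_mult)
  also have "\<dots> = 1" using assms n2 by (simp add: nn_integral_pd vv_pos nn_integral_nd)
  finally show ?thesis .
qed

lemma space_SS: "(A, mu, th) \<in> space SS \<longleftrightarrow> th \<in> space (thetas n)"
  by (simp add: state_space_def space_pair_measure)

lemma prob_space_P:
  assumes "A > 0" "(A, mu, th) \<in> space SS"
  shows "prob_space (P (A, mu, th))"
proof
  have "emeasure (P (A, mu, th)) (space (P (A, mu, th))) = (\<integral>\<^sup>+x. 1 \<partial>P (A, mu, th))" by simp
  also have "\<dots> = (\<integral>\<^sup>+p. ennreal (nd (avg n th) (A / real n) (fst p) * pd n (mm A (fst p)) (vv A) (snd p)) \<partial>(lborel \<Otimes>\<^sub>M thetas n))"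
    using assms by (subst nn_integral_step_pair) (auto simp: space_SS nn_integral_igd al_pos be_pos)
  finally show "emeasure (P (A, mu, th)) (space (P (A, mu, th))) = 1"
    using nn_integral_pair_density[OF assms(1)] by simp
qed

lemma sets_P: "x \<in> space SS \<Longrightarrow> sets (P x) = sets SS"
  by (rule sets_kernel[OF step_measurable])

end

section \<open>Drift condition and overlap on sublevel sets for the clamped kernel\<close>

context gibbs_reg
begin

lemma cl_space: "x \<in> space SS \<Longrightarrow> (cl (fst x), snd x) \<in> space SS"
  by (cases x) (auto simp: state_space_def space_pair_measure)

lemma prob_space_Q: "x \<in> space SS \<Longrightarrow> prob_space (Q x)"
  using prob_space_P[of "cl (fst x)" "fst (snd x)" "snd (snd x)"] cl_space[of x] cl(4) by (simp add: Q_def)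

lemma sets_Q: "x \<in> space SS \<Longrightarrow> sets (Q x) = sets SS"
  using sets_P[OF cl_space] by (simp add: Q_def)

lemma lyap_nonneg [simp]: "0 \<le> lyap x" by (simp add: lyap_def)

lemma measurable_lyap [measurable]: "lyap \<in> borel_measurable SS"
  unfolding lyap_def[abs_def] by measurable

lemma measurable_cl [measurable]: "(\<lambda>x. (cl (fst x), snd x)) \<in> measurable SS SS"
  unfolding cl_def state_space_def by measurable

lemma Q_measurable [measurable]: "Q \<in> measurable SS (subprob_algebra SS)"
  unfolding Q_def[abs_def] by measurable

text \<open>The average of theta approaches Yb by the factor 1 - r, while the draws of mu and of
  theta each contribute at most V after scaling by n. As q is below 1, (1 - r)^2 \<le> (1 - q)^2
  \<le> 1 - q^2, so this coordinate can share the rate \<gamma> with A.\<close>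

lemma drift:
  assumes x: "x \<in> space SS"
  shows "(\<integral>\<^sup>+y. ennreal (lyap y) \<partial>Q x) \<le> ennreal (\<gamma> * lyap x + Kd)"
proof -
  obtain A0 mu0 th0 where x_eq: "x = (A0, mu0, th0)" by (cases x) auto
  define A where "A = cl A0"
  have A: "\<delta> / 2 \<le> A" "A > 0" "\<bar>A - As\<bar> = min \<bar>A0 - As\<bar> h" using cl by (auto simp: A_def)
  have th0: "th0 \<in> space (thetas n)" using x by (simp add: x_eq space_SS)
  have VA: "V + A > 0" using V A by simp
  have n: "real n > 0" using n10 by simp
  define r where "r = A / (V + A)"
  have r: "q \<le> r" "r \<le> 1" "V / (V + A) = 1 - r" using ratio_ge[OF A(1)] ratio[OF A(2)] VA by (auto simp: r_def field_simps)
  define C where "C = \<gamma> * (real n * (A - As)\<^sup>2) + (Kd - 2 * V)"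
  have g0: "\<gamma> \<ge> 0" using q by (simp add: \<gamma>_def power_le_one)
  have K0: "Kd - 2 * V \<ge> 0" using D_nonneg V M_nonneg h_pos by (auto simp: Kd_def B2_def)
  have C0: "C \<ge> 0" using g0 K0 by (simp add: C_def)
  let ?J = "\<lambda>th. \<integral>\<^sup>+A'. ennreal (igd al (be th) A' * (real n * (min \<bar>A' - As\<bar> h)\<^sup>2)) \<partial>lborel"
  have inner: "EA th (\<lambda>A'. ennreal (lyap (A', mu, th))) = ennreal (real n * (avg n th - Yb)\<^sup>2) + ?J th" for mu th
  proof -
    have "EA th (\<lambda>A'. ennreal (lyap (A', mu, th)))
       = (\<integral>\<^sup>+A'. ennreal (real n * (avg n th - Yb)\<^sup>2) * ennreal (igd al (be th) A') + ennreal (igd al (be th) A' * (real n * (min \<bar>A' - As\<bar> h)\<^sup>2)) \<partial>lborel)"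
      using al_pos be_pos
      by (intro nn_integral_cong) (simp add: lyap_def ennreal_mult[symmetric] ennreal_plus[symmetric] algebra_simps del: ennreal_plus)
    then show ?thesis by (simp add: nn_integral_add nn_integral_cmult nn_integral_igd al_pos be_pos)
  qed
  have [measurable]: "?J \<in> borel_measurable (thetas n)" by measurable
  have mid: "Eth A mu (\<lambda>th'. ennreal (real n * (avg n th' - Yb)\<^sup>2) + ?J th')
     \<le> ennreal (real n * (1 - r)\<^sup>2 * (mu - Yb)\<^sup>2 + (V + C))" for mu
  proof -
    have [measurable]: "pd n (mm A mu) (vv A) \<in> borel_measurable (thetas n)" by measurable
    have "Eth A mu (\<lambda>th'. ennreal (real n * (avg n th' - Yb)\<^sup>2) + ?J th')
      = (\<integral>\<^sup>+th'. ennreal (real n) * ennreal (pd n (mm A mu) (vv A) th' * (avg n th' - Yb)\<^sup>2) + ennreal (pd n (mm A mu) (vv A) th') * ?J th' \<partial>thetas n)"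
      by (intro nn_integral_cong) (simp add: distrib_left ennreal_mult[symmetric] mult_ac)
    also have "\<dots> = ennreal (real n) * ennreal ((avg n (mm A mu) - Yb)\<^sup>2 + vv A / real n) + Eth A mu (\<lambda>th'. ?J th')"
      using avg_second_moment[OF A(2), of mu Yb] by (subst nn_integral_add) (auto simp: nn_integral_cmult)
    also have "\<dots> \<le> ennreal (real n * ((avg n (mm A mu) - Yb)\<^sup>2 + vv A / real n)) + ennreal C"
      using drift_A[OF A(1,2), of mu] unfolding C_def by (intro add_mono) (auto simp: ennreal_mult')
    also have "\<dots> = ennreal (real n * ((avg n (mm A mu) - Yb)\<^sup>2 + vv A / real n) + C)"
      using C0 vv(1)[OF A(2)] n by (intro ennreal_plus[symmetric]) auto
    also have "\<dots> \<le> ennreal (real n * (1 - r)\<^sup>2 * (mu - Yb)\<^sup>2 + (V + C))"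
    proof (rule ennreal_leI)
      have "avg n (mm A mu) - Yb = (1 - r) * (mu - Yb)" using avg_mm[OF VA, of mu] unfolding r(3)[symmetric] by simp
      then show "real n * ((avg n (mm A mu) - Yb)\<^sup>2 + vv A / real n) + C \<le> real n * (1 - r)\<^sup>2 * (mu - Yb)\<^sup>2 + (V + C)"
        using vv(2)[OF A(2)] n by (simp add: distrib_left power_mult_distrib)
    qed
    finally show ?thesis .
  qed
  have "(\<integral>\<^sup>+y. ennreal (lyap y) \<partial>Q x) = (\<integral>\<^sup>+y. ennreal (lyap y) \<partial>P (A, mu0, th0))" by (simp add: Q_def x_eq A_def)
  also have "\<dots> = Emu (avg n th0) A (\<lambda>mu'. Eth A mu' (\<lambda>th'. ennreal (real n * (avg n th' - Yb)\<^sup>2) + ?J th'))"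
    by (subst nn_integral_step) (use th0 in \<open>auto simp: inner\<close>)
  also have "\<dots> \<le> Emu (avg n th0) A (\<lambda>mu'. ennreal (real n * (1 - r)\<^sup>2 * (mu' - Yb)\<^sup>2 + (V + C)))"
    by (intro nn_integral_mono mult_left_mono mid) auto
  also have "\<dots> = ennreal (real n * (1 - r)\<^sup>2 * ((avg n th0 - Yb)\<^sup>2 + A / real n) + (V + C))"
    using A n C0 V by (intro normal_second_moment) auto
  also have "\<dots> \<le> ennreal (\<gamma> * lyap x + Kd)"
  proof (rule ennreal_leI)
    have rr: "(1 - r)\<^sup>2 \<le> \<gamma>"
    proof -
      have "(1 - r)\<^sup>2 \<le> (1 - q)\<^sup>2" using r q by (intro power_mono) auto
      also have "\<dots> \<le> 1 - q\<^sup>2" using q mult_left_mono[of q 1 q] by (simp add: power2_eq_square algebra_simps)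
      finally show ?thesis by (simp add: \<gamma>_def)
    qed
    have "(1 - r)\<^sup>2 * A \<le> V"
    proof -
      have "(1 - r) * A = V * r" using VA by (simp add: r_def field_simps)
      then have "(1 - r)\<^sup>2 * A = V * (r * (1 - r))" by (simp add: power2_eq_square)
      also have "\<dots> \<le> V * (1 * 1)" using V r q by (intro mult_left_mono mult_mono) auto
      finally show ?thesis by simp
    qed
    moreover have "real n * (1 - r)\<^sup>2 * ((avg n th0 - Yb)\<^sup>2 + A / real n) = (1 - r)\<^sup>2 * (real n * (avg n th0 - Yb)\<^sup>2) + (1 - r)\<^sup>2 * A"
      using n by (simp add: distrib_left)
    moreover have "(1 - r)\<^sup>2 * (real n * (avg n th0 - Yb)\<^sup>2) \<le> \<gamma> * (real n * (avg n th0 - Yb)\<^sup>2)"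
      using rr by (intro mult_right_mono) auto
    \<comment> \<open>The distance of the clamped A to As is the capped distance of the original A0,
      so the bound is in terms of \<open>lyap\<close> at the unclamped state.\<close>
    moreover have minE: "(A - As)\<^sup>2 = (min \<bar>A0 - As\<bar> h)\<^sup>2" using A(3) by (metis power2_abs)
    ultimately show "real n * (1 - r)\<^sup>2 * ((avg n th0 - Yb)\<^sup>2 + A / real n) + (V + C) \<le> \<gamma> * lyap x + Kd"
      unfolding C_def lyap_def x_eq minE by (simp only: fst_conv snd_conv distrib_left[of \<gamma>])
  qed
  finally show ?thesis .
qed

text \<open>\<open>w0\<close> bounds \<open>vv\<close> from below on the clamped range and
  \<open>E1\<close> bounds the sum of the exponents in \<open>normal_affinity_ge\<close>. For n (mu
  - Yb)^2 \<le> 1 the density of mu is at least sqrt n * \<open>c0\<close>. The affinity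
  \<open>bb\<close> is this density bound times the window length 2 / sqrt n times exp (-
  E1).\<close>

definition "w0 = V * q"
definition "E1 R = 2 * R / (16 * w0\<^sup>2) + (M + 1) * (2 * R) / (8 * w0 * V\<^sup>2)"
definition "c0 R = exp (- (2 + 2 * R) / \<delta>) / sqrt (2 * pi * (M + \<delta>))"
definition "bb R = 2 * c0 R * exp (- E1 R)"

lemma bb_pos: "bb R > 0" using M_nonneg del by (simp add: bb_def c0_def)

lemma nd_lower:
  assumes A: "\<delta> / 2 \<le> A" "A \<le> M + \<delta>" and mu: "real n * (mu - Yb)\<^sup>2 \<le> 1" and t: "real n * (t - Yb)\<^sup>2 \<le> R"
  shows "sqrt (real n) * c0 R \<le> nd t (A / real n) mu"
proof -
  have n: "real n > 0" using n10 by simp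
  have A0: "A > 0" using A del by simp
  have "(mu - t)\<^sup>2 \<le> 2 * (mu - Yb)\<^sup>2 + 2 * (t - Yb)\<^sup>2"
    using zero_le_power2[of "(mu - Yb) + (t - Yb)"] by (simp add: power2_eq_square algebra_simps)
  then have "real n * (mu - t)\<^sup>2 \<le> real n * (2 * (mu - Yb)\<^sup>2 + 2 * (t - Yb)\<^sup>2)" using n by (intro mult_left_mono) auto
  then have e: "real n * (mu - t)\<^sup>2 \<le> 2 + 2 * R" using mu t by (simp add: distrib_left)
  have "real n * (mu - t)\<^sup>2 / (2 * A) \<le> (2 + 2 * R) / \<delta>"
    using e A del n by (intro frac_le) (auto intro: order_trans[OF _ e])
  then have "exp (- (2 + 2 * R) / \<delta>) \<le> exp (- (mu - t)\<^sup>2 / (2 * (A / real n)))"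
    by (simp only: minus_divide_left[symmetric] exp_le_cancel_iff neg_le_iff_le) (simp add: mult.commute)
  moreover have "sqrt (2 * pi * (A / real n)) \<le> sqrt (2 * pi * (M + \<delta>)) / sqrt (real n)"
    using A n by (simp add: real_sqrt_divide[symmetric] divide_right_mono)
  ultimately have "exp (- (2 + 2 * R) / \<delta>) / (sqrt (2 * pi * (M + \<delta>)) / sqrt (real n)) \<le> exp (- (mu - t)\<^sup>2 / (2 * (A / real n))) / sqrt (2 * pi * (A / real n))"
    using n A0 by (intro frac_le) auto
  then show ?thesis using n A0 by (simp add: nd_eq c0_def mult.commute)
qed

lemma sqrt_prod: "sqrt (\<Prod>i\<in>I. f i) = (\<Prod>i\<in>I. sqrt (f i))"
  by (induction I rule: infinite_finite_induct) (auto simp: real_sqrt_mult)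

text \<open>Both \<open>mm\<close> and \<open>vv\<close> are Lipschitz in A, and n (A1 - A2)^2 is
  bounded. Hence each coordinate loses O(1 / n) in the exponent on average, where the average of (Y
  i - mu)^2 is at most M + 1, and the total stays bounded.\<close>

lemma theta_affinity:
  assumes A: "\<delta> / 2 \<le> A1" "\<delta> / 2 \<le> A2" and d: "real n * (A1 - A2)\<^sup>2 \<le> 2 * R"
    and mu: "real n * (mu - Yb)\<^sup>2 \<le> 1"
  shows "ennreal (exp (- E1 R)) \<le> (\<integral>\<^sup>+th. ennreal (sqrt (pd n (mm A1 mu) (vv A1) th * pd n (mm A2 mu) (vv A2) th)) \<partial>thetas n)"
proof -
  have n: "real n > 0" using n10 by simp
  have A0: "A1 > 0" "A2 > 0" using A del by auto
  have VA: "V + A1 > 0" "V + A2 > 0" using A0 V by auto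
  have w0: "w0 > 0" using V q by (simp add: w0_def)
  have vw: "vv A1 \<ge> w0" "vv A2 \<ge> w0" using mult_left_mono[OF ratio_ge[OF A(1)], of V] mult_left_mono[OF ratio_ge[OF A(2)], of V] V unfolding w0_def vv(3) by simp_all
  let ?e = "\<lambda>i. (vv A1 - vv A2)\<^sup>2 / (16 * w0\<^sup>2) + (mm A1 mu i - mm A2 mu i)\<^sup>2 / (8 * w0)"
  have den: "V\<^sup>2 \<le> (V + A1) * (V + A2)" using V A0 by (simp add: power2_eq_square) (intro mult_mono, auto)
  have vd: "vv A1 - vv A2 = V\<^sup>2 * (A1 - A2) / ((V + A1) * (V + A2))"
    using VA by (simp add: vv_def divide_simps) (simp add: power2_eq_square algebra_simps)
  have md: "mm A1 mu i - mm A2 mu i = V * (A1 - A2) / ((V + A1) * (V + A2)) * (Y i - mu)" for i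
    using VA by (simp add: mm_def divide_simps) (simp add: power2_eq_square algebra_simps)
  have k: "\<bar>(A1 - A2) / ((V + A1) * (V + A2))\<bar> \<le> \<bar>A1 - A2\<bar> / V\<^sup>2"
    using den V VA by (simp add: abs_mult) (intro divide_left_mono, auto)
  have "\<bar>vv A1 - vv A2\<bar> = V\<^sup>2 * \<bar>(A1 - A2) / ((V + A1) * (V + A2))\<bar>" unfolding vd using V by (simp add: abs_mult)
  also have "\<dots> \<le> V\<^sup>2 * (\<bar>A1 - A2\<bar> / V\<^sup>2)" using k by (intro mult_left_mono) auto
  finally have "\<bar>vv A1 - vv A2\<bar> \<le> \<bar>A1 - A2\<bar>" using V by simp
  then have v2: "(vv A1 - vv A2)\<^sup>2 \<le> (A1 - A2)\<^sup>2" by (simp add: abs_le_square_iff)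
  have m2: "(mm A1 mu i - mm A2 mu i)\<^sup>2 \<le> (A1 - A2)\<^sup>2 / V\<^sup>2 * (Y i - mu)\<^sup>2" for i
  proof -
    have "\<bar>V * (A1 - A2) / ((V + A1) * (V + A2))\<bar> = V * \<bar>(A1 - A2) / ((V + A1) * (V + A2))\<bar>" using V by (simp add: abs_mult)
    also have "\<dots> \<le> V * (\<bar>A1 - A2\<bar> / V\<^sup>2)" using k V by (intro mult_left_mono) auto
    also have "\<dots> = \<bar>(A1 - A2) / V\<bar>" using V by (simp add: power2_eq_square)
    finally have "(V * (A1 - A2) / ((V + A1) * (V + A2)))\<^sup>2 \<le> ((A1 - A2) / V)\<^sup>2" by (simp only: abs_le_square_iff)
    from mult_right_mono[OF this zero_le_power2[of "Y i - mu"]]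
    show ?thesis unfolding md by (simp only: power_mult_distrib[symmetric] power_divide[symmetric])
  qed
  have sY: "(\<Sum>i<n. (Y i - mu)\<^sup>2) \<le> real n * (M + 1)"
  proof -
    have "ssq n Y = (\<Sum>i<n. (Y i - mu)\<^sup>2) - real n * (mu - Yb)\<^sup>2"
      using ssq_shift[of n Y mu] n by (simp add: Yb_def power2_commute)
    then show ?thesis using mu ssq_le n10 by (simp add: distrib_left)
  qed
  have "(\<Sum>i<n. ?e i) \<le> (\<Sum>i<n. (A1 - A2)\<^sup>2 / (16 * w0\<^sup>2) + (A1 - A2)\<^sup>2 / V\<^sup>2 * (Y i - mu)\<^sup>2 / (8 * w0))"
    using v2 m2 w0 by (intro sum_mono add_mono divide_right_mono) auto
  also have "\<dots> = real n * (A1 - A2)\<^sup>2 / (16 * w0\<^sup>2) + (A1 - A2)\<^sup>2 / V\<^sup>2 * (\<Sum>i<n. (Y i - mu)\<^sup>2) / (8 * w0)"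
    by (simp add: sum.distrib sum_distrib_left sum_divide_distrib)
  also have "\<dots> \<le> 2 * R / (16 * w0\<^sup>2) + (A1 - A2)\<^sup>2 / V\<^sup>2 * (real n * (M + 1)) / (8 * w0)"
    using d sY w0 by (intro add_mono divide_right_mono mult_left_mono) auto
  also have "(A1 - A2)\<^sup>2 / V\<^sup>2 * (real n * (M + 1)) / (8 * w0) = (M + 1) * (real n * (A1 - A2)\<^sup>2) / (8 * w0 * V\<^sup>2)"
    using V w0 by (simp add: mult_ac)
  also have "\<dots> \<le> (M + 1) * (2 * R) / (8 * w0 * V\<^sup>2)"
    using d M_nonneg V w0 by (intro divide_right_mono mult_left_mono) auto
  finally have sum_e: "(\<Sum>i<n. ?e i) \<le> E1 R" by (simp add: E1_def)
  have "exp (- E1 R) \<le> exp (- (\<Sum>i<n. ?e i))" using sum_e by simp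
  also have "\<dots> = (\<Prod>i<n. exp (- ?e i))" by (simp add: exp_sum sum_negf[symmetric])
  finally have "ennreal (exp (- E1 R)) \<le> ennreal (\<Prod>i<n. exp (- ?e i))" by (rule ennreal_leI)
  also have "\<dots> = (\<Prod>i<n. ennreal (exp (- ?e i)))" by (simp add: prod_ennreal)
  also have "\<dots> \<le> (\<Prod>i<n. \<integral>\<^sup>+x. ennreal (sqrt (nd (mm A1 mu i) (vv A1) x * nd (mm A2 mu i) (vv A2) x)) \<partial>lborel)"
    using normal_affinity_ge[OF w0 vw] by (intro prod_mono_ennreal) (simp add: add_divide_distrib)
  also have "\<dots> = (\<integral>\<^sup>+th. (\<Prod>i<n. ennreal (sqrt (nd (mm A1 mu i) (vv A1) (th i) * nd (mm A2 mu i) (vv A2) (th i)))) \<partial>thetas n)"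
    by (intro L.product_nn_integral_prod[symmetric]) auto
  also have "\<dots> = (\<integral>\<^sup>+th. ennreal (sqrt (pd n (mm A1 mu) (vv A1) th * pd n (mm A2 mu) (vv A2) th)) \<partial>thetas n)"
    by (intro nn_integral_cong) (simp add: prod_ennreal pd_def prod.distrib[symmetric] sqrt_prod)
  finally show ?thesis .
qed

text \<open>On sublevel sets both steps give mu a density of order sqrt n on a window of length 2 /
  sqrt n about Yb, and for each mu in the window the laws of theta have affinity bounded below.
  Fubini multiplies the two, and \<open>overlap_ge_affinity\<close> converts affinity into
  overlap.\<close>

lemma small_set:
  assumes xy: "x \<in> space SS" "y \<in> space SS" and R: "lyap x + lyap y \<le> R"
    and [measurable]: "\<psi> \<in> borel_measurable SS" and psi: "\<And>z. \<psi> z \<le> (1::ennreal)"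
  shows "(\<integral>\<^sup>+z. \<psi> z \<partial>Q x) \<le> (\<integral>\<^sup>+z. \<psi> z \<partial>Q y) + ennreal (1 - (bb R)\<^sup>2 / 2)"
proof -
  obtain A1 mu1 th1 A2 mu2 th2 where e: "x = (A1, mu1, th1)" "y = (A2, mu2, th2)" by (cases x, cases y) auto
  have th: "th1 \<in> space (thetas n)" "th2 \<in> space (thetas n)" using xy by (auto simp: e space_SS)
  have n: "real n > 0" using n10 by simp
  have R1: "lyap x \<le> R" "lyap y \<le> R" using R lyap_nonneg[of x] lyap_nonneg[of y] by linarith+
  define C1 C2 where "C1 = cl A1" and "C2 = cl A2"
  have C: "\<delta> / 2 \<le> C1" "\<delta> / 2 \<le> C2" "C1 > 0" "C2 > 0" "C1 \<le> M + \<delta>" "C2 \<le> M + \<delta>"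
    using cl[of A1] cl[of A2] As V del h_def unfolding C1_def C2_def by auto
  have CA: "(C1 - As)\<^sup>2 = (min \<bar>A1 - As\<bar> h)\<^sup>2" "(C2 - As)\<^sup>2 = (min \<bar>A2 - As\<bar> h)\<^sup>2"
    using cl(5)[of A1] cl(5)[of A2] unfolding C1_def C2_def by (metis power2_abs)+
  have t: "real n * (avg n th1 - Yb)\<^sup>2 \<le> R" "real n * (avg n th2 - Yb)\<^sup>2 \<le> R"
    using R1 n by (auto simp: lyap_def e intro: order_trans[rotated])
  have d: "real n * (C1 - C2)\<^sup>2 \<le> 2 * R"
  proof -
    have "(C1 - C2)\<^sup>2 \<le> 2 * (C1 - As)\<^sup>2 + 2 * (C2 - As)\<^sup>2"
      using zero_le_power2[of "(C1 - As) + (C2 - As)"] by (simp add: power2_eq_square algebra_simps)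
    then have "real n * (C1 - C2)\<^sup>2 \<le> real n * (2 * (C1 - As)\<^sup>2 + 2 * (C2 - As)\<^sup>2)" using n by (intro mult_left_mono) auto
    also have "\<dots> = 2 * (real n * (min \<bar>A1 - As\<bar> h)\<^sup>2 + real n * (min \<bar>A2 - As\<bar> h)\<^sup>2)" by (simp add: CA algebra_simps)
    also have "\<dots> \<le> 2 * (lyap x + lyap y)" using n by (intro mult_left_mono add_mono) (auto simp: lyap_def e)
    finally show ?thesis using R by simp
  qed
  let ?p = "\<lambda>t A p. nd t (A / real n) (fst p) * pd n (mm A (fst p)) (vv A) (snd p)"
  let ?p1 = "?p (avg n th1) C1" and ?p2 = "?p (avg n th2) C2"
  let ?N = "lborel \<Otimes>\<^sub>M thetas n"
  have aff: "ennreal (bb R) \<le> (\<integral>\<^sup>+p. ennreal (sqrt (?p1 p * ?p2 p)) \<partial>?N)"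
  proof -
    let ?s = "1 / sqrt (real n)"
    have "ennreal (bb R) = (\<integral>\<^sup>+mu. ennreal (sqrt (real n) * c0 R * exp (- E1 R)) * indicator {Yb - ?s .. Yb + ?s} mu \<partial>lborel)"
    proof -
      have "(\<integral>\<^sup>+mu. ennreal (sqrt (real n) * c0 R * exp (- E1 R)) * indicator {Yb - ?s .. Yb + ?s} mu \<partial>lborel)
         = ennreal (sqrt (real n) * c0 R * exp (- E1 R)) * ennreal (2 * ?s)"
        by (subst nn_integral_cmult_indicator) auto
      also have "\<dots> = ennreal (sqrt (real n) * c0 R * exp (- E1 R) * (2 * ?s))"
        using n by (intro ennreal_mult''[symmetric]) auto
      also have "sqrt (real n) * c0 R * exp (- E1 R) * (2 * ?s) = bb R" using n by (simp add: bb_def)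
      finally show ?thesis by simp
    qed
    also have "\<dots> \<le> (\<integral>\<^sup>+mu. \<integral>\<^sup>+th. ennreal (sqrt (?p1 (mu, th) * ?p2 (mu, th))) \<partial>thetas n \<partial>lborel)"
    proof (intro nn_integral_mono)
      fix mu
      show "ennreal (sqrt (real n) * c0 R * exp (- E1 R)) * indicator {Yb - ?s .. Yb + ?s} mu \<le> (\<integral>\<^sup>+th. ennreal (sqrt (?p1 (mu, th) * ?p2 (mu, th))) \<partial>thetas n)"
      proof (cases "mu \<in> {Yb - ?s .. Yb + ?s}")
        case True
        then have "\<bar>mu - Yb\<bar> \<le> ?s" by (auto simp: abs_le_iff)
        then have "(mu - Yb)\<^sup>2 \<le> ?s\<^sup>2" by (metis abs_ge_zero power2_abs power_mono)
        then have mu: "real n * (mu - Yb)\<^sup>2 \<le> 1" using n by (simp add: power_divide field_simps)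
        have c0: "c0 R \<ge> 0" using M_nonneg del by (simp add: c0_def)
        let ?n1 = "nd (avg n th1) (C1 / real n) mu" and ?n2 = "nd (avg n th2) (C2 / real n) mu"
        have "sqrt (real n) * c0 R \<le> sqrt (?n1 * ?n2)"
          using nd_lower[OF C(1,5) mu t(1)] nd_lower[OF C(2,6) mu t(2)] n c0
          by (intro real_le_rsqrt) (auto simp: power2_eq_square intro!: mult_mono)
        then have "ennreal (sqrt (real n) * c0 R) * ennreal (exp (- E1 R)) \<le> ennreal (sqrt (?n1 * ?n2)) *
            (\<integral>\<^sup>+th. ennreal (sqrt (pd n (mm C1 mu) (vv C1) th * pd n (mm C2 mu) (vv C2) th)) \<partial>thetas n)"
          using theta_affinity[OF C(1,2) d mu] by (intro mult_mono ennreal_leI) auto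
        also have "\<dots> = (\<integral>\<^sup>+th. ennreal (sqrt (?n1 * ?n2)) * ennreal (sqrt (pd n (mm C1 mu) (vv C1) th * pd n (mm C2 mu) (vv C2) th)) \<partial>thetas n)"
          by (rule nn_integral_cmult[symmetric]) auto
        also have "\<dots> = (\<integral>\<^sup>+th. ennreal (sqrt (?p1 (mu, th) * ?p2 (mu, th))) \<partial>thetas n)"
          by (intro nn_integral_cong) (simp add: ennreal_mult[symmetric] real_sqrt_mult mult_ac)
        finally show ?thesis using True n c0 by (simp add: ennreal_mult)
      qed simp
    qed
    also have "\<dots> = (\<integral>\<^sup>+p. ennreal (sqrt (?p1 p * ?p2 p)) \<partial>?N)"
      by (subst thetas.nn_integral_fst[symmetric]) auto
    finally show ?thesis .
  qed
  let ?\<Psi> = "\<lambda>p. EA (snd p) (\<lambda>A'. \<psi> (A', fst p, snd p))"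
  have Psi1: "?\<Psi> p \<le> 1" for p
  proof -
    have "?\<Psi> p \<le> EA (snd p) (\<lambda>A'. 1)"
      using psi by (intro nn_integral_mono mult_left_mono) auto
    then show ?thesis by (simp add: nn_integral_igd al_pos be_pos)
  qed
  have ov: "ennreal ((bb R)\<^sup>2 / 2) \<le> (\<integral>\<^sup>+p. ennreal (min (?p1 p) (?p2 p)) \<partial>?N)"
    using C bb_pos aff by (intro overlap_ge_affinity) (auto simp: nn_integral_pair_density)
  have "(\<integral>\<^sup>+p. ennreal (?p1 p) * ?\<Psi> p \<partial>?N) \<le> (\<integral>\<^sup>+p. ennreal (?p2 p) * ?\<Psi> p \<partial>?N) + ennreal (1 - (bb R)\<^sup>2 / 2)"
    using C Psi1 ov measurable_Pi[of \<psi>] by (intro density_overlap) (auto simp: nn_integral_pair_density)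
  then show ?thesis
    unfolding Q_def e using th by (simp add: nn_integral_step_pair C1_def[symmetric] C2_def[symmetric])
qed

end

section \<open>The posterior density\<close>

context gibbs
begin

abbreviation "p \<equiv> post_dens n Y V a b0"
abbreviation "Ep f \<equiv> \<integral>\<^sup>+x. ennreal (p x) * f x \<partial>SS"

text \<open>\<open>hh\<close> is the unnormalised posterior density of A with mu and theta
  integrated out; \<open>p3\<close> is that of theta with mu and A integrated out.\<close>

definition hh :: "real \<Rightarrow> real" where
  "hh A = (if A > 0 then (sqrt (2 * pi * V)) ^ n * sqrt (2 * pi / real n) *
     (A powr (- a - 1) * exp (- b0 / A) * (V + A) powr (- ((real n - 1) / 2)) * exp (- ssq n Y / (2 * (V + A)))) else 0)"

definition p3 :: "(nat \<Rightarrow> real) \<Rightarrow> real" where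
  "p3 th = sqrt (2 * pi / real n) * exp (- (\<Sum>i<n. (Y i - th i)\<^sup>2) / (2 * V)) * Gamma al / be th powr al"

lemma powr_half_power: "x > 0 \<Longrightarrow> (x powr (- 1 / 2)) ^ n = x powr (- real n / 2)"
  by (simp add: powr_realpow[symmetric] powr_powr)

text \<open>Factorisation in the order theta, A given theta, mu given both. The inverse gamma factor
  is the sampler's own update of A, which is thus the conditional law after mu has been integrated
  out.\<close>

lemma post_dens_eq_mu_A:
  "p (A, mu, th) = p3 th * igd al (be th) A * nd (avg n th) (A / real n) mu"
proof (cases "A > 0")
  case True
  have n: "real n > 0" using n2 by simp
  have g: "Gamma al > 0" using al_pos by (rule Gamma_real_pos)
  have s: "(\<Sum>i<n. (th i - mu)\<^sup>2) = ssq n th + real n * (mu - avg n th)\<^sup>2"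
    using ssq_shift[of n th mu] n by (simp add: power2_commute)
  have "(\<Prod>i<n. A powr (- 1 / 2) * exp (- (th i - mu)\<^sup>2 / (2 * A)) * exp (- (Y i - th i)\<^sup>2 / (2 * V)))
     = A powr (- real n / 2) * exp (- (\<Sum>i<n. (th i - mu)\<^sup>2) / (2 * A)) * exp (- (\<Sum>i<n. (Y i - th i)\<^sup>2) / (2 * V))"
    using powr_half_power[OF True] by (simp add: prod.distrib exp_sum[symmetric] sum_divide_distrib sum_negf)
  also have "exp (- (\<Sum>i<n. (th i - mu)\<^sup>2) / (2 * A)) = exp (- (ssq n th / 2) / A) * exp (- (mu - avg n th)\<^sup>2 / (2 * (A / real n)))"
    unfolding s exp_add[symmetric] using True n by (simp add: field_simps)
  finally have *: "p (A, mu, th) = A powr (- a - 1) * exp (- b0 / A) * (A powr (- real n / 2) * (exp (- (ssq n th / 2) / A) * exp (- (mu - avg n th)\<^sup>2 / (2 * (A / real n))))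
     * exp (- (\<Sum>i<n. (Y i - th i)\<^sup>2) / (2 * V)))"
    using True by (simp add: post_dens_def)
  have e: "exp (- b0 / A) * exp (- (ssq n th / 2) / A) = exp (- be th / A)"
    unfolding exp_add[symmetric] by (simp add: be_def add_divide_distrib diff_divide_distrib)
  have "- a - 1 + - real n / 2 = (- al - 1) - 1 / 2" by (simp add: al_def field_simps)
  then have "A powr (- a - 1) * A powr (- real n / 2) = A powr (- al - 1) / A powr (1 / 2)"
    by (simp only: powr_add[symmetric] powr_diff[symmetric])
  then have w: "A powr (- a - 1) * A powr (- real n / 2) = A powr (- al - 1) / sqrt A"
    using True by (simp add: powr_half_sqrt)
  have r: "sqrt (2 * pi / real n) * (1 / sqrt (2 * pi * (A / real n))) = 1 / sqrt A"
    using True n by (simp add: real_sqrt_mult real_sqrt_divide)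
  have bp: "be th powr al > 0" using be_pos[of th] by simp
  have "p3 th * igd al (be th) A * nd (avg n th) (A / real n) mu =
     exp (- (\<Sum>i<n. (Y i - th i)\<^sup>2) / (2 * V)) * (A powr (- al - 1) * exp (- be th / A)) * exp (- (mu - avg n th)\<^sup>2 / (2 * (A / real n))) *
     (sqrt (2 * pi / real n) * (1 / sqrt (2 * pi * (A / real n)))) * (Gamma al / be th powr al * (be th powr al / Gamma al))"
    using True n by (simp add: p3_def igd_def nd_eq)
  also have "Gamma al / be th powr al * (be th powr al / Gamma al) = 1" using g bp by simp
  finally have "p3 th * igd al (be th) A * nd (avg n th) (A / real n) mu =
     (A powr (- al - 1) / sqrt A) * (exp (- b0 / A) * exp (- (ssq n th / 2) / A)) * exp (- (mu - avg n th)\<^sup>2 / (2 * (A / real n))) *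
     exp (- (\<Sum>i<n. (Y i - th i)\<^sup>2) / (2 * V))"
    unfolding r e by simp
  also have "\<dots> = p (A, mu, th)" unfolding * w[symmetric] by (simp only: mult_ac)
  finally show ?thesis by simp
qed (simp add: post_dens_def igd_def)

text \<open>Factorisation in the order A, mu given A, theta given both. The last factor is the
  sampler's update of theta; the first is the density whose concentration is studied.\<close>

lemma post_dens_eq_A_mu_theta:
  "p (A, mu, th) = hh A * nd (avg n Y) ((V + A) / real n) mu * pd n (mm A mu) (vv A) th"
proof (cases "A > 0")
  case True
  have n: "real n > 0" using n2 by simp
  have VA: "V + A > 0" using True V by simp
  have v: "vv A > 0" by (rule vv_pos[OF True])
  \<comment> \<open>Completing the square in one coordinate: the two normal factors split into the
    marginal law of Y i, with variance V + A, and the conditional law of theta i.\<close>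
  have fac: "A powr (- 1 / 2) * exp (- (x - mu)\<^sup>2 / (2 * A)) * exp (- (Y i - x)\<^sup>2 / (2 * V)) =
     sqrt (2 * pi * V) * (V + A) powr (- 1 / 2) * exp (- (Y i - mu)\<^sup>2 / (2 * (V + A))) * nd (mm A mu i) (vv A) x" for x i
  proof -
    have "(x - mu)\<^sup>2 / (2 * A) + (Y i - x)\<^sup>2 / (2 * V) = (Y i - mu)\<^sup>2 / (2 * (V + A)) + (x - mm A mu i)\<^sup>2 / (2 * vv A)"
    proof -
      have 1: "x - mm A mu i = (x * (V + A) - (mu * V + Y i * A)) / (V + A)" using VA by (simp add: mm_def field_simps)
      have "(x - mm A mu i)\<^sup>2 / (2 * vv A) = (x * (V + A) - (mu * V + Y i * A))\<^sup>2 / (2 * A * V * (V + A))"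
        unfolding 1 vv_def using VA V True by (simp add: power_divide power2_eq_square)
      moreover have "(x - mu)\<^sup>2 / (2 * A) + (Y i - x)\<^sup>2 / (2 * V) =
          ((Y i - mu)\<^sup>2 * A * V + (x * (V + A) - (mu * V + Y i * A))\<^sup>2) / (2 * A * V * (V + A))"
        using VA V True by (simp add: divide_simps) (simp add: power2_eq_square algebra_simps)
      moreover have "(Y i - mu)\<^sup>2 / (2 * (V + A)) = ((Y i - mu)\<^sup>2 * A * V) / (2 * A * V * (V + A))"
        using V True by simp
      ultimately show ?thesis by (simp add: add_divide_distrib)
    qed
    then have "exp (- (x - mu)\<^sup>2 / (2 * A)) * exp (- (Y i - x)\<^sup>2 / (2 * V)) = exp (- (Y i - mu)\<^sup>2 / (2 * (V + A))) * exp (- (x - mm A mu i)\<^sup>2 / (2 * vv A))"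
      unfolding exp_add[symmetric] by (simp only: minus_divide_left[symmetric] minus_add_distrib[symmetric])
    moreover have "sqrt (2 * pi * V) * (V + A) powr (- 1 / 2) / sqrt (2 * pi * vv A) = A powr (- 1 / 2)"
      using True VA V by (simp add: vv_def powr_minus powr_half_sqrt real_sqrt_mult real_sqrt_divide field_simps)
    ultimately show ?thesis using v by (simp add: nd_eq mult.assoc) (simp add: field_simps)
  qed
  have s: "(\<Sum>i<n. (Y i - mu)\<^sup>2) = ssq n Y + real n * (mu - avg n Y)\<^sup>2"
    using ssq_shift[of n Y mu] n by (simp add: power2_commute)
  have "(\<Prod>i<n. A powr (- 1 / 2) * exp (- (th i - mu)\<^sup>2 / (2 * A)) * exp (- (Y i - th i)\<^sup>2 / (2 * V)))
     = (sqrt (2 * pi * V)) ^ n * (V + A) powr (- real n / 2) * exp (- (\<Sum>i<n. (Y i - mu)\<^sup>2) / (2 * (V + A))) * pd n (mm A mu) (vv A) th"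
    unfolding fac using powr_half_power[OF VA]
    by (simp add: prod.distrib exp_sum[symmetric] sum_divide_distrib sum_negf pd_def power_mult_distrib)
  also have "exp (- (\<Sum>i<n. (Y i - mu)\<^sup>2) / (2 * (V + A))) = exp (- ssq n Y / (2 * (V + A))) * exp (- (mu - avg n Y)\<^sup>2 / (2 * ((V + A) / real n)))"
  proof -
    have "- (mu - avg n Y)\<^sup>2 / (2 * ((V + A) / real n)) = - (real n * (mu - avg n Y)\<^sup>2) / (2 * (V + A))" by simp
    moreover have "exp (- (x + y) / w) = exp (- x / w) * exp (- y / w)" for x y w :: real
      by (simp add: exp_add[symmetric] add_divide_distrib diff_divide_distrib)
    ultimately show ?thesis unfolding s by simp
  qed
  finally have *: "p (A, mu, th) = A powr (- a - 1) * exp (- b0 / A) * ((sqrt (2 * pi * V)) ^ n * (V + A) powr (- real n / 2) *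
     (exp (- ssq n Y / (2 * (V + A))) * exp (- (mu - avg n Y)\<^sup>2 / (2 * ((V + A) / real n)))) * pd n (mm A mu) (vv A) th)"
    using True by (simp add: post_dens_def)
  have "(V + A) powr (- ((real n - 1) / 2)) = (V + A) powr (- real n / 2) * (V + A) powr (1 / 2)"
  proof -
    have "- ((real n - 1) / 2) = - real n / 2 + 1 / 2" by (simp add: field_simps)
    then show ?thesis by (simp only: powr_add)
  qed
  then have w: "(V + A) powr (- ((real n - 1) / 2)) = (V + A) powr (- real n / 2) * sqrt (V + A)"
    using VA by (simp add: powr_half_sqrt)
  have r: "sqrt (2 * pi / real n) * sqrt (V + A) / sqrt (2 * pi * ((V + A) / real n)) = 1"
    using VA n by (simp add: real_sqrt_mult real_sqrt_divide)
  have "hh A * nd (avg n Y) ((V + A) / real n) mu * pd n (mm A mu) (vv A) th =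
     A powr (- a - 1) * exp (- b0 / A) * ((sqrt (2 * pi * V)) ^ n * (V + A) powr (- real n / 2) *
     (exp (- ssq n Y / (2 * (V + A))) * exp (- (mu - avg n Y)\<^sup>2 / (2 * ((V + A) / real n)))) * pd n (mm A mu) (vv A) th) *
     (sqrt (2 * pi / real n) * sqrt (V + A) / sqrt (2 * pi * ((V + A) / real n)))"
    using True VA n unfolding hh_def w by (simp add: nd_eq)
  then show ?thesis unfolding r * mult_1_right by (rule sym)
qed (simp add: post_dens_def hh_def)

lemma hh_nonneg [simp]: "0 \<le> hh A"
  using V n2 by (simp add: hh_def)

lemma hh_pos: "A > 0 \<Longrightarrow> 0 < hh A"
  using V n2 by (simp add: hh_def)

lemma measurable_hh [measurable]: "hh \<in> borel_measurable borel"
  unfolding hh_def[abs_def] by measurable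

lemma p3_nonneg [simp]: "0 \<le> p3 th"
  using al_pos Gamma_real_pos[OF al_pos] by (simp add: p3_def less_imp_le)

lemma measurable_p3 [measurable]: "p3 \<in> borel_measurable (thetas n)"
proof -
  have [measurable]: "(\<lambda>th. \<Sum>i<n. (Y i - th i)\<^sup>2) \<in> borel_measurable (thetas n)"
    by (intro borel_measurable_sum borel_measurable_power borel_measurable_diff) auto
  show ?thesis unfolding p3_def[abs_def] by measurable
qed

lemma p_nonneg [simp]: "0 \<le> p x"
  by (cases x) (simp only: post_dens_eq_A_mu_theta, simp)

lemma measurable_p [measurable]: "p \<in> borel_measurable SS"
proof -
  have "(\<lambda>x. hh (fst x) * nd (avg n Y) ((V + fst x) / real n) (fst (snd x)) * pd n (mm (fst x) (fst (snd x))) (vv (fst x)) (snd (snd x))) \<in> borel_measurable SS"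
    by measurable
  moreover have "p = (\<lambda>x. hh (fst x) * nd (avg n Y) ((V + fst x) / real n) (fst (snd x)) * pd n (mm (fst x) (fst (snd x))) (vv (fst x)) (snd (snd x)))"
  proof
    fix x show "p x = hh (fst x) * nd (avg n Y) ((V + fst x) / real n) (fst (snd x)) * pd n (mm (fst x) (fst (snd x))) (vv (fst x)) (snd (snd x))"
      using post_dens_eq_A_mu_theta[of "fst x" "fst (snd x)" "snd (snd x)"] by simp
  qed
  ultimately show ?thesis by simp
qed

lemma sigma_finite_mu_theta: "sigma_finite_measure (lborel \<Otimes>\<^sub>M thetas n)"
  by (intro sigma_finite_pair_measure sigma_finite_thetas sigma_finite_lborel)

lemma nn_integral_SS:
  assumes F [measurable]: "F \<in> borel_measurable SS"
  shows "(\<integral>\<^sup>+x. F x \<partial>SS) = (\<integral>\<^sup>+A. \<integral>\<^sup>+mu. \<integral>\<^sup>+th. F (A, mu, th) \<partial>thetas n \<partial>lborel \<partial>lborel)"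
proof -
  have F': "F \<in> borel_measurable (lborel \<Otimes>\<^sub>M (lborel \<Otimes>\<^sub>M thetas n))" using F by (simp add: state_space_def)
  have "(\<integral>\<^sup>+x. F x \<partial>SS) = (\<integral>\<^sup>+A. \<integral>\<^sup>+p. F (A, p) \<partial>(lborel \<Otimes>\<^sub>M thetas n) \<partial>lborel)"
    unfolding state_space_def by (rule sigma_finite_measure.nn_integral_fst[OF sigma_finite_mu_theta F', symmetric])
  also have "\<dots> = (\<integral>\<^sup>+A. \<integral>\<^sup>+mu. \<integral>\<^sup>+th. F (A, mu, th) \<partial>thetas n \<partial>lborel \<partial>lborel)"
  proof (intro nn_integral_cong thetas.nn_integral_fst[symmetric])
    fix A :: real
    show "(\<lambda>p. F (A, p)) \<in> borel_measurable (lborel \<Otimes>\<^sub>M thetas n)"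
      using measurable_Pair2[OF F', of A] by simp
  qed
  finally show ?thesis .
qed

lemma nn_integral_swap:
  assumes "sigma_finite_measure N1" "sigma_finite_measure N2" and f: "case_prod f \<in> borel_measurable (N1 \<Otimes>\<^sub>M N2)"
  shows "(\<integral>\<^sup>+x. \<integral>\<^sup>+y. f x y \<partial>N2 \<partial>N1) = (\<integral>\<^sup>+y. \<integral>\<^sup>+x. f x y \<partial>N1 \<partial>N2)"
proof -
  interpret pair_sigma_finite N1 N2 using assms by (simp add: pair_sigma_finite_def)
  show ?thesis using Fubini'[OF f] by simp
qed

lemma nn_integral_SS':
  assumes F [measurable]: "F \<in> borel_measurable SS"
  shows "(\<integral>\<^sup>+x. F x \<partial>SS) = (\<integral>\<^sup>+th. \<integral>\<^sup>+A. \<integral>\<^sup>+mu. F (A, mu, th) \<partial>lborel \<partial>lborel \<partial>thetas n)"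
proof -
  have F': "F \<in> borel_measurable (lborel \<Otimes>\<^sub>M (lborel \<Otimes>\<^sub>M thetas n))" using F by (simp add: state_space_def)
  have mA: "(\<lambda>q. F (A, q)) \<in> borel_measurable (lborel \<Otimes>\<^sub>M thetas n)" for A
    using measurable_Pair2[OF F', of A] by simp
  have m: "(\<lambda>q. \<integral>\<^sup>+mu. F (fst q, mu, snd q) \<partial>lborel) \<in> borel_measurable (lborel \<Otimes>\<^sub>M thetas n)" by measurable
  have "(\<integral>\<^sup>+x. F x \<partial>SS) = (\<integral>\<^sup>+A. \<integral>\<^sup>+th. \<integral>\<^sup>+mu. F (A, mu, th) \<partial>lborel \<partial>thetas n \<partial>lborel)"
    unfolding nn_integral_SS[OF F]
    by (intro nn_integral_cong nn_integral_swap sigma_finite_lborel sigma_finite_thetas) (simp add: split_beta' mA)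
  also have "\<dots> = (\<integral>\<^sup>+th. \<integral>\<^sup>+A. \<integral>\<^sup>+mu. F (A, mu, th) \<partial>lborel \<partial>lborel \<partial>thetas n)"
    using m by (intro nn_integral_swap sigma_finite_lborel sigma_finite_thetas) (simp add: split_beta')
  finally show ?thesis .
qed

definition Z :: ennreal where "Z = (\<integral>\<^sup>+x. ennreal (p x) \<partial>SS)"

lemma Z_eq: "Z = (\<integral>\<^sup>+A. ennreal (hh A) \<partial>lborel)"
proof -
  have "Z = (\<integral>\<^sup>+A. \<integral>\<^sup>+mu. \<integral>\<^sup>+th. ennreal (p (A, mu, th)) \<partial>thetas n \<partial>lborel \<partial>lborel)"
    unfolding Z_def by (rule nn_integral_SS) measurable
  also have "\<dots> = (\<integral>\<^sup>+A. ennreal (hh A) \<partial>lborel)"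
  proof (intro nn_integral_cong)
    fix A
    have [measurable]: "pd n (mm A mu) (vv A) \<in> borel_measurable (thetas n)" for mu by measurable
    show "(\<integral>\<^sup>+mu. \<integral>\<^sup>+th. ennreal (p (A, mu, th)) \<partial>thetas n \<partial>lborel) = ennreal (hh A)"
    proof (cases "A > 0")
      case True
      have "(\<integral>\<^sup>+mu. \<integral>\<^sup>+th. ennreal (p (A, mu, th)) \<partial>thetas n \<partial>lborel) = 
        (\<integral>\<^sup>+mu. ennreal (hh A) * ennreal (nd (avg n Y) ((V + A) / real n) mu) * (\<integral>\<^sup>+th. ennreal (pd n (mm A mu) (vv A) th) \<partial>thetas n) \<partial>lborel)"
        by (intro nn_integral_cong) (simp add: post_dens_eq_A_mu_theta ennreal_mult nn_integral_cmult)
      then show ?thesis using True V n2 by (simp add: nn_integral_pd vv_pos nn_integral_cmult nn_integral_nd)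
    qed (simp add: post_dens_def hh_def)
  qed
  finally show ?thesis .
qed

lemma Z_pos: "Z > 0"
proof -
  have "Z \<noteq> 0"
  proof
    assume "Z = 0"
    then have "AE A in lborel. ennreal (hh A) = 0"
      unfolding Z_eq by (subst (asm) nn_integral_0_iff_AE) auto
    moreover have "A \<notin> {0<..<1}" if "ennreal (hh A) = 0" for A
      using that hh_pos[of A] by (auto simp: ennreal_eq_0_iff not_le)
    ultimately have "AE A in lborel. A \<notin> {0<..<1::real}"
      by (auto elim: AE_mp)
    then have "emeasure lborel {0<..<1::real} = 0"
      by (subst (asm) AE_iff_measurable[of "{0<..<1}"]) auto
    then show False by simp
  qed
  then show ?thesis by (simp add: zero_less_iff_neq_zero)
qed

text \<open>Since V + A \<ge> V for A > 0, the factors coming from the data are bounded, and the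
  inverse gamma prior dominates \<open>hh\<close>.\<close>

lemma Z_finite: "Z < \<infinity>"
proof -
  let ?c = "(sqrt (2 * pi * V)) ^ n * sqrt (2 * pi / real n) * V powr (- ((real n - 1) / 2))"
  have "Z \<le> (\<integral>\<^sup>+A. ennreal ?c * ennreal (if A > 0 then A powr (- a - 1) * exp (- b0 / A) else 0) \<partial>lborel)"
    unfolding Z_eq
  proof (intro nn_integral_mono)
    fix A :: real
    show "ennreal (hh A) \<le> ennreal ?c * ennreal (if A > 0 then A powr (- a - 1) * exp (- b0 / A) else 0)"
    proof (cases "A > 0")
      case True
      have "(V + A) powr (- ((real n - 1) / 2)) * exp (- ssq n Y / (2 * (V + A))) \<le> V powr (- ((real n - 1) / 2)) * 1"
        using True V n2 by (intro mult_mono powr_mono2') auto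
      then have "((sqrt (2 * pi * V)) ^ n * sqrt (2 * pi / real n) * (A powr (- a - 1) * exp (- b0 / A))) *
          ((V + A) powr (- ((real n - 1) / 2)) * exp (- ssq n Y / (2 * (V + A)))) \<le>
        ((sqrt (2 * pi * V)) ^ n * sqrt (2 * pi / real n) * (A powr (- a - 1) * exp (- b0 / A))) * (V powr (- ((real n - 1) / 2)) * 1)"
        using True V by (intro mult_left_mono) auto
      then have "hh A \<le> ?c * (A powr (- a - 1) * exp (- b0 / A))"
        using True by (simp add: hh_def mult_ac)
      then show ?thesis using True V by (simp add: ennreal_mult[symmetric] ennreal_leI)
    qed (simp add: hh_def)
  qed
  also have "\<dots> = ennreal ?c * ennreal (Gamma a / b0 powr a)"
    using a b0 by (subst nn_integral_cmult) (auto simp: nn_integral_ig_kernel)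
  also have "\<dots> < \<infinity>" by (simp add: ennreal_mult_less_top)
  finally show ?thesis .
qed

lemma nn_integral_posterior:
  assumes [measurable]: "\<phi> \<in> borel_measurable SS"
  shows "(\<integral>\<^sup>+x. \<phi> x \<partial>posterior n Y V a b0) = Ep (\<lambda>x. \<phi> x) / Z"
proof -
  have "(\<integral>\<^sup>+x. \<phi> x \<partial>posterior n Y V a b0) = (\<integral>\<^sup>+x. ennreal (p x) / Z * \<phi> x \<partial>SS)"
    unfolding posterior_def Z_def[symmetric] by (rule nn_integral_density) measurable
  also have "\<dots> = (\<integral>\<^sup>+x. (ennreal (p x) * \<phi> x) / Z \<partial>SS)"
    by (intro nn_integral_cong) (simp add: ennreal_times_divide mult.commute divide_ennreal_def mult_ac)
  also have "\<dots> = Ep (\<lambda>x. \<phi> x) / Z"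
    by (rule nn_integral_divide) measurable
  finally show ?thesis .
qed

lemma sets_posterior [simp, measurable_cong]: "sets (posterior n Y V a b0) = sets SS"
  by (simp add: posterior_def)

lemma prob_space_posterior: "prob_space (posterior n Y V a b0)"
proof
  have "emeasure (posterior n Y V a b0) (space (posterior n Y V a b0)) = (\<integral>\<^sup>+x. 1 \<partial>posterior n Y V a b0)" by simp
  also have "\<dots> = Z / Z" by (subst nn_integral_posterior) (auto simp: Z_def)
  also have "\<dots> = 1" using Z_pos Z_finite by (intro ennreal_divide_self) auto
  finally show "emeasure (posterior n Y V a b0) (space (posterior n Y V a b0)) = 1" .
qed

lemma nn_integral_p_theta:
  assumes \<phi> [measurable]: "\<phi> \<in> borel_measurable SS"
  shows "Ep (\<lambda>x. \<phi> x) =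
    (\<integral>\<^sup>+th. ennreal (p3 th) * EA th (\<lambda>A. Emu (avg n th) A (\<lambda>mu. \<phi> (A, mu, th))) \<partial>thetas n)"
proof -
  have "Ep (\<lambda>x. \<phi> x) = (\<integral>\<^sup>+th. \<integral>\<^sup>+A. \<integral>\<^sup>+mu. ennreal (p (A, mu, th)) * \<phi> (A, mu, th) \<partial>lborel \<partial>lborel \<partial>thetas n)"
    by (rule nn_integral_SS') measurable
  also have "\<dots> = (\<integral>\<^sup>+th. ennreal (p3 th) * EA th (\<lambda>A. Emu (avg n th) A (\<lambda>mu. \<phi> (A, mu, th))) \<partial>thetas n)"
  proof (intro nn_integral_cong)
    fix th assume th: "th \<in> space (thetas n)"
    have [measurable]: "(\<lambda>q. \<phi> (f q, g q, th)) \<in> borel_measurable M" if [measurable]: "f \<in> borel_measurable M" "g \<in> borel_measurable M"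
      for f g and M :: "'z measure"
      using th by (intro measurable_compose[OF _ \<phi>] measurable_state_Pair) auto
    have in1: "(\<lambda>A. Emu (avg n th) A (\<lambda>mu. \<phi> (A, mu, th))) \<in> borel_measurable lborel" by measurable
    have "(\<integral>\<^sup>+A. \<integral>\<^sup>+mu. ennreal (p (A, mu, th)) * \<phi> (A, mu, th) \<partial>lborel \<partial>lborel)
      = (\<integral>\<^sup>+A. ennreal (p3 th) * (ennreal (igd al (be th) A) * Emu (avg n th) A (\<lambda>mu. \<phi> (A, mu, th))) \<partial>lborel)"
    proof (intro nn_integral_cong)
      fix A
      have "(\<integral>\<^sup>+mu. ennreal (p (A, mu, th)) * \<phi> (A, mu, th) \<partial>lborel) = (\<integral>\<^sup>+mu. ennreal (p3 th * igd al (be th) A) * (ennreal (nd (avg n th) (A / real n) mu) * \<phi> (A, mu, th)) \<partial>lborel)"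
        using al_pos be_pos by (intro nn_integral_cong) (simp add: post_dens_eq_mu_A ennreal_mult mult_ac)
      also have "\<dots> = ennreal (p3 th * igd al (be th) A) * Emu (avg n th) A (\<lambda>mu. \<phi> (A, mu, th))"
        by (rule nn_integral_cmult) measurable
      finally show "(\<integral>\<^sup>+mu. ennreal (p (A, mu, th)) * \<phi> (A, mu, th) \<partial>lborel) = ennreal (p3 th) * (ennreal (igd al (be th) A) * Emu (avg n th) A (\<lambda>mu. \<phi> (A, mu, th)))"
        using al_pos be_pos by (simp add: ennreal_mult mult_ac)
    qed
    also have "\<dots> = ennreal (p3 th) * EA th (\<lambda>A. Emu (avg n th) A (\<lambda>mu. \<phi> (A, mu, th)))"
      using in1 by (intro nn_integral_cmult) measurable
    finally show "(\<integral>\<^sup>+A. \<integral>\<^sup>+mu. ennreal (p (A, mu, th)) * \<phi> (A, mu, th) \<partial>lborel \<partial>lborel) = ennreal (p3 th) * EA th (\<lambda>A. Emu (avg n th) A (\<lambda>mu. \<phi> (A, mu, th)))" .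
  qed
  finally show ?thesis .
qed

text \<open>Redrawing mu and then theta are exact conditional draws and leave the posterior
  unchanged; only then A' is drawn given theta. The result differs from
  \<open>nn_integral_p_theta\<close> in one point: mu is drawn with the old A, and A and A' are
  independent given theta.\<close>

lemma nn_integral_p_step:
  assumes \<phi> [measurable]: "\<phi> \<in> borel_measurable SS"
  shows "Ep (\<lambda>x. \<integral>\<^sup>+y. \<phi> y \<partial>P x) =
    (\<integral>\<^sup>+th. ennreal (p3 th) * EA th (\<lambda>A. EA th (\<lambda>A'. Emu (avg n th) A (\<lambda>mu. \<phi> (A', mu, th)))) \<partial>thetas n)"
proof -
  define \<Phi> where "\<Phi> mu th = EA th (\<lambda>A'. \<phi> (A', mu, th))" for mu th
  define \<Psi> where "\<Psi> A mu = Eth A mu (\<lambda>th. \<Phi> mu th)" for A mu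
  have m1 [measurable]: "(\<lambda>q. \<Phi> (fst q) (snd q)) \<in> borel_measurable (borel \<Otimes>\<^sub>M thetas n)"
    using measurable_Pi[OF \<phi>] by (simp add: \<Phi>_def cong: measurable_cong_sets)
  have m1' [measurable (raw)]: "(\<lambda>x. \<Phi> (f x) (g x)) \<in> borel_measurable M"
    if [measurable]: "f \<in> borel_measurable M" "g \<in> measurable M (thetas n)" for f g and M :: "'z measure"
    using measurable_compose[of "\<lambda>x. (f x, g x)" M _ _ , OF _ m1] by simp
  have m2 [measurable]: "(\<lambda>q. \<Psi> (fst q) (snd q)) \<in> borel_measurable (borel \<Otimes>\<^sub>M borel)"
    unfolding \<Psi>_def[abs_def] by measurable
  have m1A: "\<Phi> mu \<in> borel_measurable (thetas n)" for mu by (rule m1') auto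
  have m2' [measurable (raw)]: "(\<lambda>x. \<Psi> (f x) (g x)) \<in> borel_measurable M"
    if [measurable]: "f \<in> borel_measurable M" "g \<in> borel_measurable M" for f g and M :: "'z measure"
    using measurable_compose[of "\<lambda>x. (f x, g x)" M _ _ , OF _ m2] by simp
  have pdm: "pd n (mm A mu) (vv A) \<in> borel_measurable (thetas n)" for A mu by measurable
  have step: "(\<integral>\<^sup>+y. \<phi> y \<partial>P (A, mu, th)) = Emu (avg n th) A (\<lambda>mu'. \<Psi> A mu')"
    if "th \<in> space (thetas n)" for A mu th
    unfolding \<Psi>_def \<Phi>_def by (rule nn_integral_step[OF \<phi> that])
  have "Ep (\<lambda>x. \<integral>\<^sup>+y. \<phi> y \<partial>P x) =
     (\<integral>\<^sup>+th. \<integral>\<^sup>+A. \<integral>\<^sup>+mu. ennreal (p (A, mu, th)) * (\<integral>\<^sup>+y. \<phi> y \<partial>P (A, mu, th)) \<partial>lborel \<partial>lborel \<partial>thetas n)"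
    by (rule nn_integral_SS') (intro borel_measurable_times_ennreal nn_integral_measurable_subprob_algebra2[of _ _ SS], auto)
  \<comment> \<open>Given A and theta, the posterior law of mu is the law that the update draws
    from, so the fresh mu can be identified with the old one.\<close>
  also have "\<dots> = (\<integral>\<^sup>+th. \<integral>\<^sup>+A. \<integral>\<^sup>+mu. ennreal (p (A, mu, th)) * \<Psi> A mu \<partial>lborel \<partial>lborel \<partial>thetas n)"
  proof (rule nn_integral_cong, rule nn_integral_cong)
    fix th A assume th: "th \<in> space (thetas n)"
    show "(\<integral>\<^sup>+mu. ennreal (p (A, mu, th)) * (\<integral>\<^sup>+y. \<phi> y \<partial>P (A, mu, th)) \<partial>lborel) = (\<integral>\<^sup>+mu. ennreal (p (A, mu, th)) * \<Psi> A mu \<partial>lborel)"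
    proof (cases "A > 0")
      case True
      let ?c = "ennreal (p3 th * igd al (be th) A)" and ?G = "Emu (avg n th) A (\<lambda>mu'. \<Psi> A mu')"
      have "(\<integral>\<^sup>+mu. ennreal (p (A, mu, th)) * (\<integral>\<^sup>+y. \<phi> y \<partial>P (A, mu, th)) \<partial>lborel)
        = (\<integral>\<^sup>+mu. (?c * ?G) * ennreal (nd (avg n th) (A / real n) mu) \<partial>lborel)"
        using th al_pos be_pos by (intro nn_integral_cong) (simp add: step post_dens_eq_mu_A ennreal_mult mult_ac)
      also have "\<dots> = ?c * ?G" using True n2 by (subst nn_integral_cmult) (auto simp: nn_integral_nd)
      also have "\<dots> = (\<integral>\<^sup>+mu. ?c * (ennreal (nd (avg n th) (A / real n) mu) * \<Psi> A mu) \<partial>lborel)"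
        by (rule nn_integral_cmult[symmetric]) measurable
      also have "\<dots> = (\<integral>\<^sup>+mu. ennreal (p (A, mu, th)) * \<Psi> A mu \<partial>lborel)"
        using al_pos be_pos by (intro nn_integral_cong) (simp add: post_dens_eq_mu_A ennreal_mult mult_ac)
      finally show ?thesis .
    qed (simp add: post_dens_def)
  qed
  also have "\<dots> = Ep (\<lambda>x. \<Psi> (fst x) (fst (snd x)))"
    by (subst nn_integral_SS') auto
  also have "\<dots> = (\<integral>\<^sup>+A. \<integral>\<^sup>+mu. \<integral>\<^sup>+th. ennreal (p (A, mu, th)) * \<Psi> A mu \<partial>thetas n \<partial>lborel \<partial>lborel)"
    by (subst nn_integral_SS) auto
  \<comment> \<open>In the other order of integration, theta given A and mu already has the law of
    its update, so the fresh theta can be identified with the old one.\<close>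
  also have "\<dots> = (\<integral>\<^sup>+A. \<integral>\<^sup>+mu. \<integral>\<^sup>+th. ennreal (p (A, mu, th)) * \<Phi> mu th \<partial>thetas n \<partial>lborel \<partial>lborel)"
  proof (rule nn_integral_cong, rule nn_integral_cong)
    fix A mu
    show "(\<integral>\<^sup>+th. ennreal (p (A, mu, th)) * \<Psi> A mu \<partial>thetas n) = (\<integral>\<^sup>+th. ennreal (p (A, mu, th)) * \<Phi> mu th \<partial>thetas n)"
    proof (cases "A > 0")
      case True
      let ?c = "ennreal (hh A * nd (avg n Y) ((V + A) / real n) mu)"
      have "(\<integral>\<^sup>+th. ennreal (p (A, mu, th)) * \<Psi> A mu \<partial>thetas n) = (\<integral>\<^sup>+th. (?c * \<Psi> A mu) * ennreal (pd n (mm A mu) (vv A) th) \<partial>thetas n)"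
        by (intro nn_integral_cong) (simp add: post_dens_eq_A_mu_theta ennreal_mult mult_ac)
      also have "\<dots> = ?c * \<Psi> A mu" using True pdm by (subst nn_integral_cmult) (auto simp: nn_integral_pd vv_pos)
      also have "\<dots> = (\<integral>\<^sup>+th. ?c * (ennreal (pd n (mm A mu) (vv A) th) * \<Phi> mu th) \<partial>thetas n)"
        unfolding \<Psi>_def using pdm m1A by (intro nn_integral_cmult[symmetric]) auto
      also have "\<dots> = (\<integral>\<^sup>+th. ennreal (p (A, mu, th)) * \<Phi> mu th \<partial>thetas n)"
        by (intro nn_integral_cong) (simp add: post_dens_eq_A_mu_theta ennreal_mult mult_ac)
      finally show ?thesis .
    qed (simp add: post_dens_def)
  qed
  also have "\<dots> = Ep (\<lambda>x. \<Phi> (fst (snd x)) (snd (snd x)))"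
    by (subst nn_integral_SS) auto
  also have "\<dots> = (\<integral>\<^sup>+th. ennreal (p3 th) * EA th (\<lambda>A. Emu (avg n th) A (\<lambda>mu. \<Phi> mu th)) \<partial>thetas n)"
    by (subst nn_integral_p_theta) auto
  also have "\<dots> = (\<integral>\<^sup>+th. ennreal (p3 th) * EA th (\<lambda>A. EA th (\<lambda>A'. Emu (avg n th) A (\<lambda>mu. \<phi> (A', mu, th)))) \<partial>thetas n)"
  proof (rule nn_integral_cong, rule arg_cong2[where f="(*)"], rule refl,
      rule nn_integral_cong, rule arg_cong2[where f="(*)"], rule refl)
    fix th A assume th: "th \<in> space (thetas n)"
    have [measurable]: "(\<lambda>q. \<phi> (f q, g q, th)) \<in> borel_measurable M" if [measurable]: "f \<in> borel_measurable M" "g \<in> borel_measurable M"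
      for f g and M :: "'z measure"
      using th by (intro measurable_compose[OF _ \<phi>] measurable_state_Pair) auto
    have "Emu (avg n th) A (\<lambda>mu. \<Phi> mu th)
      = (\<integral>\<^sup>+mu. \<integral>\<^sup>+A'. ennreal (nd (avg n th) (A / real n) mu) * (ennreal (igd al (be th) A') * \<phi> (A', mu, th)) \<partial>lborel \<partial>lborel)"
      unfolding \<Phi>_def by (intro nn_integral_cong nn_integral_cmult[symmetric]) measurable
    also have "\<dots> = (\<integral>\<^sup>+A'. Emu (avg n th) A (\<lambda>mu. ennreal (igd al (be th) A') * \<phi> (A', mu, th)) \<partial>lborel)"
      by (intro nn_integral_swap sigma_finite_lborel) measurable
    also have "\<dots> = (\<integral>\<^sup>+A'. \<integral>\<^sup>+mu. ennreal (igd al (be th) A') * (ennreal (nd (avg n th) (A / real n) mu) * \<phi> (A', mu, th)) \<partial>lborel \<partial>lborel)"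
      by (simp only: mult_ac)
    also have "\<dots> = EA th (\<lambda>A'. Emu (avg n th) A (\<lambda>mu. \<phi> (A', mu, th)))"
      by (intro nn_integral_cong nn_integral_cmult) measurable
    finally show "Emu (avg n th) A (\<lambda>mu. \<Phi> mu th) =
      EA th (\<lambda>A'. Emu (avg n th) A (\<lambda>mu. \<phi> (A', mu, th)))" .
  qed
  finally show ?thesis .
qed

end

section \<open>Concentration of the posterior\<close>

context gibbs
begin

definition "NN = (real n - 1) / 2"

text \<open>Logarithm of \<open>hh\<close> up to the constant \<open>hc\<close>. Its likelihood
  part, the last two terms, is stationary at As.\<close>

definition lh :: "real \<Rightarrow> real" where
  "lh A = (- a - 1) * ln A - b0 / A - NN * ln (V + A) - ssq n Y / 2 / (V + A)"

definition "hc = (sqrt (2 * pi * V)) ^ n * sqrt (2 * pi / real n)"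

lemma hh_exp: "A > 0 \<Longrightarrow> hh A = hc * exp (lh A)"
proof -
  assume A: "A > 0"
  then have "A powr (- a - 1) * exp (- b0 / A) * (V + A) powr (- NN) * exp (- ssq n Y / (2 * (V + A)))
     = exp ((- a - 1) * ln A + - b0 / A + - NN * ln (V + A) + - ssq n Y / (2 * (V + A)))"
    using V by (simp only: exp_add powr_def) simp
  also have "(- a - 1) * ln A + - b0 / A + - NN * ln (V + A) + - ssq n Y / (2 * (V + A)) = lh A"
    by (simp add: lh_def)
  finally show ?thesis using A by (simp add: hh_def hc_def NN_def)
qed

lemma hc_nonneg: "hc \<ge> 0" using V by (simp add: hc_def)

end

section \<open>Truncated second moment of A under the posterior\<close>

context gibbs_reg
begin

text \<open>\<open>e0\<close> is at most As and at most b0 / (a + 1), the zero of the logarithmic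
  derivative of the prior, so below \<open>e0\<close> the signs in \<open>prior_term_le\<close> are
  known.\<close>

definition "e0 = min \<delta> (b0 / (a + 1))"
definition "CG = 1 + (1 + M / e0) * (b0 / e0 + a + 1)"
definition "Cpi = V + 4 * (M + h)\<^sup>2 * CG"

lemma e0_pos: "e0 > 0" using del a b0 by (simp add: e0_def)

lemma CG_ge: "CG \<ge> 1" using e0_pos M_nonneg a b0 by (simp add: CG_def)

lemma Cpi_nonneg: "Cpi \<ge> 0" using CG_ge V by (simp add: Cpi_def)

text \<open>The prior's share in the derivative of (A - As) * hh A, relative to hh A. For A < e0 its
  two factors have opposite signs; for A \<ge> e0 each factor divided by A is bounded.\<close>

lemma prior_term_le:
  assumes A: "A > 0"
  shows "1 + (A - As) * (b0 - (a + 1) * A) / A\<^sup>2 \<le> CG"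
proof (cases "A < e0")
  case True
  then have "A - As \<le> 0" "b0 - (a + 1) * A \<ge> 0" using As a by (auto simp: e0_def pos_less_divide_eq mult.commute)
  then have "(A - As) * (b0 - (a + 1) * A) / A\<^sup>2 \<le> 0" by (simp add: divide_nonpos_nonneg mult_nonpos_nonneg)
  then show ?thesis using CG_ge by linarith
next
  case False
  then have e: "A \<ge> e0" by simp
  have "\<bar>A - As\<bar> / A \<le> 1 + M / e0"
  proof -
    have "\<bar>A - As\<bar> / A \<le> (A + As) / A" using A As del by (intro divide_right_mono) auto
    also have "\<dots> = 1 + As / A" using A by (simp add: add_divide_distrib)
    also have "As / A \<le> M / e0" using e e0_pos As V del M_nonneg by (intro frac_le) auto
    finally show ?thesis by simp
  qed
  moreover have "\<bar>b0 - (a + 1) * A\<bar> / A \<le> b0 / e0 + a + 1"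
  proof -
    have "\<bar>b0 - (a + 1) * A\<bar> \<le> b0 + (a + 1) * A" using A a b0 by (intro abs_leI) auto
    then have "\<bar>b0 - (a + 1) * A\<bar> / A \<le> (b0 + (a + 1) * A) / A" using A by (intro divide_right_mono) auto
    also have "\<dots> = b0 / A + (a + 1)" using A by (simp add: add_divide_distrib)
    also have "b0 / A \<le> b0 / e0" using e e0_pos b0 by (intro divide_left_mono) auto
    finally show ?thesis by simp
  qed
  ultimately have "(\<bar>A - As\<bar> / A) * (\<bar>b0 - (a + 1) * A\<bar> / A) \<le> (1 + M / e0) * (b0 / e0 + a + 1)"
    using A e0_pos M_nonneg by (intro mult_mono) auto
  moreover have "(A - As) * (b0 - (a + 1) * A) / A\<^sup>2 \<le> (\<bar>A - As\<bar> / A) * (\<bar>b0 - (a + 1) * A\<bar> / A)"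
    using A by (simp add: power2_eq_square abs_mult[symmetric] divide_right_mono)
  ultimately show ?thesis by (simp add: CG_def)
qed

text \<open>Integrating the derivative of \<open>(A - As) * hh A\<close> over \<open>[\<epsilon>, L]\<close>: the boundary terms have the
  favourable sign as soon as \<open>\<epsilon> \<le> As \<le> L\<close>, so no limits are needed.\<close>

lemma hh_integral_Icc:
  assumes e: "0 < \<epsilon>" "\<epsilon> \<le> As" "As \<le> L"
  shows "(\<integral>\<^sup>+A. ennreal (hh A * (NN * (A - As)\<^sup>2 / (V + A)\<^sup>2)) * indicator {\<epsilon>..L} A \<partial>lborel) \<le> ennreal CG * Z"
proof -
  let ?k = "\<lambda>A. hc * exp (lh A)"
  let ?F = "\<lambda>A. (A - As) * ?k A"
  \<comment> \<open>By \<open>prior_term_le\<close>, F' \<le> CG k - G on the interval. As the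
    integral of F' is nonnegative, the integral of G is at most CG times that of k.\<close>
  let ?F' = "\<lambda>A. ?k A * (1 + (A - As) * (b0 - (a + 1) * A) / A\<^sup>2 - NN * (A - As)\<^sup>2 / (V + A)\<^sup>2)"
  let ?G = "\<lambda>A. ?k A * (NN * (A - As)\<^sup>2 / (V + A)\<^sup>2)"
  have eL: "\<epsilon> \<le> L" using e by simp
  have NN0: "NN \<ge> 0" using n10 by (simp add: NN_def)
  have lh': "DERIV lh A :> (b0 - (a + 1) * A) / A\<^sup>2 - NN * (A - As) / (V + A)\<^sup>2" if "A > 0" for A
  proof -
    have VA: "V + A > 0" using that V by simp
    have "DERIV lh A :> (- a - 1) / A + b0 / A\<^sup>2 - NN / (V + A) + ssq n Y / 2 / (V + A)\<^sup>2"
    proof -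
      have "((\<lambda>A. (- a - 1) * ln A - b0 / A - NN * ln (V + A) - s / (V + A)) has_real_derivative
          (- a - 1) / A + b0 / A\<^sup>2 - NN / (V + A) + s / (V + A)\<^sup>2) (at A)" for s
        using that VA by (auto intro!: derivative_eq_intros simp: power2_eq_square)
      then show ?thesis unfolding lh_def[abs_def] .
    qed
    \<comment> \<open>The definition of As in the form Delta / 2 = NN (V + As); it turns the
      likelihood part of the derivative into a multiple of A - As.\<close>
    also have "ssq n Y / 2 / (V + A)\<^sup>2 = NN * (V + As) / (V + A)\<^sup>2" using As(3) by (simp add: NN_def)
    also have "(- a - 1) / A + b0 / A\<^sup>2 - NN / (V + A) + NN * (V + As) / (V + A)\<^sup>2 = (b0 - (a + 1) * A) / A\<^sup>2 - NN * (A - As) / (V + A)\<^sup>2"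
    proof -
      have "NN / (V + A) = NN * (V + A) / (V + A)\<^sup>2" using VA by (simp add: power2_eq_square)
      moreover have "(- a - 1) / A = (- (a + 1) * A) / A\<^sup>2" using that by (simp add: power2_eq_square)
      ultimately show ?thesis by (simp add: add_divide_distrib[symmetric] diff_divide_distrib[symmetric] algebra_simps)
    qed
    finally show ?thesis .
  qed
  have lhc: "isCont lh A" if "A > 0" for A using lh'[OF that] by (rule DERIV_isCont)
  have dF: "DERIV ?F A :> ?F' A" if "A > 0" for A
  proof -
    define D' where "D' = (b0 - (a + 1) * A) / A\<^sup>2 - NN * (A - As) / (V + A)\<^sup>2"
    have "DERIV ?F A :> ?k A * (1 + (A - As) * D')"
      using lh'[OF that] unfolding D'_def[symmetric] by (auto intro!: derivative_eq_intros simp: algebra_simps)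
    also have "1 + (A - As) * D' = 1 + (A - As) * (b0 - (a + 1) * A) / A\<^sup>2 - NN * (A - As)\<^sup>2 / (V + A)\<^sup>2"
    proof -
      have "x * (c / u - NN * x / w) = x * c / u - NN * x\<^sup>2 / w" for x c u w
        by (simp add: right_diff_distrib power2_eq_square mult_ac)
      then show ?thesis unfolding D'_def by simp
    qed
    finally show ?thesis .
  qed
  have VA: "V + A \<noteq> 0" if "A > 0" for A using that V by simp
  have cF: "isCont ?F' A" "isCont ?G A" "isCont ?k A" if "A > 0" for A
    using lhc[OF that] that VA[OF that] by (auto intro!: continuous_intros)
  have bF: "has_bochner_integral lborel (\<lambda>x. ?F' x * indicator {\<epsilon>..L} x) (?F L - ?F \<epsilon>)"
    using eL e(1) dF cF(1) by (intro has_bochner_integral_FTC_Icc_real) (auto intro: has_field_derivative_at_within)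
  have iG: "integrable lborel (\<lambda>x. ?G x * indicator {\<epsilon>..L} x)" and ik: "integrable lborel (\<lambda>x. ?k x * indicator {\<epsilon>..L} x)"
    using borel_integrable_atLeastAtMost[of \<epsilon> L ?G] borel_integrable_atLeastAtMost[of \<epsilon> L ?k] cF e(1)
    by (auto simp: mult.commute)
  have "(\<integral>\<^sup>+A. ennreal (hh A * (NN * (A - As)\<^sup>2 / (V + A)\<^sup>2)) * indicator {\<epsilon>..L} A \<partial>lborel) = (\<integral>\<^sup>+A. ennreal (?G A * indicator {\<epsilon>..L} A) \<partial>lborel)"
    using e(1) by (intro nn_integral_cong) (auto simp: hh_exp indicator_def)
  also have "\<dots> = ennreal (\<integral>A. ?G A * indicator {\<epsilon>..L} A \<partial>lborel)"
    using iG NN0 hc_nonneg by (intro nn_integral_eq_integral) auto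
  also have "\<dots> \<le> ennreal (CG * (\<integral>A. ?k A * indicator {\<epsilon>..L} A \<partial>lborel))"
  proof (rule ennreal_leI)
    have "(\<integral>A. ?G A * indicator {\<epsilon>..L} A \<partial>lborel) \<le> (\<integral>A. CG * (?k A * indicator {\<epsilon>..L} A) - ?F' A * indicator {\<epsilon>..L} A \<partial>lborel)"
    proof (intro integral_mono iG)
      show "integrable lborel (\<lambda>A. CG * (?k A * indicator {\<epsilon>..L} A) - ?F' A * indicator {\<epsilon>..L} A)"
        using ik bF by (intro Bochner_Integration.integrable_diff integrable_mult_right) (auto simp: has_bochner_integral_iff)
      fix A
      show "?G A * indicator {\<epsilon>..L} A \<le> CG * (?k A * indicator {\<epsilon>..L} A) - ?F' A * indicator {\<epsilon>..L} A"
      proof (cases "A \<in> {\<epsilon>..L}")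
        case True
        then have "A > 0" using e by auto
        then have "?k A * (1 + (A - As) * (b0 - (a + 1) * A) / A\<^sup>2) \<le> ?k A * CG"
          using hc_nonneg by (intro mult_left_mono prior_term_le) auto
        then show ?thesis using True by (simp add: algebra_simps)
      qed simp
    qed
    also have "\<dots> = CG * (\<integral>A. ?k A * indicator {\<epsilon>..L} A \<partial>lborel) - (?F L - ?F \<epsilon>)"
      using ik bF by (subst Bochner_Integration.integral_diff) (auto simp: has_bochner_integral_iff)
    also have "\<dots> \<le> CG * (\<integral>A. ?k A * indicator {\<epsilon>..L} A \<partial>lborel)"
    proof -
      have "?F L \<ge> 0" "?F \<epsilon> \<le> 0" using e hc_nonneg by (auto intro: mult_nonpos_nonneg)
      then show ?thesis by linarith
    qed
    finally show "(\<integral>A. ?G A * indicator {\<epsilon>..L} A \<partial>lborel) \<le> CG * (\<integral>A. ?k A * indicator {\<epsilon>..L} A \<partial>lborel)" .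
  qed
  also have "\<dots> = ennreal CG * (\<integral>\<^sup>+A. ennreal (?k A * indicator {\<epsilon>..L} A) \<partial>lborel)"
    using ik CG_ge hc_nonneg by (subst nn_integral_eq_integral) (auto simp: ennreal_mult')
  also have "\<dots> \<le> ennreal CG * Z"
    unfolding Z_eq using e(1) by (intro mult_left_mono nn_integral_mono) (auto simp: hh_exp indicator_def)
  finally show ?thesis .
qed

text \<open>The intervals S k increase to the positive half-line, off which \<open>hh\<close>
  vanishes, and all contain As, so the bound on each passes to the limit by monotone
  continuity.\<close>

lemma hh_integral:
  "(\<integral>\<^sup>+A. ennreal (hh A * (NN * (A - As)\<^sup>2 / (V + A)\<^sup>2)) \<partial>lborel) \<le> ennreal CG * Z"
proof -
  let ?g = "\<lambda>A. ennreal (hh A * (NN * (A - As)\<^sup>2 / (V + A)\<^sup>2))"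
  have As0: "As > 0" using As del by simp
  define S where "S k = {As / (real k + 1) .. As * (real k + 1)}" for k
  have inc: "incseq S"
  proof (rule incseq_SucI)
    fix k
    have "As / (real (Suc k) + 1) \<le> As / (real k + 1)" using As0 by (intro divide_left_mono) auto
    moreover have "As * (real k + 1) \<le> As * (real (Suc k) + 1)" using As0 by (intro mult_left_mono) auto
    ultimately show "S k \<le> S (Suc k)" by (auto simp: S_def)
  qed
  have un: "A \<in> (\<Union>k. S k)" if "A > 0" for A
  proof -
    obtain k where k: "max (As / A) (A / As) \<le> real k" using real_arch_simple by blast
    have "As / A \<le> real k + 1" "A / As \<le> real k + 1" using k by auto
    then have "As \<le> A * (real k + 1)" "A \<le> As * (real k + 1)" using that As0 by (auto simp: pos_divide_le_eq mult.commute)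
    then have "A \<in> S k" by (auto simp: S_def pos_divide_le_eq)
    then show ?thesis by blast
  qed
  have "(\<integral>\<^sup>+A. ?g A \<partial>lborel) = (\<integral>\<^sup>+A. ?g A * indicator (\<Union>k. S k) A \<partial>lborel)"
  proof (intro nn_integral_cong)
    fix A show "?g A = ?g A * indicator (\<Union>k. S k) A"
      using un[of A] by (cases "A > 0") (auto simp: hh_def indicator_def)
  qed
  also have "\<dots> = emeasure (density lborel ?g) (\<Union>k. S k)"
    by (subst emeasure_density) (auto simp: S_def)
  also have "\<dots> = (SUP k. emeasure (density lborel ?g) (S k))"
    by (rule SUP_emeasure_incseq[OF _ inc, symmetric]) (auto simp: S_def)
  also have "\<dots> \<le> ennreal CG * Z"
  proof (rule SUP_least)
    fix k
    have "emeasure (density lborel ?g) (S k) = (\<integral>\<^sup>+A. ?g A * indicator (S k) A \<partial>lborel)"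
      by (subst emeasure_density) (auto simp: S_def)
    also have "\<dots> \<le> ennreal CG * Z"
      unfolding S_def
    proof (rule hh_integral_Icc)
      show "0 < As / (real k + 1)" using As0 by simp
      show "As / (real k + 1) \<le> As" "As \<le> As * (real k + 1)" using As0 by (auto simp: pos_divide_le_eq)
    qed
    finally show "emeasure (density lborel ?g) (S k) \<le> ennreal CG * Z" .
  qed
  finally show ?thesis .
qed

text \<open>Integration by parts controls the deviation only relative to V + A. Up to As + h the
  denominator is at most M + h; beyond, the relative deviation is at least h / (M + h). The factor 4
  covers n \<le> 4 NN.\<close>

lemma truncated_le_relative:
  assumes A: "A > 0"
  shows "real n * (min \<bar>A - As\<bar> h)\<^sup>2 \<le> 4 * (M + h)\<^sup>2 * (NN * (A - As)\<^sup>2 / (V + A)\<^sup>2)"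
proof -
  have VA: "V + A > 0" using A V by simp
  have Mh: "M + h > 0" using M_nonneg h_pos by simp
  have "min \<bar>A - As\<bar> h \<le> (M + h) * (\<bar>A - As\<bar> / (V + A))"
  proof (cases "A \<le> As + h")
    case True
    then have "V + A \<le> M + h" using As(2) by simp
    then have "\<bar>A - As\<bar> * (V + A) \<le> \<bar>A - As\<bar> * (M + h)" by (intro mult_left_mono) auto
    then have "\<bar>A - As\<bar> \<le> (M + h) * (\<bar>A - As\<bar> / (V + A))" using VA by (simp add: pos_le_divide_eq mult.commute)
    then show ?thesis by simp
  next
    case False
    have "h * (V + A) = h * (V + As) + h * (A - As)" by (simp add: algebra_simps)
    also have "\<dots> \<le> (A - As) * M + h * (A - As)"
    proof -
      have "h * (V + As) \<le> (A - As) * M" using False As(1,2) V del h_pos by (intro mult_mono) auto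
      then show ?thesis by simp
    qed
    also have "\<dots> = (M + h) * \<bar>A - As\<bar>" using False h_pos by (simp add: algebra_simps)
    finally have "h \<le> (M + h) * (\<bar>A - As\<bar> / (V + A))" using VA by (simp add: pos_le_divide_eq)
    then show ?thesis by simp
  qed
  then have "(min \<bar>A - As\<bar> h)\<^sup>2 \<le> ((M + h) * (\<bar>A - As\<bar> / (V + A)))\<^sup>2" using h_pos by (intro power_mono) auto
  also have "\<dots> = (M + h)\<^sup>2 * ((A - As)\<^sup>2 / (V + A)\<^sup>2)" by (simp add: power_mult_distrib power_divide)
  finally have "real n * (min \<bar>A - As\<bar> h)\<^sup>2 \<le> (4 * NN) * ((M + h)\<^sup>2 * ((A - As)\<^sup>2 / (V + A)\<^sup>2))"
    using n10 by (intro mult_mono) (auto simp: NN_def)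
  then show ?thesis by (simp add: mult_ac)
qed

text \<open>Given A, the average of theta has posterior variance exactly V / n about Yb, since V^2 /
  (V + A) + vv A = V. This is the summand V of \<open>Cpi\<close>; the other one comes from
  \<open>hh_integral\<close>.\<close>

lemma posterior_lyap:
  "Ep (\<lambda>x. ennreal (lyap x)) \<le> ennreal Cpi * Z"
proof -
  have n: "real n > 0" using n10 by simp
  have "Ep (\<lambda>x. ennreal (lyap x)) = (\<integral>\<^sup>+A. \<integral>\<^sup>+mu. \<integral>\<^sup>+th. ennreal (p (A, mu, th)) * ennreal (lyap (A, mu, th)) \<partial>thetas n \<partial>lborel \<partial>lborel)"
    by (rule nn_integral_SS) measurable
  also have "\<dots> \<le> (\<integral>\<^sup>+A. ennreal V * ennreal (hh A) + ennreal (4 * (M + h)\<^sup>2) * ennreal (hh A * (NN * (A - As)\<^sup>2 / (V + A)\<^sup>2)) \<partial>lborel)"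
  proof (rule nn_integral_mono)
    fix A
    show "(\<integral>\<^sup>+mu. \<integral>\<^sup>+th. ennreal (p (A, mu, th)) * ennreal (lyap (A, mu, th)) \<partial>thetas n \<partial>lborel)
      \<le> ennreal V * ennreal (hh A) + ennreal (4 * (M + h)\<^sup>2) * ennreal (hh A * (NN * (A - As)\<^sup>2 / (V + A)\<^sup>2))"
    proof (cases "A > 0")
      case True
      define k where "k = real n * (min \<bar>A - As\<bar> h)\<^sup>2"
      have k0: "k \<ge> 0" by (simp add: k_def)
      have VA: "V + A > 0" using True V by simp
      have v: "vv A > 0" by (rule vv_pos[OF True])
      have th: "Eth A mu (\<lambda>th. ennreal (lyap (A, mu, th))) =
          ennreal (real n * (V / (V + A))\<^sup>2 * (mu - Yb)\<^sup>2 + (vv A + k))" for mu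
      proof -
        have [measurable]: "pd n (mm A mu) (vv A) \<in> borel_measurable (thetas n)" by measurable
        have "Eth A mu (\<lambda>th. ennreal (lyap (A, mu, th))) =
          (\<integral>\<^sup>+th. ennreal (real n) * ennreal (pd n (mm A mu) (vv A) th * (avg n th - Yb)\<^sup>2) + ennreal k * ennreal (pd n (mm A mu) (vv A) th) \<partial>thetas n)"
          using k0 by (intro nn_integral_cong) (simp add: lyap_def k_def[symmetric] ennreal_mult[symmetric] ennreal_plus[symmetric] algebra_simps del: ennreal_plus)
        also have "\<dots> = ennreal (real n) * ennreal ((avg n (mm A mu) - Yb)\<^sup>2 + vv A / real n) + ennreal k"
          using avg_second_moment[OF True, of mu Yb] by (simp add: nn_integral_add nn_integral_cmult nn_integral_pd v)
        also have "\<dots> = ennreal (real n * ((avg n (mm A mu) - Yb)\<^sup>2 + vv A / real n) + k)"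
          using v k0 n by (simp add: ennreal_mult[symmetric] ennreal_plus[symmetric] del: ennreal_plus)
        also have "real n * ((avg n (mm A mu) - Yb)\<^sup>2 + vv A / real n) + k = real n * (V / (V + A))\<^sup>2 * (mu - Yb)\<^sup>2 + (vv A + k)"
          unfolding avg_mm[OF VA] using n by (simp add: distrib_left power_divide power_mult_distrib)
        finally show ?thesis .
      qed
      have "(\<integral>\<^sup>+mu. \<integral>\<^sup>+th. ennreal (p (A, mu, th)) * ennreal (lyap (A, mu, th)) \<partial>thetas n \<partial>lborel)
        = (\<integral>\<^sup>+mu. ennreal (hh A) * (ennreal (nd Yb ((V + A) / real n) mu) * ennreal (real n * (V / (V + A))\<^sup>2 * (mu - Yb)\<^sup>2 + (vv A + k))) \<partial>lborel)"
      proof (rule nn_integral_cong)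
        fix mu
        have "pd n (mm A mu) (vv A) \<in> borel_measurable (thetas n)" by measurable
        moreover have "(\<lambda>th. lyap (A, mu, th)) \<in> borel_measurable (thetas n)"
          by (intro measurable_compose[OF _ measurable_lyap] measurable_state_Pair) auto
        ultimately have "(\<integral>\<^sup>+th. ennreal (p (A, mu, th)) * ennreal (lyap (A, mu, th)) \<partial>thetas n) =
          ennreal (hh A * nd Yb ((V + A) / real n) mu) * Eth A mu (\<lambda>th. ennreal (lyap (A, mu, th)))"
          by (subst nn_integral_cmult[symmetric]) (auto simp: post_dens_eq_A_mu_theta Yb_def ennreal_mult mult_ac)
        then show "(\<integral>\<^sup>+th. ennreal (p (A, mu, th)) * ennreal (lyap (A, mu, th)) \<partial>thetas n) =
          ennreal (hh A) * (ennreal (nd Yb ((V + A) / real n) mu) * ennreal (real n * (V / (V + A))\<^sup>2 * (mu - Yb)\<^sup>2 + (vv A + k)))"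
          unfolding th by (simp add: ennreal_mult mult.assoc)
      qed
      also have "\<dots> = ennreal (hh A) * ennreal (real n * (V / (V + A))\<^sup>2 * ((Yb - Yb)\<^sup>2 + (V + A) / real n) + (vv A + k))"
        using VA n v k0 by (subst nn_integral_cmult, measurable, subst normal_second_moment) auto
      also have "real n * (V / (V + A))\<^sup>2 * ((Yb - Yb)\<^sup>2 + (V + A) / real n) + (vv A + k) = V + k"
      proof -
        have "real n * (V / (V + A))\<^sup>2 * ((Yb - Yb)\<^sup>2 + (V + A) / real n) = V * V / (V + A)" using n VA by (simp add: power2_eq_square)
        moreover have "V * V / (V + A) + vv A = V" using VA by (simp add: vv_def add_divide_distrib[symmetric]) (simp add: field_simps)
        ultimately show ?thesis by simp
      qed
      also have "ennreal (hh A) * ennreal (V + k) = ennreal V * ennreal (hh A) + ennreal (hh A * k)"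
        using V k0 by (simp add: ennreal_mult distrib_left distrib_right mult.commute)
      also have "\<dots> \<le> ennreal V * ennreal (hh A) + ennreal (hh A * (4 * (M + h)\<^sup>2 * (NN * (A - As)\<^sup>2 / (V + A)\<^sup>2)))"
        unfolding k_def by (intro add_left_mono ennreal_leI mult_left_mono truncated_le_relative True) auto
      also have "\<dots> = ennreal V * ennreal (hh A) + ennreal (4 * (M + h)\<^sup>2) * ennreal (hh A * (NN * (A - As)\<^sup>2 / (V + A)\<^sup>2))"
        using n10 by (subst ennreal_mult[symmetric]) (auto simp: NN_def mult_ac)
      finally show ?thesis .
    qed (simp add: post_dens_def)
  qed
  also have "\<dots> = ennreal V * Z + ennreal (4 * (M + h)\<^sup>2) * (\<integral>\<^sup>+A. ennreal (hh A * (NN * (A - As)\<^sup>2 / (V + A)\<^sup>2)) \<partial>lborel)"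
    by (simp add: nn_integral_add nn_integral_cmult Z_eq)
  also have "\<dots> \<le> ennreal V * Z + ennreal (4 * (M + h)\<^sup>2) * (ennreal CG * Z)"
    by (intro add_left_mono mult_left_mono hh_integral) auto
  also have "\<dots> = (ennreal V + ennreal (4 * (M + h)\<^sup>2 * CG)) * Z"
    using CG_ge by (simp add: ennreal_mult distrib_right mult.assoc)
  also have "\<dots> = ennreal Cpi * Z" using V CG_ge by (simp add: Cpi_def)
  finally show ?thesis .
qed

section \<open>Displacement of the posterior by one step\<close>

definition "ee A = min \<bar>A - As\<bar> h / h"

lemma ee_nonneg: "0 \<le> ee A" using h_pos by (simp add: ee_def)

lemma measurable_ee [measurable]: "ee \<in> borel_measurable borel"
  unfolding ee_def[abs_def] by measurable

text \<open>With w the capped deviation, 2 sqrt n w \<le> n w^2 + 1 turns the second moment into a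
  first moment of order n^(-1/2).\<close>

lemma posterior_ee:
  "Ep (\<lambda>x. ennreal (ee (fst x))) \<le> ennreal ((Cpi + 1) / (2 * h * sqrt (real n))) * Z"
proof -
  have n: "real n > 0" using n10 by simp
  let ?c = "1 / (2 * h * sqrt (real n))"
  have "Ep (\<lambda>x. ennreal (ee (fst x))) \<le> (\<integral>\<^sup>+x. ennreal ?c * (ennreal (p x) * ennreal (lyap x) + ennreal (p x)) \<partial>SS)"
  proof (rule nn_integral_mono)
    fix x :: state
    define w where "w = min \<bar>fst x - As\<bar> h"
    have w0: "w \<ge> 0" using h_pos by (simp add: w_def)
    have "0 \<le> (sqrt (real n) * w - 1)\<^sup>2" by simp
    then have "2 * sqrt (real n) * w \<le> real n * w\<^sup>2 + 1" using n by (simp add: power2_diff power_mult_distrib)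
    also have "\<dots> \<le> lyap x + 1" by (simp add: lyap_def w_def)
    finally have "w / h \<le> ?c * (lyap x + 1)" using n h_pos by (simp add: field_simps)
    then have "p x * ee (fst x) \<le> p x * (?c * (lyap x + 1))" unfolding ee_def w_def by (intro mult_left_mono) auto
    then have "ennreal (p x * ee (fst x)) \<le> ennreal (?c * (p x * lyap x + p x))"
      by (intro ennreal_leI) (simp only: ring_distribs mult_1_right mult_1 mult_ac)
    also have "\<dots> = ennreal ?c * (ennreal (p x) * ennreal (lyap x) + ennreal (p x))"
      using h_pos by (subst ennreal_mult) (auto simp: ennreal_mult)
    finally show "ennreal (p x) * ennreal (ee (fst x)) \<le> ennreal ?c * (ennreal (p x) * ennreal (lyap x) + ennreal (p x))"
      using ee_nonneg by (simp add: ennreal_mult)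
  qed
  also have "\<dots> = ennreal ?c * ((Ep (\<lambda>x. ennreal (lyap x))) + Z)"
    by (simp add: nn_integral_cmult nn_integral_add Z_def)
  also have "\<dots> \<le> ennreal ?c * (ennreal Cpi * Z + Z)"
    by (intro mult_left_mono add_right_mono posterior_lyap) auto
  also have "\<dots> = ennreal (?c * (Cpi + 1)) * Z"
  proof -
    have "ennreal (?c * (Cpi + 1)) = ennreal ?c * (ennreal Cpi + 1)" using h_pos Cpi_nonneg
      by (subst ennreal_mult) (auto simp flip: ennreal_1)
    then show ?thesis by (simp add: distrib_right distrib_left mult.assoc)
  qed
  finally show ?thesis by simp
qed

text \<open>\<open>ee\<close> reaches 1 outside the window of radius h, where the trivial bound by 1
  suffices. Inside, \<open>normal_overlap_variance\<close> applies with the reference variance As /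
  n, and h \<le> As.\<close>

lemma normal_overlap_ee:
  assumes A: "A > 0" "A' > 0" and [measurable]: "\<psi> \<in> borel_measurable borel" and psi: "\<And>x. \<psi> x \<le> (1::ennreal)"
  shows "Emu t A (\<lambda>mu. \<psi> mu) \<le>
    Emu t A' (\<lambda>mu. \<psi> mu) + (ennreal (ee A) + ennreal (ee A'))"
proof (cases "\<bar>A - As\<bar> \<le> h \<and> \<bar>A' - As\<bar> \<le> h")
  case True
  have n: "real n > 0" using n10 by simp
  have As0: "As > 0" using As del by simp
  have "Emu t A (\<lambda>mu. \<psi> mu) \<le>
    Emu t A' (\<lambda>mu. \<psi> mu) + ennreal ((\<bar>A / real n - As / real n\<bar> + \<bar>A' / real n - As / real n\<bar>) / (As / real n))"
    using A n As0 psi by (intro normal_overlap_variance) auto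
  also have "(\<bar>A / real n - As / real n\<bar> + \<bar>A' / real n - As / real n\<bar>) / (As / real n) = (\<bar>A - As\<bar> + \<bar>A' - As\<bar>) / As"
    using n As0 by (simp add: diff_divide_distrib[symmetric] add_divide_distrib[symmetric])
  also have "ennreal \<dots> \<le> ennreal (ee A + ee A')"
  proof (rule ennreal_leI)
    have "(\<bar>A - As\<bar> + \<bar>A' - As\<bar>) / As \<le> (\<bar>A - As\<bar> + \<bar>A' - As\<bar>) / h"
      using As del h_pos by (intro divide_left_mono) (auto simp: h_def)
    then show "(\<bar>A - As\<bar> + \<bar>A' - As\<bar>) / As \<le> ee A + ee A'" using True by (simp add: ee_def add_divide_distrib)
  qed
  also have "\<dots> = ennreal (ee A) + ennreal (ee A')" using ee_nonneg by simp
  finally show ?thesis by (meson add_left_mono order_trans)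
next
  case False
  have "Emu t A (\<lambda>mu. \<psi> mu) \<le> Emu t A (\<lambda>mu. 1)"
    using psi by (intro nn_integral_mono mult_left_mono) auto
  also have "\<dots> = 1" using A n10 by (simp add: nn_integral_nd)
  also have "1 \<le> ennreal (ee A) + ennreal (ee A')"
  proof -
    have "ee A \<ge> 1 \<or> ee A' \<ge> 1" using False h_pos by (auto simp: ee_def)
    then have "1 \<le> ee A + ee A'" using ee_nonneg[of A] ee_nonneg[of A'] by linarith
    then show ?thesis using ee_nonneg by (simp add: ennreal_plus[symmetric] del: ennreal_plus flip: ennreal_1) 
  qed
  also have "\<dots> \<le> Emu t A' (\<lambda>mu. \<psi> mu) + (ennreal (ee A) + ennreal (ee A'))" by simp
  finally show ?thesis .
qed

text \<open>After the step mu has been drawn with the old A, whereas under the posterior it is drawn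
  with the A that the state carries. By \<open>normal_overlap_ee\<close> the exchange costs ee A +
  ee A'; both have the same law given theta, hence the factor 2 on the bound of
  \<open>posterior_ee\<close>.\<close>

lemma posterior_one_step:
  assumes \<phi> [measurable]: "\<phi> \<in> borel_measurable SS" and le1: "\<And>x. \<phi> x \<le> (1::ennreal)"
  shows "Ep (\<lambda>x. \<integral>\<^sup>+y. \<phi> y \<partial>P x) \<le> Ep (\<lambda>x. \<phi> x) + ennreal ((Cpi + 1) / (h * sqrt (real n))) * Z"
proof -
  \<comment> \<open>A is the value with which mu is drawn, A' the value that the tested state
    carries: X integrates over independent A and A', W over the diagonal.\<close>
  define T where "T th A A' = Emu (avg n th) A (\<lambda>mu. \<phi> (A', mu, th))" for th A A'
  define X where "X th = EA th (\<lambda>A. EA th (\<lambda>A'. T th A A'))" for th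
  define W where "W th = EA th (\<lambda>A. T th A A)" for th
  define E where "E th = EA th (\<lambda>A. ennreal (ee A))" for th
  have T [measurable]: "(\<lambda>(th, A, A'). T th A A') \<in> borel_measurable (thetas n \<Otimes>\<^sub>M (borel \<Otimes>\<^sub>M borel))"
    unfolding T_def by measurable
  have T' [measurable (raw)]: "(\<lambda>x. T (f x) (g x) (k x)) \<in> borel_measurable N"
    if [measurable]: "f \<in> measurable N (thetas n)" "g \<in> borel_measurable N" "k \<in> borel_measurable N" for f g k and N :: "'z measure"
    using measurable_compose[of "\<lambda>x. (f x, g x, k x)" N _ _, OF _ T] by simp
  have X [measurable]: "X \<in> borel_measurable (thetas n)"
    unfolding X_def[abs_def] by measurable
  have W [measurable]: "W \<in> borel_measurable (thetas n)"
    unfolding W_def[abs_def] by measurable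
  have Em [measurable]: "E \<in> borel_measurable (thetas n)"
    unfolding E_def[abs_def] by measurable
  have LX: "Ep (\<lambda>x. \<integral>\<^sup>+y. \<phi> y \<partial>P x) = (\<integral>\<^sup>+th. ennreal (p3 th) * X th \<partial>thetas n)"
    unfolding nn_integral_p_step[OF \<phi>] X_def T_def ..
  have LW: "Ep (\<lambda>x. \<phi> x) = (\<integral>\<^sup>+th. ennreal (p3 th) * W th \<partial>thetas n)"
    unfolding nn_integral_p_theta[OF \<phi>] W_def T_def ..
  have LE: "Ep (\<lambda>x. ennreal (ee (fst x))) = (\<integral>\<^sup>+th. ennreal (p3 th) * E th \<partial>thetas n)"
  proof -
    have "ennreal (igd al (be th) A) * Emu (avg n th) A (\<lambda>mu. ennreal (ee A)) = ennreal (igd al (be th) A) * ennreal (ee A)" for th A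
      using n10 by (cases "A > 0") (auto simp: igd_def nn_integral_multc nn_integral_nd)
    then show ?thesis by (subst nn_integral_p_theta) (auto simp: E_def)
  qed
  have igd1: "(\<integral>\<^sup>+A. ennreal (igd al (be th) A) \<partial>lborel) = 1" for th by (simp add: nn_integral_igd al_pos be_pos)
  have XW: "X th \<le> W th + 2 * E th" if th: "th \<in> space (thetas n)" for th
  proof -
    have [measurable]: "(\<lambda>x. \<phi> (A', x, th)) \<in> borel_measurable borel" for A'
      using th by (intro measurable_compose[OF _ \<phi>] measurable_state_Pair) auto
    have Tm [measurable (raw)]: "(\<lambda>x. T th (g x) (k x)) \<in> borel_measurable N"
      if [measurable]: "g \<in> borel_measurable N" "k \<in> borel_measurable N" for g k and N :: "'z measure"
      using th by (intro T') auto
    let ?I = "\<lambda>A. EA th (\<lambda>A'. T th A A')"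
    have TT: "T th A A' \<le> T th A' A' + (ennreal (ee A) + ennreal (ee A'))"
      if "A > 0" "A' > 0" for A A'
      unfolding T_def using le1 by (intro normal_overlap_ee[OF that]) auto
    have in1: "ennreal (igd al (be th) A) * ?I A \<le> ennreal (igd al (be th) A) * (W th + ennreal (ee A) + E th)" for A
    proof (cases "A > 0")
      case True
      have "?I A \<le> (\<integral>\<^sup>+A'. ennreal (igd al (be th) A') * T th A' A' + ennreal (ee A) * ennreal (igd al (be th) A') + ennreal (igd al (be th) A') * ennreal (ee A') \<partial>lborel)"
      proof (rule nn_integral_mono)
        fix A'
        show "ennreal (igd al (be th) A') * T th A A' \<le> ennreal (igd al (be th) A') * T th A' A' + ennreal (ee A) * ennreal (igd al (be th) A') + ennreal (igd al (be th) A') * ennreal (ee A')"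
        proof (cases "A' > 0")
          case A': True
          show ?thesis using mult_left_mono[OF TT[OF True A'], of "ennreal (igd al (be th) A')"] by (simp add: distrib_left mult_ac add_ac)
        qed (simp add: igd_def)
      qed
      also have "\<dots> = W th + ennreal (ee A) + E th"
        by (simp add: nn_integral_add nn_integral_cmult igd1 W_def E_def)
      finally show ?thesis by (intro mult_left_mono) auto
    qed (simp add: igd_def)
    have "X th \<le> (\<integral>\<^sup>+A. (W th + E th) * ennreal (igd al (be th) A) + ennreal (igd al (be th) A) * ennreal (ee A) \<partial>lborel)"
      unfolding X_def by (intro nn_integral_mono order_trans[OF in1]) (simp add: distrib_left distrib_right mult_ac add_ac)
    also have "\<dots> = W th + E th + E th" by (simp add: nn_integral_add nn_integral_cmult igd1 E_def)
    finally show ?thesis by (simp add: mult_2 add.assoc)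
  qed
  have err: "2 * (\<integral>\<^sup>+th. ennreal (p3 th) * E th \<partial>thetas n) \<le> ennreal ((Cpi + 1) / (h * sqrt (real n))) * Z"
  proof -
    have "2 * (\<integral>\<^sup>+th. ennreal (p3 th) * E th \<partial>thetas n) \<le> ennreal 2 * (ennreal ((Cpi + 1) / (2 * h * sqrt (real n))) * Z)"
      unfolding LE[symmetric] using posterior_ee by (intro mult_mono) auto
    also have "\<dots> = ennreal (2 * ((Cpi + 1) / (2 * h * sqrt (real n)))) * Z"
      using Cpi_nonneg h_pos by (subst ennreal_mult) (auto simp: mult.assoc)
    also have "2 * ((Cpi + 1) / (2 * h * sqrt (real n))) = (Cpi + 1) / (h * sqrt (real n))"
      using h_pos n10 by (simp add: field_simps)
    finally show ?thesis .
  qed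
  have "(\<integral>\<^sup>+th. ennreal (p3 th) * X th \<partial>thetas n) \<le> (\<integral>\<^sup>+th. ennreal (p3 th) * W th + 2 * (ennreal (p3 th) * E th) \<partial>thetas n)"
  proof (rule nn_integral_mono)
    fix th assume "th \<in> space (thetas n)"
    then show "ennreal (p3 th) * X th \<le> ennreal (p3 th) * W th + 2 * (ennreal (p3 th) * E th)"
      using mult_left_mono[of "X th" "W th + 2 * E th" "ennreal (p3 th)"] XW by (simp add: distrib_left mult_ac)
  qed
  also have "\<dots> = (\<integral>\<^sup>+th. ennreal (p3 th) * W th \<partial>thetas n) + 2 * (\<integral>\<^sup>+th. ennreal (p3 th) * E th \<partial>thetas n)"
    by (simp add: nn_integral_add nn_integral_cmult)
  finally show "Ep (\<lambda>x. \<integral>\<^sup>+y. \<phi> y \<partial>P x) \<le> Ep (\<lambda>x. \<phi> x) + ennreal ((Cpi + 1) / (h * sqrt (real n))) * Z"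
    unfolding LX LW using err by (meson add_left_mono order_trans)
qed

text \<open>Only the draw of mu uses the wrong A; the pair (A', theta) after the step has its
  posterior law. A function that ignores mu therefore keeps its mean exactly.\<close>

lemma posterior_invariant:
  assumes \<phi> [measurable]: "\<phi> \<in> borel_measurable SS" and ind: "\<And>A mu mu' th. \<phi> (A, mu, th) = \<phi> (A, mu', th)"
  shows "Ep (\<lambda>x. \<integral>\<^sup>+y. \<phi> y \<partial>P x) = Ep (\<lambda>x. \<phi> x)"
proof -
  have c: "Emu t A (\<lambda>mu. \<phi> (A', mu, th)) = \<phi> (A', 0, th)" if "A > 0" for t A A' th
  proof -
    have "Emu t A (\<lambda>mu. \<phi> (A', mu, th)) = Emu t A (\<lambda>mu. \<phi> (A', 0, th))"
      using ind by (intro nn_integral_cong) metis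
    then show ?thesis using that n10 by (simp add: nn_integral_multc nn_integral_nd)
  qed
  have c1: "ennreal (igd al (be th) A) * Emu (avg n th) A (\<lambda>mu. \<phi> (A, mu, th)) = ennreal (igd al (be th) A) * \<phi> (A, 0, th)" for A th
    by (cases "A > 0") (auto simp: c igd_def)
  have c2: "EA th (\<lambda>A. EA th (\<lambda>A'. Emu (avg n th) A (\<lambda>mu. \<phi> (A', mu, th)))) = EA th (\<lambda>A'. \<phi> (A', 0, th))" for th
  proof -
    have "EA th (\<lambda>A. EA th (\<lambda>A'. Emu (avg n th) A (\<lambda>mu. \<phi> (A', mu, th))))
     = EA th (\<lambda>A. EA th (\<lambda>A'. \<phi> (A', 0, th)))"
    proof (rule nn_integral_cong)
      fix A
      show "ennreal (igd al (be th) A) * EA th (\<lambda>A'. Emu (avg n th) A (\<lambda>mu. \<phi> (A', mu, th)))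
        = ennreal (igd al (be th) A) * EA th (\<lambda>A'. \<phi> (A', 0, th))"
        by (cases "A > 0") (auto simp: c igd_def)
    qed
    then show ?thesis by (simp add: nn_integral_multc nn_integral_igd al_pos be_pos)
  qed
  show ?thesis unfolding nn_integral_p_step[OF \<phi>] nn_integral_p_theta[OF \<phi>] c1 c2 ..
qed

end

section \<open>Convergence in total variation\<close>

lemma tv_dist_le:
  assumes "\<And>E. E \<in> sets P \<Longrightarrow> \<bar>measure P E - measure R E\<bar> \<le> c"
  shows "tv_dist P R \<le> c"
  unfolding tv_dist_def by (rule cSUP_least) (use assms sets.empty_sets in auto)

text \<open>The bounds are asked at every point and not just on \<open>space M\<close>, so they can
  be applied without membership conditions.\<close>

definition unit_fun :: "'a measure \<Rightarrow> ('a \<Rightarrow> real) \<Rightarrow> bool" where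
  "unit_fun M \<phi> \<longleftrightarrow> \<phi> \<in> borel_measurable M \<and> (\<forall>x. 0 \<le> \<phi> x \<and> \<phi> x \<le> 1)"

text \<open>Forcing the value 0 off \<open>space M\<close> keeps the result within \<open>[0, 1]\<close> everywhere.\<close>

definition kernel_op :: "'a measure \<Rightarrow> ('a \<Rightarrow> 'a measure) \<Rightarrow> ('a \<Rightarrow> real) \<Rightarrow> 'a \<Rightarrow> real" where
  "kernel_op M K \<phi> x = (if x \<in> space M then \<integral>y. \<phi> y \<partial>K x else 0)"

lemma kernel_op:
  assumes K: "K \<in> measurable M (subprob_algebra M)" and \<phi>: "unit_fun M \<phi>"
  shows "unit_fun M (kernel_op M K \<phi>)"
    and "x \<in> space M \<Longrightarrow> ennreal (kernel_op M K \<phi> x) = (\<integral>\<^sup>+y. ennreal (\<phi> y) \<partial>K x)"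
proof -
  have m [measurable]: "\<phi> \<in> borel_measurable M" and b: "\<And>x. 0 \<le> \<phi> x" "\<And>x. \<phi> x \<le> 1" using \<phi> by (auto simp: unit_fun_def)
  have sub: "subprob_space (K x)" "sets (K x) = sets M" if "x \<in> space M" for x
    using subprob_space_kernel[OF K that] sets_kernel[OF K that] by auto
  have "(\<lambda>x. \<integral>y. \<phi> y \<partial>K x) \<in> borel_measurable M"
    by (rule measurable_compose[OF K]) measurable
  then have "kernel_op M K \<phi> \<in> borel_measurable M"
    by (subst measurable_cong[of _ _ "\<lambda>x. \<integral>y. \<phi> y \<partial>K x"]) (auto simp: kernel_op_def)
  moreover have "0 \<le> kernel_op M K \<phi> x \<and> kernel_op M K \<phi> x \<le> 1" for x
  proof (cases "x \<in> space M")
    case True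
    interpret subprob_space "K x" by (rule sub[OF True])
    note sub(2)[OF True, measurable_cong]
    have i: "integrable (K x) \<phi>" using b by (intro integrable_const_bound[where B=1]) auto
    have "(\<integral>y. \<phi> y \<partial>K x) \<le> (\<integral>y. 1 \<partial>K x)" using i b by (intro integral_mono) auto
    also have "\<dots> \<le> 1" using subprob_measure_le_1[of "space (K x)"] by simp
    finally show ?thesis using True b by (simp add: kernel_op_def)
  qed (simp add: kernel_op_def)
  ultimately show "unit_fun M (kernel_op M K \<phi>)" by (simp add: unit_fun_def)
  show "ennreal (kernel_op M K \<phi> x) = (\<integral>\<^sup>+y. ennreal (\<phi> y) \<partial>K x)" if x: "x \<in> space M"
  proof -
    interpret subprob_space "K x" by (rule sub[OF x])
    note sub(2)[OF x, measurable_cong]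
    have i: "integrable (K x) \<phi>" using b by (intro integrable_const_bound[where B=1]) auto
    show ?thesis using i b x by (simp add: kernel_op_def nn_integral_eq_integral)
  qed
qed

lemma unit_fun_funpow:
  "K \<in> measurable M (subprob_algebra M) \<Longrightarrow> unit_fun M \<phi> \<Longrightarrow> unit_fun M ((kernel_op M K ^^ k) \<phi>)"
  by (induction k) (auto intro: kernel_op(1))

lemma unit_fun_le: "unit_fun M \<phi> \<Longrightarrow> 0 \<le> \<phi> x" "unit_fun M \<phi> \<Longrightarrow> \<phi> x \<le> 1" "unit_fun M \<phi> \<Longrightarrow> \<phi> \<in> borel_measurable M"
  by (auto simp: unit_fun_def)

lemma unit_fun_integrable:
  assumes "prob_space N" "sets N = sets M" "unit_fun M \<phi>"
  shows "integrable N \<phi>"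
proof -
  interpret prob_space N by fact
  have [measurable]: "\<phi> \<in> borel_measurable N" using assms by (simp add: unit_fun_def cong: measurable_cong_sets)
  show ?thesis using unit_fun_le[OF assms(3)] by (intro integrable_const_bound[where B=1]) auto
qed

context gibbs
begin

lemma gibbs_law_Suc: "gibbs_law n Y V a b0 x0 (Suc k) = Giry_Monad.bind (gibbs_law n Y V a b0 x0 k) P"
  by (simp add: gibbs_law_def)

lemma sets_gibbs_law:
  assumes "x0 \<in> space SS"
  shows "sets (gibbs_law n Y V a b0 x0 k) = sets SS"
proof (induction k)
  case (Suc k)
  have sp: "space (gibbs_law n Y V a b0 x0 k) = space SS" using Suc by (rule sets_eq_imp_space_eq)
  show ?case unfolding gibbs_law_Suc
    by (rule sets_bind) (use sp assms sets_P in auto)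
qed (simp add: gibbs_law_def)

text \<open>Duality between laws and test functions: afterwards only iterates of an operator on
  [0, 1]-valued functions have to be studied. The induction varies \<phi> because the last step of
  the chain acts on \<phi> first.\<close>

lemma nn_integral_gibbs_law:
  assumes x0: "x0 \<in> space SS"
  shows "unit_fun SS \<phi> \<Longrightarrow> (\<integral>\<^sup>+x. ennreal (\<phi> x) \<partial>gibbs_law n Y V a b0 x0 k) = ennreal ((kernel_op SS P ^^ k) \<phi> x0)"
proof (induction k arbitrary: \<phi>)
  case 0
  then show ?case using x0 unit_fun_le(3)[OF 0] by (simp add: gibbs_law_def nn_integral_return)
next
  case (Suc k)
  have sets: "sets (gibbs_law n Y V a b0 x0 k) = sets SS" by (rule sets_gibbs_law[OF x0])
  then have sp: "space (gibbs_law n Y V a b0 x0 k) = space SS" by (rule sets_eq_imp_space_eq)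
  have "(\<integral>\<^sup>+x. ennreal (\<phi> x) \<partial>gibbs_law n Y V a b0 x0 (Suc k)) = (\<integral>\<^sup>+x. \<integral>\<^sup>+y. ennreal (\<phi> y) \<partial>P x \<partial>gibbs_law n Y V a b0 x0 k)"
    unfolding gibbs_law_Suc using unit_fun_le(3)[OF Suc.prems] step_measurable sets
    by (intro nn_integral_bind[where B=SS]) (auto cong: measurable_cong_sets)
  also have "\<dots> = (\<integral>\<^sup>+x. ennreal (kernel_op SS P \<phi> x) \<partial>gibbs_law n Y V a b0 x0 k)"
    by (intro nn_integral_cong) (simp add: sp kernel_op(2)[OF step_measurable Suc.prems])
  also have "\<dots> = ennreal ((kernel_op SS P ^^ k) (kernel_op SS P \<phi>) x0)"
    by (rule Suc.IH[OF kernel_op(1)[OF step_measurable Suc.prems]])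
  finally show ?case by (simp add: funpow_swap1)
qed

lemma measure_gibbs_law:
  assumes "x0 \<in> space SS" "E \<in> sets SS"
  shows "measure (gibbs_law n Y V a b0 x0 k) E = (kernel_op SS P ^^ k) (indicator E) x0"
proof -
  have u: "unit_fun SS (indicator E)" using assms(2) by (auto simp: unit_fun_def indicator_def)
  have "emeasure (gibbs_law n Y V a b0 x0 k) E = (\<integral>\<^sup>+x. ennreal (indicator E x) \<partial>gibbs_law n Y V a b0 x0 k)"
    using assms sets_gibbs_law by (simp add: ennreal_indicator)
  then show ?thesis unfolding nn_integral_gibbs_law[OF assms(1) u]
    using unit_fun_le(1)[OF unit_fun_funpow[OF step_measurable u]] by (simp add: measure_def)
qed

lemma P_indep_mu: "P (A, mu, th) = P (A, mu', th)"
  by (simp add: gibbs_step_def)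

text \<open>The step does not read the old mu, so one application of the operator already produces a
  function to which \<open>posterior_invariant\<close> applies.\<close>

lemma kernel_op_indep_mu: "kernel_op SS P \<phi> (A, mu, th) = kernel_op SS P \<phi> (A, mu', th)"
  using P_indep_mu[of A mu th mu'] by (simp add: kernel_op_def space_SS)

end

section \<open>Comparison of P with Q, contraction, and the total error\<close>

context gibbs_reg
begin

abbreviation "post \<equiv> posterior n Y V a b0"
abbreviation "U \<equiv> kernel_op SS P"
abbreviation "W \<equiv> kernel_op SS Q"

lemma \<gamma>: "0 \<le> \<gamma>" "\<gamma> < 1" using q by (auto simp: \<gamma>_def power_le_one)

lemma Kd_pos: "Kd > 0"
proof -
  have "D * (16 * B3\<^sup>2 + 8 * B1\<^sup>2 + 36 * B2 + 2 * h * V) \<ge> 0"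
    using D_nonneg V M_nonneg h_pos by (auto simp: B2_def)
  then show ?thesis using V unfolding Kd_def by linarith
qed

lemma sets_post: "sets post = sets SS" and space_post: "space post = space SS"
  using sets_eq_imp_space_eq[OF sets_posterior] by auto

lemma post_lyap: "(\<integral>\<^sup>+x. ennreal (lyap x) \<partial>post) \<le> ennreal Cpi" "integrable post lyap" "(\<integral>x. lyap x \<partial>post) \<le> Cpi"
proof -
  show 1: "(\<integral>\<^sup>+x. ennreal (lyap x) \<partial>post) \<le> ennreal Cpi"
  proof -
    have "(\<integral>\<^sup>+x. ennreal (lyap x) \<partial>post) = (\<integral>\<^sup>+x. ennreal (p x) * ennreal (lyap x) \<partial>SS) / Z"
      by (rule nn_integral_posterior) measurable
    also have "\<dots> \<le> (ennreal Cpi * Z) / Z" by (intro divide_right_mono_ennreal posterior_lyap)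
    also have "\<dots> = ennreal Cpi" using Z_pos Z_finite by (intro mult_divide_eq_ennreal) auto
    finally show ?thesis .
  qed
  show "integrable post lyap" using 1
    by (intro integrableI_nonneg) (auto intro: le_less_trans)
  show "(\<integral>x. lyap x \<partial>post) \<le> Cpi"
    using 1 Cpi_nonneg by (intro integral_real_bounded) auto
qed

text \<open>P and Q agree while \<bar>A - As\<bar> \<le> h. Otherwise \<open>lyap\<close> is at
  least n h^2, so an error of at most 1 is at most lyap / (n h^2). The error is propagated along Q
  only, where the drift lets the mean of \<open>lyap\<close> grow by at most \<open>Kd\<close> per
  step; summing over k steps gives order k^2 / n.\<close>

lemma UW_close:
  assumes u: "unit_fun SS \<phi>"
  shows "x \<in> space SS \<Longrightarrow> \<bar>(U ^^ k) \<phi> x - (W ^^ k) \<phi> x\<bar> \<le> real k / (real n * h\<^sup>2) * (lyap x + real k * Kd)"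
proof (induction k arbitrary: x)
  case (Suc k)
  let ?\<psi> = "(U ^^ k) \<phi>" and ?\<chi> = "(W ^^ k) \<phi>"
  define c where "c = 1 / (real n * h\<^sup>2)"
  have nh: "real n * h\<^sup>2 > 0" using n10 h_pos by simp
  have c: "c > 0" using nh by (simp add: c_def)
  have up: "unit_fun SS ?\<psi>" and uc: "unit_fun SS ?\<chi>"
    by (simp_all add: unit_fun_funpow[OF step_measurable u] unit_fun_funpow[OF Q_measurable u])
  have 1: "\<bar>U ?\<psi> x - W ?\<psi> x\<bar> \<le> c * lyap x"
  proof (cases "\<bar>fst x - As\<bar> \<le> h")
    case True
    then have "cl (fst x) = fst x" by (auto simp: cl_def)
    then have "Q x = P x" by (simp add: Q_def)
    then show ?thesis using c by (simp add: kernel_op_def)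
  next
    case False
    have "\<bar>U ?\<psi> x - W ?\<psi> x\<bar> \<le> 1"
      using unit_fun_le(1,2)[OF kernel_op(1)[OF step_measurable up], of x] unit_fun_le(1,2)[OF kernel_op(1)[OF Q_measurable up], of x]
      by (auto simp: abs_le_iff)
    also have "1 = c * (real n * h\<^sup>2)" using nh n10 h_pos by (simp add: c_def)
    also have "\<dots> \<le> c * lyap x" using False c by (intro mult_left_mono) (auto simp: lyap_def)
    finally show ?thesis .
  qed
  have 2: "\<bar>W ?\<psi> x - W ?\<chi> x\<bar> \<le> c * (real k * (lyap x + Kd + real k * Kd))"
  proof -
    have x: "x \<in> space SS" by (rule Suc.prems)
    interpret prob_space "Q x" by (rule prob_space_Q[OF x])
    note s = sets_Q[OF x]
    have sp: "space (Q x) = space SS" using s by (rule sets_eq_imp_space_eq)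
    have i: "integrable (Q x) ?\<psi>" "integrable (Q x) ?\<chi>"
      using unit_fun_integrable[OF prob_space_Q[OF x] s] up uc by auto
    have il: "integrable (Q x) lyap" "(\<integral>y. lyap y \<partial>Q x) \<le> \<gamma> * lyap x + Kd"
    proof -
      have m: "lyap \<in> borel_measurable (Q x)" using measurable_lyap s by (simp cong: measurable_cong_sets)
      show "integrable (Q x) lyap" using drift[OF x] m
        by (intro integrableI_nonneg) (auto intro: le_less_trans)
      show "(\<integral>y. lyap y \<partial>Q x) \<le> \<gamma> * lyap x + Kd"
        using drift[OF x] \<gamma> Kd_pos by (intro integral_real_bounded) auto
    qed
    have "\<bar>W ?\<psi> x - W ?\<chi> x\<bar> = \<bar>\<integral>y. ?\<psi> y - ?\<chi> y \<partial>Q x\<bar>" using x i by (simp add: kernel_op_def)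
    also have "\<dots> \<le> (\<integral>y. \<bar>?\<psi> y - ?\<chi> y\<bar> \<partial>Q x)" by (rule integral_abs_bound)
    also have "\<dots> \<le> (\<integral>y. (c * real k) * (lyap y + real k * Kd) \<partial>Q x)"
    proof (rule integral_mono)
      fix y assume "y \<in> space (Q x)"
      then have "y \<in> space SS" using sp by simp
      from Suc.IH[OF this] show "\<bar>?\<psi> y - ?\<chi> y\<bar> \<le> (c * real k) * (lyap y + real k * Kd)" by (simp add: c_def)
    qed (use i il in auto)
    also have "\<dots> = (c * real k) * ((\<integral>y. lyap y \<partial>Q x) + real k * Kd)" using il by (simp add: prob_space)
    also have "\<dots> \<le> (c * real k) * ((lyap x + Kd) + real k * Kd)"
    proof -
      have "\<gamma> * lyap x \<le> 1 * lyap x" using \<gamma> by (intro mult_right_mono) auto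
      then show ?thesis using il c by (intro mult_left_mono add_right_mono) auto
    qed
    finally show ?thesis by (simp add: mult_ac)
  qed
  have "\<bar>(U ^^ Suc k) \<phi> x - (W ^^ Suc k) \<phi> x\<bar> \<le> c * lyap x + c * (real k * (lyap x + Kd + real k * Kd))"
    using 1 2 by simp
  also have "\<dots> \<le> c * (real (Suc k) * (lyap x + real (Suc k) * Kd))"
  proof -
    have "0 \<le> real (Suc k) * Kd" using Kd_pos by simp
    then have "lyap x + real k * (lyap x + Kd + real k * Kd) \<le> real (Suc k) * (lyap x + real (Suc k) * Kd)"
      by (simp add: algebra_simps)
    then have "c * (lyap x + real k * (lyap x + Kd + real k * Kd)) \<le> c * (real (Suc k) * (lyap x + real (Suc k) * Kd))"
      using c by (intro mult_left_mono) auto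
    then show ?thesis by (simp add: distrib_left)
  qed
  finally show ?case by (simp add: c_def)
qed simp

text \<open>The constants of \<open>hairer_mattingly\<close> for f = \<open>lyap\<close>; the
  minimum with 1 provides \<epsilon> \<le> 1. They are built from V, a, b0, \<delta> and M alone, so
  the rate \<alpha> is uniform in n and in the data.\<close>

definition "Rd = 4 * Kd / (1 - \<gamma>)"
definition "\<epsilon> = min 1 ((bb Rd)\<^sup>2 / 2)"
definition "\<beta> = \<epsilon> / (2 * Kd)"
definition "\<alpha> = max (1 - \<epsilon> / 2) ((2 + \<beta> * Rd * ((1 + \<gamma>) / 2)) / (2 + \<beta> * Rd))"

lemma \<epsilon>: "0 < \<epsilon>" "\<epsilon> \<le> 1" using bb_pos[of Rd] by (auto simp: \<epsilon>_def)

lemma \<beta>: "\<beta> > 0" using \<epsilon> Kd_pos by (simp add: \<beta>_def)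

lemma \<alpha>: "0 \<le> \<alpha>" "\<alpha> < 1"
proof -
  have R: "\<beta> * Rd > 0" using \<beta> Kd_pos \<gamma> by (simp add: Rd_def)
  show "0 \<le> \<alpha>" using \<epsilon> by (simp add: \<alpha>_def le_max_iff_disj)
  have "\<beta> * Rd * ((1 + \<gamma>) / 2) < \<beta> * Rd * 1" using R \<gamma> by (intro mult_strict_left_mono) auto
  then have "(2 + \<beta> * Rd * ((1 + \<gamma>) / 2)) / (2 + \<beta> * Rd) < 1" using R by (simp add: pos_divide_less_eq)
  then show "\<alpha> < 1" using \<epsilon> by (simp add: \<alpha>_def)
qed

lemma small_set_real:
  assumes xy: "x \<in> space SS" "y \<in> space SS" and R: "lyap x + lyap y \<le> 4 * Kd / (1 - \<gamma>)"
    and u: "unit_fun SS \<psi>"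
  shows "(\<integral>z. \<psi> z \<partial>Q x) - (\<integral>z. \<psi> z \<partial>Q y) \<le> 1 - \<epsilon>"
proof -
  have "ennreal (W \<psi> x) \<le> ennreal (W \<psi> y) + ennreal (1 - (bb Rd)\<^sup>2 / 2)"
    unfolding kernel_op(2)[OF Q_measurable u xy(1)] kernel_op(2)[OF Q_measurable u xy(2)]
    using unit_fun_le[OF u] R by (intro small_set xy) (auto simp: Rd_def)
  also have "\<dots> \<le> ennreal (W \<psi> y) + ennreal (1 - \<epsilon>)"
    using \<epsilon> by (intro add_left_mono ennreal_leI) (simp add: \<epsilon>_def)
  also have "\<dots> = ennreal (W \<psi> y + (1 - \<epsilon>))"
    using \<epsilon> unit_fun_le(1)[OF kernel_op(1)[OF Q_measurable u], of y] by simp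
  finally have "W \<psi> x \<le> W \<psi> y + (1 - \<epsilon>)"
    using \<epsilon> unit_fun_le(1)[OF kernel_op(1)[OF Q_measurable u], of y] by (subst (asm) ennreal_le_iff) auto
  then show ?thesis using xy by (simp add: kernel_op_def)
qed

text \<open>A function with values in [0, 1] oscillates by at most 1 = (1 / 2) * 2, hence the
  initial Lipschitz constant 1 / 2. Each step multiplies it by \<alpha>.\<close>

lemma contraction:
  assumes u: "unit_fun SS \<phi>"
  shows "x \<in> space SS \<Longrightarrow> y \<in> space SS \<Longrightarrow>
    \<bar>(W ^^ k) \<phi> x - (W ^^ k) \<phi> y\<bar> \<le> \<alpha> ^ k * (1 / 2) * (2 + \<beta> * lyap x + \<beta> * lyap y)"
proof (induction k arbitrary: x y)
  case 0
  have "\<bar>\<phi> x - \<phi> y\<bar> \<le> 1" using unit_fun_le(1,2)[OF u, of x] unit_fun_le(1,2)[OF u, of y] by (auto simp: abs_le_iff)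
  moreover have "0 \<le> \<beta> * lyap x" "0 \<le> \<beta> * lyap y" using \<beta> by auto
  ultimately show ?case by simp
next
  case (Suc k)
  have uk: "unit_fun SS ((W ^^ k) \<phi>)" by (rule unit_fun_funpow[OF Q_measurable u])
  have "\<bar>(\<integral>z. (W ^^ k) \<phi> z \<partial>Q x) - (\<integral>z. (W ^^ k) \<phi> z \<partial>Q y)\<bar> \<le> \<alpha> * (\<alpha> ^ k * (1 / 2)) * (2 + \<beta> * lyap x + \<beta> * lyap y)"
  proof (rule hairer_mattingly[where M=SS and f=lyap and \<gamma>=\<gamma> and K=Kd and \<epsilon>=\<epsilon> and B=1])
    show "\<alpha> \<ge> 1 - \<epsilon> / 2" by (simp add: \<alpha>_def)
    show "\<alpha> \<ge> (2 + \<beta> * (4 * Kd / (1 - \<gamma>)) * ((1 + \<gamma>) / 2)) / (2 + \<beta> * (4 * Kd / (1 - \<gamma>)))"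
      unfolding Rd_def[symmetric] by (simp add: \<alpha>_def)
    show "\<bar>(W ^^ k) \<phi> x\<bar> \<le> 1" for x using unit_fun_le(1,2)[OF uk, of x] by simp
    show "(W ^^ k) \<phi> \<in> borel_measurable SS" by (rule unit_fun_le(3)[OF uk])
    fix x y :: state and \<psi> :: "state \<Rightarrow> real"
    assume "x \<in> space SS" "y \<in> space SS" "lyap x + lyap y \<le> 4 * Kd / (1 - \<gamma>)"
      "\<psi> \<in> borel_measurable SS" "\<And>z. 0 \<le> \<psi> z" "\<And>z. \<psi> z \<le> 1"
    then show "(\<integral>z. \<psi> z \<partial>Q x) - (\<integral>z. \<psi> z \<partial>Q y) \<le> 1 - \<epsilon>" by (intro small_set_real) (auto simp: unit_fun_def)
  qed (use prob_space_Q sets_Q drift \<gamma> Kd_pos \<epsilon> \<alpha> Suc in \<open>auto simp: \<beta>_def\<close>)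
  then show ?case using Suc.prems by (simp add: kernel_op_def[of SS Q "(W ^^ k) \<phi>"])
qed

lemma unit_fun_post:
  assumes u: "unit_fun SS \<phi>"
  shows "ennreal (\<integral>x. \<phi> x \<partial>post) = (\<integral>\<^sup>+x. ennreal (\<phi> x) \<partial>post)"
  using unit_fun_integrable[OF prob_space_posterior sets_post u] unit_fun_le(1)[OF u]
  by (subst nn_integral_eq_integral) auto

lemma nn_integral_post_U:
  assumes u: "unit_fun SS \<phi>"
  shows "(\<integral>\<^sup>+x. ennreal (U \<phi> x) \<partial>post) = (\<integral>\<^sup>+x. ennreal (p x) * (\<integral>\<^sup>+y. ennreal (\<phi> y) \<partial>P x) \<partial>SS) / Z"
proof -
  have "(\<integral>\<^sup>+x. ennreal (U \<phi> x) \<partial>post) = (\<integral>\<^sup>+x. ennreal (p x) * ennreal (U \<phi> x) \<partial>SS) / Z"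
    using unit_fun_le(3)[OF kernel_op(1)[OF step_measurable u]] by (intro nn_integral_posterior) auto
  also have "(\<integral>\<^sup>+x. ennreal (p x) * ennreal (U \<phi> x) \<partial>SS) = (\<integral>\<^sup>+x. ennreal (p x) * (\<integral>\<^sup>+y. ennreal (\<phi> y) \<partial>P x) \<partial>SS)"
    by (intro nn_integral_cong) (simp add: kernel_op(2)[OF step_measurable u])
  finally show ?thesis .
qed

lemma post_U_le:
  assumes u: "unit_fun SS \<phi>"
  shows "(\<integral>x. U \<phi> x \<partial>post) \<le> (\<integral>x. \<phi> x \<partial>post) + (Cpi + 1) / (h * sqrt (real n))"
proof -
  let ?e = "(Cpi + 1) / (h * sqrt (real n))"
  have e: "?e \<ge> 0" using Cpi_nonneg h_pos by simp
  have m: "(\<lambda>x. ennreal (\<phi> x)) \<in> borel_measurable SS" using unit_fun_le(3)[OF u] by measurable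
  have Zc: "(x + ennreal ?e * Z) / Z = x / Z + ennreal ?e" for x
    unfolding add_divide_distrib_ennreal using Z_pos Z_finite by (subst mult_divide_eq_ennreal) auto
  have le1: "ennreal (\<phi> x) \<le> 1" for x using unit_fun_le(2)[OF u, of x] by simp
  have "ennreal (\<integral>x. U \<phi> x \<partial>post) \<le> ennreal (\<integral>x. \<phi> x \<partial>post) + ennreal ?e"
    unfolding unit_fun_post[OF u] unit_fun_post[OF kernel_op(1)[OF step_measurable u]] nn_integral_post_U[OF u] nn_integral_posterior[OF m]
    using divide_right_mono_ennreal[OF posterior_one_step[OF m le1], of Z] by (simp only: Zc)
  moreover have "(\<integral>x. \<phi> x \<partial>post) \<ge> 0" using unit_fun_le(1)[OF u] by auto
  ultimately show ?thesis using e by (simp add: ennreal_plus[symmetric] del: ennreal_plus)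
qed

text \<open>The lower bound is \<open>post_U_le\<close> for 1 - \<phi>. The step is known to be a
  probability law only for A > 0, so \<open>U (\<lambda>_. 1)\<close> is not replaced by 1
  pointwise; its posterior mean is 1 by \<open>posterior_invariant\<close>.\<close>

lemma post_U_close:
  assumes u: "unit_fun SS \<phi>"
  shows "\<bar>(\<integral>x. U \<phi> x \<partial>post) - (\<integral>x. \<phi> x \<partial>post)\<bar> \<le> (Cpi + 1) / (h * sqrt (real n))"
proof -
  interpret post: prob_space post by (rule prob_space_posterior)
  let ?c = "\<lambda>x. 1 - \<phi> x"
  have c: "unit_fun SS ?c" using u by (auto simp: unit_fun_def)
  have o: "unit_fun SS (\<lambda>_. 1)" by (simp add: unit_fun_def)
  note U = kernel_op[OF step_measurable u] kernel_op[OF step_measurable c] kernel_op[OF step_measurable o]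
  note i = unit_fun_integrable[OF prob_space_posterior sets_post]
  have sum1: "U \<phi> x + U ?c x = U (\<lambda>_. 1) x" if x: "x \<in> space SS" for x
  proof -
    have "ennreal (U \<phi> x) + ennreal (U ?c x) = (\<integral>\<^sup>+y. ennreal (\<phi> y) + ennreal (?c y) \<partial>P x)"
      unfolding U(2)[OF x] U(4)[OF x] using unit_fun_le(3)[OF u] sets_P[OF x]
      by (intro nn_integral_add[symmetric]) (auto cong: measurable_cong_sets)
    also have "\<dots> = ennreal (U (\<lambda>_. 1) x)"
      unfolding U(6)[OF x] using unit_fun_le(1,2)[OF u]
      by (intro nn_integral_cong) (simp add: ennreal_plus[symmetric] del: ennreal_plus)
    finally show ?thesis using unit_fun_le(1)[OF U(1), of x] unit_fun_le(1)[OF U(3), of x] unit_fun_le(1)[OF U(5), of x]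
      by (simp add: ennreal_plus[symmetric] del: ennreal_plus)
  qed
  have "ennreal (\<integral>x. U (\<lambda>_. 1) x \<partial>post) = 1"
    unfolding unit_fun_post[OF U(5)] nn_integral_post_U[OF o]
    using Z_pos Z_finite by (subst posterior_invariant) (auto simp: Z_def[symmetric])
  then have "(\<integral>x. U (\<lambda>_. 1) x \<partial>post) = 1" by simp
  moreover have "(\<integral>x. U (\<lambda>_. 1) x \<partial>post) = (\<integral>x. U \<phi> x + U ?c x \<partial>post)"
    by (intro Bochner_Integration.integral_cong) (auto simp: space_post sum1)
  ultimately have "(\<integral>x. U \<phi> x \<partial>post) + (\<integral>x. U ?c x \<partial>post) = 1"
    using i[OF U(1)] i[OF U(3)] by simp
  moreover have "(\<integral>x. ?c x \<partial>post) = 1 - (\<integral>x. \<phi> x \<partial>post)" using i[OF u] by (simp add: post.prob_space)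
  ultimately show ?thesis using post_U_le[OF u] post_U_le[OF c] by (simp add: abs_le_iff)
qed

text \<open>Every iterate after the first application ignores mu, so further applications preserve
  its posterior mean. Hence the displacement n^(-1/2) is paid once and not k times.\<close>

lemma post_U_invariant:
  assumes u: "unit_fun SS \<phi>"
  shows "(\<integral>x. (U ^^ Suc k) \<phi> x \<partial>post) = (\<integral>x. U \<phi> x \<partial>post)"
proof (induction k)
  case (Suc k)
  let ?\<psi> = "(U ^^ Suc k) \<phi>"
  have up: "unit_fun SS ?\<psi>" by (rule unit_fun_funpow[OF step_measurable u])
  have m: "(\<lambda>x. ennreal (?\<psi> x)) \<in> borel_measurable SS" using unit_fun_le(3)[OF up] by measurable
  have ind: "ennreal (?\<psi> (A, mu, th)) = ennreal (?\<psi> (A, mu', th))" for A mu mu' th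
    using kernel_op_indep_mu[of "(U ^^ k) \<phi>" A mu th mu'] by simp
  have "ennreal (\<integral>x. U ?\<psi> x \<partial>post) = ennreal (\<integral>x. ?\<psi> x \<partial>post)"
    unfolding unit_fun_post[OF up] unit_fun_post[OF kernel_op(1)[OF step_measurable up]] nn_integral_post_U[OF up] nn_integral_posterior[OF m]
    by (subst posterior_invariant[OF m ind]) simp
  then have "(\<integral>x. U ?\<psi> x \<partial>post) = (\<integral>x. ?\<psi> x \<partial>post)"
    using unit_fun_le(1)[OF up] unit_fun_le(1)[OF kernel_op(1)[OF step_measurable up]] by (subst (asm) ennreal_inj) auto
  then show ?case using Suc by simp
qed simp

text \<open>The argument m stands for n, which keeps \<open>bound\<close> free of n and Y as a
  locale constant. The first summand is the replacement of P by Q, once from x0 and once from the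
  posterior; the second is the contraction, the third the displacement of the posterior.\<close>

definition "bound k m = real k / (m * h\<^sup>2) * (Cpi + 2 * real k * Kd) + \<alpha> ^ k * (1 / 2) * (2 + \<beta> * Cpi) + (Cpi + 1) / (h * sqrt m)"

text \<open>Four comparisons for an event E: U against W at x0, x0 against the posterior under W, W
  against U under the posterior, and k steps of U against none under the posterior.\<close>

lemma tv_bound:
  assumes x0: "x0 \<in> space SS" "fst x0 = As" "avg n (snd (snd x0)) = Yb" and k: "k > 0"
  shows "tv_dist (gibbs_law n Y V a b0 x0 k) post \<le> bound k (real n)"
proof (rule tv_dist_le)
  fix E assume "E \<in> sets (gibbs_law n Y V a b0 x0 k)"
  then have E: "E \<in> sets SS" using sets_gibbs_law[OF x0(1)] by simp
  let ?\<phi> = "indicator E :: state \<Rightarrow> real"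
  have u: "unit_fun SS ?\<phi>" using E by (auto simp: unit_fun_def indicator_def)
  interpret post: prob_space post by (rule prob_space_posterior)
  \<comment> \<open>Here the initial state (I) enters: the chain starts at the minimum of the
    Lyapunov function.\<close>
  have l0: "lyap x0 = 0" using h_pos by (simp add: lyap_def x0)
  have ui: "integrable post ((U ^^ k) ?\<phi>)" "integrable post ((W ^^ k) ?\<phi>)"
    using unit_fun_integrable[OF prob_space_posterior sets_post] unit_fun_funpow[OF step_measurable u] unit_fun_funpow[OF Q_measurable u] by auto
  define c where "c = real k / (real n * h\<^sup>2)"
  have c: "c \<ge> 0" by (simp add: c_def)
  have 1: "\<bar>(U ^^ k) ?\<phi> x0 - (W ^^ k) ?\<phi> x0\<bar> \<le> c * (real k * Kd)"
    using UW_close[OF u x0(1), of k] by (simp add: l0 c_def)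
  have 2: "\<bar>(W ^^ k) ?\<phi> x0 - (\<integral>x. (W ^^ k) ?\<phi> x \<partial>post)\<bar> \<le> \<alpha> ^ k * (1 / 2) * (2 + \<beta> * Cpi)"
  proof -
    have "\<bar>(W ^^ k) ?\<phi> x0 - (\<integral>x. (W ^^ k) ?\<phi> x \<partial>post)\<bar> = \<bar>\<integral>x. (W ^^ k) ?\<phi> x0 - (W ^^ k) ?\<phi> x \<partial>post\<bar>"
      using ui by (simp add: post.prob_space)
    also have "\<dots> \<le> (\<integral>x. \<bar>(W ^^ k) ?\<phi> x0 - (W ^^ k) ?\<phi> x\<bar> \<partial>post)" by (rule integral_abs_bound)
    also have "\<dots> \<le> (\<integral>x. \<alpha> ^ k * (1 / 2) * (2 + \<beta> * lyap x) \<partial>post)"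
      using contraction[OF u x0(1), of _ k] ui post_lyap(2) by (intro integral_mono) (auto simp: l0 space_post)
    also have "\<dots> = \<alpha> ^ k * (1 / 2) * (2 + \<beta> * (\<integral>x. lyap x \<partial>post))"
      using post_lyap(2) by (simp add: post.prob_space)
    also have "\<dots> \<le> \<alpha> ^ k * (1 / 2) * (2 + \<beta> * Cpi)"
      using post_lyap(3) \<beta> \<alpha> by (intro mult_left_mono add_left_mono) auto
    finally show ?thesis .
  qed
  have 3: "\<bar>(\<integral>x. (W ^^ k) ?\<phi> x \<partial>post) - (\<integral>x. (U ^^ k) ?\<phi> x \<partial>post)\<bar> \<le> c * (Cpi + real k * Kd)"
  proof -
    have "\<bar>(\<integral>x. (W ^^ k) ?\<phi> x \<partial>post) - (\<integral>x. (U ^^ k) ?\<phi> x \<partial>post)\<bar> = \<bar>\<integral>x. (U ^^ k) ?\<phi> x - (W ^^ k) ?\<phi> x \<partial>post\<bar>"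
      using ui by (simp add: abs_minus_commute)
    also have "\<dots> \<le> (\<integral>x. \<bar>(U ^^ k) ?\<phi> x - (W ^^ k) ?\<phi> x\<bar> \<partial>post)" by (rule integral_abs_bound)
    also have "\<dots> \<le> (\<integral>x. c * (lyap x + real k * Kd) \<partial>post)"
      using UW_close[OF u, of _ k] ui post_lyap(2) by (intro integral_mono) (auto simp: c_def space_post)
    also have "\<dots> = c * ((\<integral>x. lyap x \<partial>post) + real k * Kd)" using post_lyap(2) by (simp add: post.prob_space)
    also have "\<dots> \<le> c * (Cpi + real k * Kd)" using post_lyap(3) c by (intro mult_left_mono add_right_mono) auto
    finally show ?thesis .
  qed
  \<comment> \<open>\<open>post_U_invariant\<close> speaks of at least one step, hence the
    hypothesis k > 0.\<close>
  obtain j where j: "k = Suc j" using k by (cases k) auto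
  have 4: "\<bar>(\<integral>x. (U ^^ k) ?\<phi> x \<partial>post) - (\<integral>x. ?\<phi> x \<partial>post)\<bar> \<le> (Cpi + 1) / (h * sqrt (real n))"
    unfolding j post_U_invariant[OF u] by (rule post_U_close[OF u])
  have "(\<integral>x. ?\<phi> x \<partial>post) = measure post E" using E sets_post by (simp add: space_post)
  then have "\<bar>measure (gibbs_law n Y V a b0 x0 k) E - measure post E\<bar>
    \<le> c * (real k * Kd) + \<alpha> ^ k * (1 / 2) * (2 + \<beta> * Cpi) + c * (Cpi + real k * Kd) + (Cpi + 1) / (h * sqrt (real n))"
    unfolding measure_gibbs_law[OF x0(1) E] using 1 2 3 4 by linarith
  also have "\<dots> = bound k (real n)" by (simp add: bound_def c_def algebra_simps)
  finally show "\<bar>measure (gibbs_law n Y V a b0 x0 k) E - measure post E\<bar> \<le> bound k (real n)" .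
qed

end

thm gibbs_reg.bound_def gibbs_reg.\<alpha>_def gibbs_reg.\<beta>_def gibbs_reg.Cpi_def gibbs_reg.\<alpha>

text \<open>The existence of a suitable k is part of the conclusion because \<open>Kc\<close> is
  defined by \<open>LEAST\<close>, which carries no information when no k qualifies.\<close>

theorem mainTheorem6:
  fixes V a b0 c :: real and Y :: "nat \<Rightarrow> nat \<Rightarrow> real" and x0 :: "nat \<Rightarrow> state"
  assumes "V > 0" and "a > 0" and "b0 > 0"
    and assmA: "\<exists>\<delta> M N0. \<delta> > 0 \<and>
          (\<forall>n\<ge>2. ssq n (Y n) / (real n - 1) \<le> M) \<and>
          (\<forall>n\<ge>max 2 N0. ssq n (Y n) / (real n - 1) \<ge> V + \<delta>)"
    and init: "\<forall>n\<ge>2. x0 n \<in> space (state_space n) \<and>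
          fst (x0 n) = A_init n (Y n) V \<and>
          avg n (snd (snd (x0 n))) = avg n (Y n)"
    and "0 < c" and "c < 1"
  shows "\<exists>N Kbar. \<forall>n\<ge>N.
          (\<exists>k. tv_dist (gibbs_law n (Y n) V a b0 (x0 n) k) (posterior n (Y n) V a b0) \<le> c) \<and>
          Kc c n (Y n) V a b0 (x0 n) \<le> Kbar"
proof -
  from assmA obtain \<delta> M N0 where \<delta>: "\<delta> > 0"
    and hi: "\<And>n. n \<ge> 2 \<Longrightarrow> ssq n (Y n) / (real n - 1) \<le> M"
    and lo: "\<And>n. n \<ge> max 2 N0 \<Longrightarrow> ssq n (Y n) / (real n - 1) \<ge> V + \<delta>"
    by blast
  have reg: "gibbs_reg n (Y n) V a b0 \<delta> M" if "n \<ge> max 10 N0" for n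
    using that \<open>V > 0\<close> \<open>a > 0\<close> \<open>b0 > 0\<close> \<delta> hi lo by unfold_locales auto
  \<comment> \<open>Any admissible n serves here. The constants used below take only V, a, b0,
    \<delta> and M as arguments, so for every other n the interpretation \<open>R\<close> yields the
    very same terms.\<close>
  interpret I: gibbs_reg "max 10 N0" "Y (max 10 N0)" V a b0 \<delta> M
    by (rule reg) simp
  have "(\<lambda>k. I.\<alpha> ^ k * (1 / 2) * (2 + I.\<beta> * I.Cpi)) \<longlonglongrightarrow> 0 * (1 / 2) * (2 + I.\<beta> * I.Cpi)"
    using I.\<alpha> by (intro tendsto_intros LIMSEQ_realpow_zero) auto
  then have geometric: "(\<lambda>k. I.\<alpha> ^ k * (1 / 2) * (2 + I.\<beta> * I.Cpi)) \<longlonglongrightarrow> 0" by simp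
  \<comment> \<open>k is fixed first, from c and the constants, and n is taken large afterwards: the
    comparison of P with Q worsens as k grows but vanishes as n grows.\<close>
  have "\<forall>\<^sub>F k in sequentially. I.\<alpha> ^ k * (1 / 2) * (2 + I.\<beta> * I.Cpi) < c / 2 \<and> k > 0"
    using \<open>0 < c\<close> by (intro eventually_conj eventually_gt_at_top order_tendstoD(2)[OF geometric]) simp
  then obtain k where k: "I.\<alpha> ^ k * (1 / 2) * (2 + I.\<beta> * I.Cpi) < c / 2" "k > 0"
    by (auto simp: eventually_sequentially)
  have rest: "(\<lambda>n. real k / (real n * I.h\<^sup>2) * (I.Cpi + 2 * real k * I.Kd) + (I.Cpi + 1) / (I.h * sqrt (real n))) \<longlonglongrightarrow> 0"
    using I.h_pos by real_asymp
  have "\<forall>\<^sub>F n in sequentially. real k / (real n * I.h\<^sup>2) * (I.Cpi + 2 * real k * I.Kd) + (I.Cpi + 1) / (I.h * sqrt (real n)) < c / 2"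
    using \<open>0 < c\<close> by (intro order_tendstoD(2)[OF rest]) simp
  then obtain N1 where N1: "\<And>n. n \<ge> N1 \<Longrightarrow>
      real k / (real n * I.h\<^sup>2) * (I.Cpi + 2 * real k * I.Kd) + (I.Cpi + 1) / (I.h * sqrt (real n)) < c / 2"
    by (auto simp: eventually_sequentially)
  have tv: "tv_dist (gibbs_law n (Y n) V a b0 (x0 n) k) (posterior n (Y n) V a b0) \<le> c"
    if n: "n \<ge> max N1 (max 10 N0)" for n
  proof -
    interpret R: gibbs_reg n "Y n" V a b0 \<delta> M
      using n by (intro reg) simp
    have n2: "n \<ge> 2" "n \<ge> max 2 N0" "n \<ge> N1" using n by auto
    \<comment> \<open>For these n the initial value of A is given by the first branch of
      \<open>A_init\<close>, which is As.\<close>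
    have "ssq n (Y n) / (real n - 1) > V" using lo[OF n2(2)] \<delta> by linarith
    then have "fst (x0 n) = R.As" using init n2 by (simp add: A_init_def R.As_def)
    then have "tv_dist (gibbs_law n (Y n) V a b0 (x0 n) k) (posterior n (Y n) V a b0) \<le> R.bound k (real n)"
      using init n2 k(2) by (intro R.tv_bound) (auto simp: R.Yb_def)
    also have "R.bound k (real n) \<le> c" unfolding R.bound_def using N1[OF n2(3)] k(1) by linarith
    finally show ?thesis .
  qed
  show ?thesis
  proof (intro exI allI impI conjI)
    fix n assume n: "n \<ge> max N1 (max 10 N0)"
    show "tv_dist (gibbs_law n (Y n) V a b0 (x0 n) k) (posterior n (Y n) V a b0) \<le> c"
      by (rule tv[OF n])
    show "Kc c n (Y n) V a b0 (x0 n) \<le> k"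
      unfolding Kc_def by (rule Least_le) (rule tv[OF n])
  qed
qed

end
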